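(* Let $M^6$ be a 6-manifold endowed with a nearly Kähler $\mathrm{SU}(3)$-structure $(\omega,\psi_\pm)$ with torsion $\sigma_0$, and let $c\in\mathbb R^*$. Then the one-parameter family of warped $\mathrm{G}_2$-structures on $M^6\times_f S^1$ given by $$\varphi(t)=\Big(1-\tfrac{3\sigma_0^2}{2}t\Big)^{3/2}\big(c\,\omega\wedge ds-\psi_-\big)\quad\text{and}\quad\ast_t\varphi(t)=\Big(1-\tfrac{3\sigma_0^2}{2}t\Big)^{2}\Big(\tfrac12\omega^2+c\,\psi_+\wedge ds\Big)$$ is a solution of the Laplacian coflow for $t\in\big(-\infty,\frac{2}{3\sigma_0^2}\big)$, where the warping function is $f(t)=c\big(1-\frac{3\sigma_0^2}{2}t\big)^{1/2}$.
   Context: An $\mathrm{SU}(3)$-structure on a 6-manifold $M^6$ is a triple $(\omega,\psi_+,\psi_-)$ of a 2-form and two 3-forms such that locally there is a coframe $\{e^1,\dots,e^6\}$ (an adapted basis) with $\omega=e^{12}+e^{34}+e^{56}$, $\psi_+=e^{135}-e^{146}-e^{236}-e^{245}$, $\psi_-=-e^{246}+e^{235}+e^{145}+e^{136}$, where $e^{ij}=e^i\wedge e^j$, etc. The induced metric $g_{\omega,\psi_\pm}$ is the one for which adapted bases are orthonormal, with volume form $vol_6=\frac1{3!}\omega^3$. The structure is nearly Kähler with torsion $\sigma_0$ (a nonzero real constant) if $$d\omega=-\tfrac32\sigma_0\psi_+,\qquad d\psi_+=0,\qquad d\psi_-=\sigma_0\omega^2.$$ Warped $\mathrm{G}_2$-structures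 (here with parameters $(\alpha,\beta)=(0,1)$): for an $\mathrm{SU}(3)$-structure $(\omega,\psi_\pm)$ on $M^6$ and a non-vanishing function $f$, with $s$ the coordinate on $S^1$, the 3-form $\varphi=f\,\omega\wedge ds-\psi_-$ on $M^6\times S^1$ is a $\mathrm{G}_2$-structure with metric $g_{\omega,\psi_\pm}+f^2ds^2$, volume form $f\,vol_6\wedge ds$, and Hodge dual $\frac12\omega^2+f\,\psi_+\wedge ds$. $M^6\times_f S^1$ denotes $M^6\times S^1$ with this warped metric. A family of $\mathrm{G}_2$-structures $\varphi(t)$ solves the Laplacian coflow if $\frac{\partial}{\partial t}(\ast_t\varphi(t))=-\Delta_t(\ast_t\varphi(t))$ and $d_7(\ast_t\varphi(t))=0$, where $d_7$ is the exterior derivative on the 7-manifold and $\ast_t$, $\Delta_t$ are the Hodge star and the Hodge Laplacian ($\Delta=dd^*+d^*d$) induced by $\varphi(t)$. *)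

theory Defs
  imports "HOL-Analysis.Analysis" "HOL-Library.Function_Algebras"
begin

section \<open>Smooth manifolds\<close>

text \<open>C^k on an open set; C^\<infinity> means C^k for all k.\<close>

fun Ck_on :: "nat \<Rightarrow> 'a::real_normed_vector set \<Rightarrow> ('a \<Rightarrow> 'b::real_normed_vector) \<Rightarrow> bool" where
  "Ck_on 0 S f \<longleftrightarrow> continuous_on S f"
| "Ck_on (Suc k) S f \<longleftrightarrow>
     (\<forall>x\<in>S. f differentiable (at x)) \<and> (\<forall>v. Ck_on k S (\<lambda>x. frechet_derivative f (at x) v))"

definition smooth_on :: "'a::real_normed_vector set \<Rightarrow> ('a \<Rightarrow> 'b::real_normed_vector) \<Rightarrow> bool" where
  "smooth_on S f \<longleftrightarrow> (\<forall>k. Ck_on k S f)"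

text \<open>A space together with an atlas, the charts being indexed by \<open>Index\<close>: the chart \<open>i\<close>
  maps \<open>Dom i\<close> to the model space by \<open>Coord i\<close>.\<close>

record ('i, 'p, 'e) manifold =
  Space :: "'p topology"
  Index :: "'i set"
  Dom :: "'i \<Rightarrow> 'p set"
  Coord :: "'i \<Rightarrow> 'p \<Rightarrow> 'e"

definition chart_image :: "('i, 'p, 'e) manifold \<Rightarrow> 'i \<Rightarrow> 'e set" where
  "chart_image M i = Coord M i ` Dom M i"

definition chart_inv :: "('i, 'p, 'e) manifold \<Rightarrow> 'i \<Rightarrow> 'e \<Rightarrow> 'p" where
  "chart_inv M i = inv_into (Dom M i) (Coord M i)"

definition transition :: "('i, 'p, 'e) manifold \<Rightarrow> 'i \<Rightarrow> 'i \<Rightarrow> 'e \<Rightarrow> 'e" where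
  "transition M i j = Coord M j \<circ> chart_inv M i"

definition smooth_manifold :: "('i, 'p, 'e::euclidean_space) manifold \<Rightarrow> bool" where
  "smooth_manifold M \<longleftrightarrow>
     Hausdorff_space (Space M) \<and> second_countable (Space M) \<and>
     topspace (Space M) = (\<Union>i\<in>Index M. Dom M i) \<and>
     (\<forall>i\<in>Index M. openin (Space M) (Dom M i) \<and> open (chart_image M i) \<and>
        homeomorphic_map (subtopology (Space M) (Dom M i)) (top_of_set (chart_image M i)) (Coord M i)) \<and>
     (\<forall>i\<in>Index M. \<forall>j\<in>Index M. smooth_on (Coord M i ` (Dom M i \<inter> Dom M j)) (transition M i j))"

definition product_manifold ::
  "('i, 'p, 'e) manifold \<Rightarrow> ('j, 'q, 'f) manifold \<Rightarrow> ('i \<times> 'j, 'p \<times> 'q, 'e \<times> 'f) manifold" where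
  "product_manifold M N =
     \<lparr>Space = prod_topology (Space M) (Space N),
      Index = Index M \<times> Index N,
      Dom = (\<lambda>(i, j). Dom M i \<times> Dom N j),
      Coord = (\<lambda>(i, j). map_prod (Coord M i) (Coord N j))\<rparr>"

text \<open>The chart \<open>a\<close> of the unit circle is the branch of the angle with values in
  the open interval from \<open>a\<close> to \<open>a + 2 * pi\<close>.\<close>

definition circle :: "(real, complex, real) manifold" where
  "circle =
     \<lparr>Space = top_of_set (sphere 0 1),
      Index = UNIV,
      Dom = (\<lambda>a. sphere 0 1 - {cis a}),
      Coord = (\<lambda>a. inv_into {a<..<a + 2 * pi} cis)\<rparr>"


section \<open>Exterior algebra of a vector space\<close>

text \<open>A k-covector on \<open>'e\<close> is an alternating k-linear function of the list of its arguments;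
  by convention it vanishes on lists whose length is not k.\<close>

type_synonym 'e covector = "'e list \<Rightarrow> real"

definition alternating :: "nat \<Rightarrow> ('e::real_vector) covector \<Rightarrow> bool" where
  "alternating k \<alpha> \<longleftrightarrow>
     (\<forall>vs. length vs \<noteq> k \<longrightarrow> \<alpha> vs = 0) \<and>
     (\<forall>vs i. length vs = k \<and> i < k \<longrightarrow> linear (\<lambda>v. \<alpha> (vs[i := v]))) \<and>
     (\<forall>vs i j. length vs = k \<and> i < j \<and> j < k \<and> vs ! i = vs ! j \<longrightarrow> \<alpha> vs = 0)"

text \<open>The wedge product as a signed sum over shuffles: \<open>I\<close> is the set of positions of the arguments
  passed to the first factor. If \<open>\<alpha>\<close> has degree p, only the sets \<open>I\<close> with p elements contribute.\<close>

definition shuffle_sign :: "nat \<Rightarrow> nat set \<Rightarrow> real" where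
  "shuffle_sign n I = (-1) ^ card {(i, j). i \<in> I \<and> j \<in> {..<n} - I \<and> j < i}"

definition wedge :: "'e covector \<Rightarrow> 'e covector \<Rightarrow> 'e covector" (infixr "\<and>\<^sub>w" 72) where
  "\<alpha> \<and>\<^sub>w \<beta> = (\<lambda>vs. \<Sum>I\<in>Pow {..<length vs}.
      shuffle_sign (length vs) I * \<alpha> (nths vs I) * \<beta> (nths vs (- I)))"

text \<open>\<open>monomial e [i, j, \<dots>]\<close> is the wedge product of \<open>e i\<close>, \<open>e j\<close>, \<open>\<dots>\<close>, i.e. \<open>e^{ij\<dots>}\<close>.\<close>

fun monomial :: "(nat \<Rightarrow> 'e covector) \<Rightarrow> nat list \<Rightarrow> 'e covector" where
  "monomial e [] = (\<lambda>vs. if vs = [] then 1 else 0)"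
| "monomial e [i] = e i"
| "monomial e (i # is) = e i \<and>\<^sub>w monomial e is"

definition coframe :: "nat \<Rightarrow> (nat \<Rightarrow> ('e::euclidean_space) covector) \<Rightarrow> bool" where
  "coframe n e \<longleftrightarrow> DIM('e) = n \<and> (\<forall>i\<in>{1..n}. alternating 1 (e i)) \<and>
     (\<forall>a. (\<forall>v. (\<Sum>i=1..n. a i * e i [v]) = 0) \<longrightarrow> (\<forall>i\<in>{1..n}. a i = 0))"

text \<open>The inner product for which the coframe is orthonormal.\<close>

definition coframe_metric :: "nat \<Rightarrow> (nat \<Rightarrow> 'e covector) \<Rightarrow> 'e \<Rightarrow> 'e \<Rightarrow> real" where
  "coframe_metric n e u v = (\<Sum>i=1..n. e i [u] * e i [v])"

text \<open>The metric dual of the linear form \<open>\<lambda>v. b \<bullet> v\<close>. For \<open>b \<in> Basis\<close> this form is the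
  coordinate differential \<open>dx^b\<close>.\<close>

definition sharp :: "('e \<Rightarrow> 'e \<Rightarrow> real) \<Rightarrow> 'e \<Rightarrow> ('e::euclidean_space)" where
  "sharp g b = (THE w. \<forall>v. g w v = b \<bullet> v)"

text \<open>Hodge star of a k-covector for the metric \<open>g\<close> and the volume element \<open>vol\<close>:
  contraction of \<open>vol\<close> with \<open>\<alpha>\<close> after raising all indices of \<open>\<alpha>\<close>, divided by \<open>k!\<close>.
  For an oriented orthonormal coframe it sends \<open>e^{1\<dots>k}\<close> to \<open>e^{k+1\<dots>n}\<close>.\<close>

definition hodge_star ::
  "('e \<Rightarrow> 'e \<Rightarrow> real) \<Rightarrow> 'e covector \<Rightarrow> nat \<Rightarrow> 'e covector \<Rightarrow> ('e::euclidean_space) covector" where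
  "hodge_star g vol k \<alpha> = (\<lambda>ws.
     (\<Sum>bs\<in>{bs. set bs \<subseteq> Basis \<and> length bs = k}. \<alpha> (map (sharp g) bs) * vol (bs @ ws)) / fact k)"


section \<open>Differential forms\<close>

text \<open>A form on a manifold is given by its local expressions, one for each chart.
  The value of the expression for the chart \<open>i\<close> is only relevant on \<open>chart_image M i\<close>.\<close>

type_synonym ('i, 'e) form = "'i \<Rightarrow> 'e \<Rightarrow> 'e covector"

definition differential_form ::
  "('i, 'p, 'e::euclidean_space) manifold \<Rightarrow> nat \<Rightarrow> ('i, 'e) form \<Rightarrow> bool" where
  "differential_form M k \<alpha> \<longleftrightarrow>
     (\<forall>i\<in>Index M. \<forall>x\<in>chart_image M i. alternating k (\<alpha> i x)) \<and>
     (\<forall>i\<in>Index M. \<forall>vs. smooth_on (chart_image M i) (\<lambda>x. \<alpha> i x vs)) \<and>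
     (\<forall>i\<in>Index M. \<forall>j\<in>Index M. \<forall>x\<in>Coord M i ` (Dom M i \<inter> Dom M j). \<forall>vs.
        \<alpha> i x vs =
        \<alpha> j (transition M i j x) (map (frechet_derivative (transition M i j) (at x)) vs))"

definition form_eq ::
  "('i, 'p, 'e) manifold \<Rightarrow> ('i, 'e) form \<Rightarrow> ('i, 'e) form \<Rightarrow> bool" where
  "form_eq M \<alpha> \<beta> \<longleftrightarrow> (\<forall>i\<in>Index M. \<forall>x\<in>chart_image M i. \<alpha> i x = \<beta> i x)"

definition form_wedge :: "('i, 'e) form \<Rightarrow> ('i, 'e) form \<Rightarrow> ('i, 'e) form" (infixr "\<and>\<^sub>f" 72) where
  "\<alpha> \<and>\<^sub>f \<beta> = (\<lambda>i x. \<alpha> i x \<and>\<^sub>w \<beta> i x)"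

definition form_scale :: "real \<Rightarrow> ('i, 'e) form \<Rightarrow> ('i, 'e) form" (infixr "\<cdot>\<^sub>f" 71) where
  "a \<cdot>\<^sub>f \<alpha> = (\<lambda>i x vs. a * \<alpha> i x vs)"

definition form_mult ::
  "('i, 'p, 'e) manifold \<Rightarrow> ('p \<Rightarrow> real) \<Rightarrow> ('i, 'e) form \<Rightarrow> ('i, 'e) form" where
  "form_mult M f \<alpha> = (\<lambda>i x vs. f (chart_inv M i x) * \<alpha> i x vs)"

definition exterior_derivative ::
  "('i, 'e::real_normed_vector) form \<Rightarrow> ('i, 'e) form" where
  "exterior_derivative \<alpha> = (\<lambda>i x vs. \<Sum>k<length vs.
     (-1) ^ k * frechet_derivative (\<lambda>y. \<alpha> i y (take k vs @ drop (Suc k) vs)) (at x) (vs ! k))"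

text \<open>Pullback along the projection \<open>M \<times> S^1 \<rightarrow> M\<close>, and the form \<open>ds\<close> for the
  angular coordinate \<open>s\<close> of the circle.\<close>

definition pull :: "('i, 'e) form \<Rightarrow> ('i \<times> real, 'e \<times> real) form" where
  "pull \<alpha> = (\<lambda>(i, a) (x, s) vs. \<alpha> i x (map fst vs))"

definition ds :: "('i \<times> real, 'e \<times> real) form" where
  "ds = (\<lambda>(i, a) (x, s) vs. if length vs = 1 then snd (hd vs) else 0)"


section \<open>SU(3)-structures\<close>

definition su3_adapted ::
  "(nat \<Rightarrow> 'e covector) \<Rightarrow> 'e covector \<Rightarrow> 'e covector \<Rightarrow> ('e::euclidean_space) covector \<Rightarrow> bool" where
  "su3_adapted e \<omega> \<psi>p \<psi>m \<longleftrightarrow> coframe 6 e \<and>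
     \<omega> = monomial e [1,2] + monomial e [3,4] + monomial e [5,6] \<and>
     \<psi>p = monomial e [1,3,5] - monomial e [1,4,6] - monomial e [2,3,6] - monomial e [2,4,5] \<and>
     \<psi>m = - monomial e [2,4,6] + monomial e [2,3,5] + monomial e [1,4,5] + monomial e [1,3,6]"

definition su3_structure ::
  "('i, 'p, 'e::euclidean_space) manifold \<Rightarrow> ('i, 'e) form \<Rightarrow> ('i, 'e) form \<Rightarrow> ('i, 'e) form \<Rightarrow> bool" where
  "su3_structure M \<omega> \<psi>p \<psi>m \<longleftrightarrow>
     differential_form M 2 \<omega> \<and> differential_form M 3 \<psi>p \<and> differential_form M 3 \<psi>m \<and>
     (\<forall>i\<in>Index M. \<forall>x\<in>chart_image M i. \<exists>N e.
        open N \<and> x \<in> N \<and> N \<subseteq> chart_image M i \<and>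
        (\<forall>k\<in>{1..6}. \<forall>vs. smooth_on N (\<lambda>y. e k y vs)) \<and>
        (\<forall>y\<in>N. su3_adapted (\<lambda>k. e k y) (\<omega> i y) (\<psi>p i y) (\<psi>m i y)))"

definition su3_metric ::
  "'e covector \<Rightarrow> 'e covector \<Rightarrow> 'e covector \<Rightarrow> 'e \<Rightarrow> ('e::euclidean_space) \<Rightarrow> real" where
  "su3_metric \<omega> \<psi>p \<psi>m = (THE g. \<exists>e. su3_adapted e \<omega> \<psi>p \<psi>m \<and> g = coframe_metric 6 e)"

definition vol6 :: "('i, 'e) form \<Rightarrow> ('i, 'e) form" where
  "vol6 \<omega> = (1 / fact 3) \<cdot>\<^sub>f (\<omega> \<and>\<^sub>f \<omega> \<and>\<^sub>f \<omega>)"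

definition nearly_Kaehler ::
  "('i, 'p, 'e::euclidean_space) manifold \<Rightarrow> real \<Rightarrow> ('i, 'e) form \<Rightarrow> ('i, 'e) form \<Rightarrow> ('i, 'e) form \<Rightarrow> bool" where
  "nearly_Kaehler M \<sigma>0 \<omega> \<psi>p \<psi>m \<longleftrightarrow> su3_structure M \<omega> \<psi>p \<psi>m \<and> \<sigma>0 \<noteq> 0 \<and>
     form_eq M (exterior_derivative \<omega>) ((- (3 / 2) * \<sigma>0) \<cdot>\<^sub>f \<psi>p) \<and>
     form_eq M (exterior_derivative \<psi>p) 0 \<and>
     form_eq M (exterior_derivative \<psi>m) (\<sigma>0 \<cdot>\<^sub>f (\<omega> \<and>\<^sub>f \<omega>))"


section \<open>G2-structures and the Laplacian coflow\<close>

definition g2_adapted :: "(nat \<Rightarrow> 'e covector) \<Rightarrow> ('e::euclidean_space) covector \<Rightarrow> bool" where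
  "g2_adapted e \<phi> \<longleftrightarrow> coframe 7 e \<and>
     \<phi> = monomial e [1,2,7] + monomial e [3,4,7] + monomial e [5,6,7]
       + monomial e [1,3,5] - monomial e [1,4,6] - monomial e [2,3,6] - monomial e [2,4,5]"

definition g2_structure :: "('i, 'p, 'e::euclidean_space) manifold \<Rightarrow> ('i, 'e) form \<Rightarrow> bool" where
  "g2_structure M \<phi> \<longleftrightarrow> differential_form M 3 \<phi> \<and>
     (\<forall>i\<in>Index M. \<forall>x\<in>chart_image M i. \<exists>N e.
        open N \<and> x \<in> N \<and> N \<subseteq> chart_image M i \<and>
        (\<forall>k\<in>{1..7}. \<forall>vs. smooth_on N (\<lambda>y. e k y vs)) \<and>
        (\<forall>y\<in>N. g2_adapted (\<lambda>k. e k y) (\<phi> i y)))"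

text \<open>The metric and volume element induced by a G2-structure: those for which the adapted coframes
  are orthonormal and positively oriented. They do not depend on the adapted coframe because the
  stabiliser of the model 3-form in GL(7) is contained in SO(7).\<close>

definition g2_metric :: "('e::euclidean_space) covector \<Rightarrow> 'e \<Rightarrow> 'e \<Rightarrow> real" where
  "g2_metric \<phi> = (THE g. \<exists>e. g2_adapted e \<phi> \<and> g = coframe_metric 7 e)"

definition g2_volume :: "('e::euclidean_space) covector \<Rightarrow> 'e covector" where
  "g2_volume \<phi> = (THE \<nu>. \<exists>e. g2_adapted e \<phi> \<and> \<nu> = monomial e [1,2,3,4,5,6,7])"

text \<open>In the following operators \<open>k\<close> is the degree of the form. The sign of the codifferential is
  that of \<open>d^* = (-1)^{n(k+1)+1} * d *\<close> with n = 7.\<close>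

definition g2_star ::
  "('i, 'e::euclidean_space) form \<Rightarrow> nat \<Rightarrow> ('i, 'e) form \<Rightarrow> ('i, 'e) form" where
  "g2_star \<phi> k \<alpha> = (\<lambda>i x. hodge_star (g2_metric (\<phi> i x)) (g2_volume (\<phi> i x)) k (\<alpha> i x))"

definition g2_codiff ::
  "('i, 'e::euclidean_space) form \<Rightarrow> nat \<Rightarrow> ('i, 'e) form \<Rightarrow> ('i, 'e) form" where
  "g2_codiff \<phi> k \<alpha> =
     ((-1) ^ (7 * (k + 1) + 1)) \<cdot>\<^sub>f g2_star \<phi> (7 - k + 1) (exterior_derivative (g2_star \<phi> k \<alpha>))"

definition g2_laplacian ::
  "('i, 'e::euclidean_space) form \<Rightarrow> nat \<Rightarrow> ('i, 'e) form \<Rightarrow> ('i, 'e) form" where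
  "g2_laplacian \<phi> k \<alpha> =
     exterior_derivative (g2_codiff \<phi> k \<alpha>) + g2_codiff \<phi> (k + 1) (exterior_derivative \<alpha>)"

definition laplacian_coflow ::
  "('i, 'p, 'e::euclidean_space) manifold \<Rightarrow> real set \<Rightarrow> (real \<Rightarrow> ('i, 'e) form) \<Rightarrow> bool" where
  "laplacian_coflow M T \<phi> \<longleftrightarrow> (\<forall>t\<in>T.
     g2_structure M (\<phi> t) \<and>
     (\<forall>i\<in>Index M. \<forall>x\<in>chart_image M i. \<forall>vs.
        ((\<lambda>\<tau>. g2_star (\<phi> \<tau>) 3 (\<phi> \<tau>) i x vs) has_real_derivative
           - g2_laplacian (\<phi> t) 4 (g2_star (\<phi> t) 3 (\<phi> t)) i x vs) (at t within T)) \<and>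
     form_eq M (exterior_derivative (g2_star (\<phi> t) 3 (\<phi> t))) 0)"


section \<open>Warped G2-structures\<close>

definition warped_3form ::
  "('i, 'p, 'e) manifold \<Rightarrow> ('p \<Rightarrow> real) \<Rightarrow> ('i, 'e) form \<Rightarrow> ('i, 'e) form \<Rightarrow> ('i \<times> real, 'e \<times> real) form" where
  "warped_3form M f \<omega> \<psi>m =
     form_mult (product_manifold M circle) (f \<circ> fst) (pull \<omega> \<and>\<^sub>f ds) - pull \<psi>m"

text \<open>\<open>\<phi>\<close> is the warped G2-structure on \<open>M \<times>\<^sub>f S^1\<close> determined by the SU(3)-structure
  \<open>(\<omega>, \<psi>p, \<psi>m)\<close> and the warping function \<open>f\<close>; its metric and volume form are
  \<open>g + f\<^sup>2 ds\<^sup>2\<close> and \<open>f vol6 \<and> ds\<close>.\<close>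

definition warped_g2_structure ::
  "('i, 'p, 'e::euclidean_space) manifold \<Rightarrow> ('p \<Rightarrow> real) \<Rightarrow> ('i, 'e) form \<Rightarrow> ('i, 'e) form \<Rightarrow> ('i, 'e) form
     \<Rightarrow> ('i \<times> real, 'e \<times> real) form \<Rightarrow> bool" where
  "warped_g2_structure M f \<omega> \<psi>p \<psi>m \<phi> \<longleftrightarrow>
     su3_structure M \<omega> \<psi>p \<psi>m \<and>
     (\<forall>p\<in>topspace (Space M). f p \<noteq> 0) \<and>
     (\<forall>i\<in>Index M. smooth_on (chart_image M i) (f \<circ> chart_inv M i)) \<and>
     g2_structure (product_manifold M circle) \<phi> \<and>
     form_eq (product_manifold M circle) \<phi> (warped_3form M f \<omega> \<psi>m) \<and>
     (\<forall>i\<in>Index M. \<forall>a. \<forall>(x, s)\<in>chart_image (product_manifold M circle) (i, a).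
        g2_metric (\<phi> (i, a) (x, s)) = (\<lambda>(u, h) (v, k).
          su3_metric (\<omega> i x) (\<psi>p i x) (\<psi>m i x) u v + (f (chart_inv M i x))\<^sup>2 * h * k)) \<and>
     form_eq (product_manifold M circle) (\<lambda>j y. g2_volume (\<phi> j y))
       (form_mult (product_manifold M circle) (f \<circ> fst) (pull (vol6 \<omega>) \<and>\<^sub>f ds))"

end

theory Submission
  imports Defs
begin

text \<open>
  Multiplying an adapted coframe of \<open>M\<close> by a constant \<open>r\<close> turns \<open>(\<omega>, \<psi>p, \<psi>m)\<close> into
  \<open>(r\<^sup>2 \<omega>, r\<^sup>3 \<psi>p, r\<^sup>3 \<psi>m)\<close>. With \<open>r\<^sup>2 = h t\<close>, the form \<open>\<phi> t\<close> is therefore the warped 3-form of a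
  rescaled SU(3)-structure with the constant warping function \<open>c * r\<close>, and everything about it can be
  computed pointwise in one coframe. Write \<open>\<Phi> = \<omega>\<^sup>2 / 2 + c \<psi>p \<and> ds\<close>. Pointwise the star of \<open>\<phi> t\<close>
  is \<open>r\<^sup>4 \<Phi>\<close> (\<open>coflow_stars\<close>), which is closed because \<open>\<omega> \<and> d\<omega>\<close> is a multiple of
  \<open>\<omega> \<and> \<psi>p = 0\<close> and \<open>d\<psi>p = 0\<close>. So only the summand \<open>d d\<^sup>*\<close> of the Laplacian contributes, and the
  torsion equations give
  \<open>d \<phi> = - r\<^sup>3 (3/2 c \<sigma>0 \<psi>p \<and> ds + \<sigma>0 \<omega>\<^sup>2)\<close>, then
  \<open>* d \<phi> = r\<^sup>2 (3/2 \<sigma>0 \<psi>m - 2 c \<sigma>0 \<omega> \<and> ds)\<close>, and after one more derivative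
  \<open>\<Delta> (r\<^sup>4 \<Phi>) = 3 \<sigma>0\<^sup>2 r\<^sup>2 \<Phi>\<close> (\<open>coflow_laplacian\<close>). Hence the form \<open>h\<^sup>2 \<Phi>\<close>
  solves the flow exactly when \<open>2 h h' = - 3 \<sigma>0\<^sup>2 h\<close>, which is how the affine function \<open>h\<close> arises.

  Three pieces of general theory support this computation.

  The wedge product, a sum over shuffles, obeys a Leibniz rule for inserting a vector in the first slot
  (\<open>wedge_Cons\<close>). Associativity, alternation and the Leibniz rule of the exterior derivative all
  follow from it by induction on the list of arguments, and calculations with products of one-forms
  become sorting of indices.

  The Hodge star is a sum over a coordinate basis. The sum may be taken over the frame dual to an
  orthonormal coframe instead (\<open>sharp_contraction\<close>), and then the star of a monomial is the
  complementary monomial (\<open>hodge_star_monomial\<close>).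

  The metric and the volume of a G2-structure are defined as the ones of any adapted coframe, so they
  must be independent of the coframe (\<open>g2_adapted_unique\<close>). This rests on Bryant's formula
  \<open>contract u \<phi> \<and> contract w \<phi> \<and> \<phi> = 6 g(u, w) vol\<close>, which determines the metric up to a factor; comparing the
  norm of \<open>\<phi>\<close> in the two metrics shows that the factor is 1. Uniqueness of the SU(3) metric follows by
  adding a line to the tangent space.
\<close>

section \<open>The wedge product as a derivation in its first argument\<close>

definition contract :: "'e \<Rightarrow> 'e covector \<Rightarrow> 'e covector" where
  "contract v \<alpha> = (\<lambda>vs. \<alpha> (v # vs))"

text \<open>The grading involution: the sign that a covector contributes when a vector or a one-form
  is moved past it. With it the signs of the Leibniz rules below do not mention degrees.\<close>

definition parity :: "'e covector \<Rightarrow> 'e covector" where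
  "parity \<alpha> = (\<lambda>vs. (-1) ^ length vs * \<alpha> vs)"

definition cov_scale :: "real \<Rightarrow> 'e covector \<Rightarrow> 'e covector" (infixr "\<cdot>\<^sub>c" 71) where
  "a \<cdot>\<^sub>c \<alpha> = (\<lambda>vs. a * \<alpha> vs)"

lemma cov_scale_apply: "(a \<cdot>\<^sub>c \<alpha>) vs = a * \<alpha> vs" by (simp add: cov_scale_def)

lemma wedge_Nil: "(\<alpha> \<and>\<^sub>w \<beta>) [] = \<alpha> [] * \<beta> []"
  by (simp add: wedge_def shuffle_sign_def)

lemma Pow_lessThan_Suc_decomp:
  "Pow {..<Suc n} = (\<lambda>I. insert 0 (Suc ` I)) ` Pow {..<n} \<union> ((`) Suc) ` Pow {..<n}"
proof (intro equalityI subsetI)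
  fix J assume J: "J \<in> Pow {..<Suc n}"
  define I where "I = {i. Suc i \<in> J}"
  have "I \<in> Pow {..<n}" using J by (auto simp: I_def)
  moreover have "J = (if 0 \<in> J then insert 0 (Suc ` I) else Suc ` I)"
  proof -
    have "x \<in> Suc ` I" if "x \<in> J" "x \<noteq> 0" for x
      using that by (cases x) (auto simp: I_def)
    then show ?thesis by (auto simp: I_def)
  qed
  ultimately show "J \<in> (\<lambda>I. insert 0 (Suc ` I)) ` Pow {..<n} \<union> ((`) Suc) ` Pow {..<n}"
    by (metis UnI1 UnI2 image_eqI)
qed auto

text \<open>The first argument goes to the first factor: position 0 lies before all others and adds
  no inversion.\<close>

lemma shuffle_sign_insert_zero:
  assumes "I \<subseteq> {..<n}" shows "shuffle_sign (Suc n) (insert 0 (Suc ` I)) = shuffle_sign n I"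
proof -
  have "{(i, j). i \<in> insert 0 (Suc ` I) \<and> j \<in> {..<Suc n} - insert 0 (Suc ` I) \<and> j < i}
      = map_prod Suc Suc ` {(i, j). i \<in> I \<and> j \<in> {..<n} - I \<and> j < i}" (is "?L = ?R")
  proof (intro equalityI subsetI)
    fix p assume "p \<in> ?L"
    then obtain i j where p: "p = (i, j)" "i \<in> Suc ` I" "j < Suc n" "j \<noteq> 0" "j \<notin> Suc ` I" "j < i"
      by auto
    then obtain j' where "j = Suc j'" by (cases j) auto
    with p show "p \<in> ?R" by auto
  qed auto
  then show ?thesis unfolding shuffle_sign_def
    by (simp add: card_image inj_on_def)
qed

text \<open>The first argument goes to the second factor: it is overtaken by every argument of the
  first factor.\<close>

lemma shuffle_sign_Suc_image:
  assumes "I \<subseteq> {..<n}" shows "shuffle_sign (Suc n) (Suc ` I) = (-1) ^ card I * shuffle_sign n I"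
proof -
  have fin: "finite I" using assms finite_subset by blast
  have "{(i, j). i \<in> Suc ` I \<and> j \<in> {..<Suc n} - Suc ` I \<and> j < i}
      = (\<lambda>i. (Suc i, 0)) ` I \<union> map_prod Suc Suc ` {(i, j). i \<in> I \<and> j \<in> {..<n} - I \<and> j < i}" (is "?L = ?R")
  proof (intro equalityI subsetI)
    fix p assume "p \<in> ?L"
    then obtain i j where p: "p = (Suc i, j)" "i \<in> I" "j < Suc n" "j \<notin> Suc ` I" "j < Suc i"
      by auto
    then show "p \<in> ?R" by (cases j) auto
  qed auto
  moreover have "card ?R = card I + card {(i, j). i \<in> I \<and> j \<in> {..<n} - I \<and> j < i}"
  proof (subst card_Un_disjoint)
    have "finite {(i, j). i \<in> I \<and> j \<in> {..<n} - I \<and> j < i}"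
      by (rule finite_subset[of _ "I \<times> {..<n}"]) (use fin in auto)
    then show "finite (map_prod Suc Suc ` {(i, j). i \<in> I \<and> j \<in> {..<n} - I \<and> j < i})" by simp
  qed (use fin in \<open>auto simp: card_image inj_on_def\<close>)
  ultimately show ?thesis unfolding shuffle_sign_def by (simp add: power_add)
qed

text \<open>The shuffles split according to the factor that receives the first argument. Together
  with \<open>wedge_Nil\<close> this determines the product, so that identities between products can
  be proved by induction on the list of arguments.\<close>

lemma wedge_Cons:
  "(\<alpha> \<and>\<^sub>w \<beta>) (v # vs) = (contract v \<alpha> \<and>\<^sub>w \<beta>) vs + (parity \<alpha> \<and>\<^sub>w contract v \<beta>) vs"
proof -
  let ?n = "length vs"
  let ?g = "\<lambda>I. shuffle_sign (Suc ?n) I * \<alpha> (nths (v # vs) I) * \<beta> (nths (v # vs) (- I))"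
  have inj: "inj_on (\<lambda>I. insert 0 (Suc ` I)) (Pow {..<?n})" "inj_on ((`) Suc) (Pow {..<?n})"
    by (auto simp: inj_on_def)
  have pre: "{j. Suc j \<in> insert 0 (Suc ` I)} = I" "{j. Suc j \<in> - insert 0 (Suc ` I)} = - I"
    "{j. Suc j \<in> Suc ` I} = I" "{j. Suc j \<in> - Suc ` I} = - I" "{j. Suc j \<notin> Suc ` I} = - I" for I
    by auto
  \<comment> \<open>The sign \<open>(-1) ^ card I\<close> is the one that \<open>parity \<alpha>\<close> reads off from the length of its argument list.\<close>
  have card_nths: "card I = length (nths vs I)" if "I \<subseteq> {..<?n}" for I
    using that by (auto simp: length_nths intro!: arg_cong[where f = card])
  have "(\<alpha> \<and>\<^sub>w \<beta>) (v # vs) = sum ?g (Pow {..<Suc ?n})" by (simp add: wedge_def)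
  also have "\<dots> = sum ?g ((\<lambda>I. insert 0 (Suc ` I)) ` Pow {..<?n}) + sum ?g (((`) Suc) ` Pow {..<?n})"
    unfolding Pow_lessThan_Suc_decomp by (rule sum.union_disjoint) auto
  also have "sum ?g ((\<lambda>I. insert 0 (Suc ` I)) ` Pow {..<?n}) = (contract v \<alpha> \<and>\<^sub>w \<beta>) vs"
    by (subst sum.reindex[OF inj(1)])
      (auto simp: wedge_def contract_def nths_Cons pre shuffle_sign_insert_zero intro!: sum.cong)
  also have "sum ?g (((`) Suc) ` Pow {..<?n}) = (parity \<alpha> \<and>\<^sub>w contract v \<beta>) vs"
    by (subst sum.reindex[OF inj(2)])
      (auto simp: wedge_def contract_def parity_def nths_Cons pre shuffle_sign_Suc_image card_nths
        intro!: sum.cong)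
  finally show ?thesis .
qed

lemma covector_eqI: "\<alpha> [] = \<beta> [] \<Longrightarrow> (\<And>v. contract v \<alpha> = contract v \<beta>) \<Longrightarrow> \<alpha> = \<beta>"
  by (rule ext) (metis contract_def list.exhaust)

lemma wedge_add_left: "(\<alpha> + \<alpha>') \<and>\<^sub>w \<beta> = \<alpha> \<and>\<^sub>w \<beta> + \<alpha>' \<and>\<^sub>w \<beta>"
  and wedge_add_right: "\<alpha> \<and>\<^sub>w (\<beta> + \<beta>') = \<alpha> \<and>\<^sub>w \<beta> + \<alpha> \<and>\<^sub>w \<beta>'"
  and wedge_scale_left: "(a \<cdot>\<^sub>c \<alpha>) \<and>\<^sub>w \<beta> = a \<cdot>\<^sub>c (\<alpha> \<and>\<^sub>w \<beta>)"
  and wedge_scale_right: "\<alpha> \<and>\<^sub>w (a \<cdot>\<^sub>c \<beta>) = a \<cdot>\<^sub>c (\<alpha> \<and>\<^sub>w \<beta>)"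
  and wedge_minus_left: "(- \<alpha>) \<and>\<^sub>w \<beta> = - (\<alpha> \<and>\<^sub>w \<beta>)"
  and wedge_minus_right: "\<alpha> \<and>\<^sub>w (- \<beta>) = - (\<alpha> \<and>\<^sub>w \<beta>)"
  and wedge_diff_left: "(\<alpha> - \<alpha>') \<and>\<^sub>w \<beta> = \<alpha> \<and>\<^sub>w \<beta> - \<alpha>' \<and>\<^sub>w \<beta>"
  and wedge_diff_right: "\<alpha> \<and>\<^sub>w (\<beta> - \<beta>') = \<alpha> \<and>\<^sub>w \<beta> - \<alpha> \<and>\<^sub>w \<beta>'"
  and wedge_zero_left: "0 \<and>\<^sub>w \<beta> = 0"
  and wedge_zero_right: "\<alpha> \<and>\<^sub>w 0 = 0"
  by (rule ext, simp add: wedge_def cov_scale_def algebra_simps sum.distrib sum_subtractf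
      sum_distrib_left sum_negf)+

lemmas wedge_bilinear = wedge_add_left wedge_add_right wedge_scale_left wedge_scale_right
  wedge_minus_left wedge_minus_right wedge_diff_left wedge_diff_right wedge_zero_left wedge_zero_right

lemma contract_wedge: "contract v (\<alpha> \<and>\<^sub>w \<beta>) = contract v \<alpha> \<and>\<^sub>w \<beta> + parity \<alpha> \<and>\<^sub>w contract v \<beta>"
  by (rule ext) (simp add: contract_def[of v "_ \<and>\<^sub>w _"] wedge_Cons)

lemma contract_linear:
  "contract v (\<alpha> + \<beta>) = contract v \<alpha> + contract v \<beta>"
  "contract v (\<alpha> - \<beta>) = contract v \<alpha> - contract v \<beta>"
  "contract v (- \<alpha>) = - contract v \<alpha>"
  "contract v 0 = 0"
  "contract v (a \<cdot>\<^sub>c \<alpha>) = a \<cdot>\<^sub>c contract v \<alpha>"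
  by (rule ext, simp add: contract_def cov_scale_def)+

lemma parity_linear:
  "parity (\<alpha> + \<beta>) = parity \<alpha> + parity \<beta>"
  "parity (\<alpha> - \<beta>) = parity \<alpha> - parity \<beta>"
  "parity (- \<alpha>) = - parity \<alpha>"
  "parity 0 = 0"
  "parity (a \<cdot>\<^sub>c \<alpha>) = a \<cdot>\<^sub>c parity \<alpha>"
  by (rule ext, simp add: parity_def cov_scale_def algebra_simps)+

lemma parity_parity: "parity (parity \<alpha>) = \<alpha>"
  by (rule ext) (simp add: parity_def mult.assoc[symmetric] power_add[symmetric])

lemma contract_parity: "contract v (parity \<alpha>) = - parity (contract v \<alpha>)"
  by (rule ext) (simp add: parity_def contract_def)

lemma parity_wedge: "parity (\<alpha> \<and>\<^sub>w \<beta>) = parity \<alpha> \<and>\<^sub>w parity \<beta>"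
proof -
  have "parity (\<alpha> \<and>\<^sub>w \<beta>) vs = (parity \<alpha> \<and>\<^sub>w parity \<beta>) vs" for vs
  proof (induction vs arbitrary: \<alpha> \<beta>)
    case Nil then show ?case by (simp add: wedge_Nil parity_def)
  next
    case (Cons v vs)
    have "parity (\<alpha> \<and>\<^sub>w \<beta>) (v # vs) = - parity (contract v (\<alpha> \<and>\<^sub>w \<beta>)) vs"
      by (simp add: parity_def contract_def)
    then show ?case
      by (simp add: contract_wedge parity_linear Cons contract_parity wedge_Cons wedge_bilinear)
  qed
  then show ?thesis by auto
qed

text \<open>By the Leibniz rule both sides produce the same three terms when the first argument is
  split off, so that the induction does not involve shuffles of three blocks.\<close>

lemma wedge_assoc: "(\<alpha> \<and>\<^sub>w \<beta>) \<and>\<^sub>w \<gamma> = \<alpha> \<and>\<^sub>w \<beta> \<and>\<^sub>w \<gamma>"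
proof -
  have "((\<alpha> \<and>\<^sub>w \<beta>) \<and>\<^sub>w \<gamma>) vs = (\<alpha> \<and>\<^sub>w \<beta> \<and>\<^sub>w \<gamma>) vs" for vs
  proof (induction vs arbitrary: \<alpha> \<beta> \<gamma>)
    case Nil then show ?case by (simp add: wedge_Nil)
  next
    case (Cons v vs)
    then show ?case
      by (simp add: wedge_Cons contract_wedge parity_wedge wedge_bilinear)
  qed
  then show ?thesis by auto
qed

lemma wedge_map:
  "(\<alpha> \<and>\<^sub>w \<beta>) (map f vs) = ((\<lambda>us. \<alpha> (map f us)) \<and>\<^sub>w (\<lambda>us. \<beta> (map f us))) vs"
  by (simp add: wedge_def nths_map)

lemma alternating_length: "alternating k \<alpha> \<Longrightarrow> length vs \<noteq> k \<Longrightarrow> \<alpha> vs = 0"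
  by (simp add: alternating_def)

lemma alternating_contract:
  assumes "alternating (Suc k) \<alpha>" shows "alternating k (contract v \<alpha>)"
  unfolding alternating_def contract_def
proof (intro conjI allI impI)
  fix vs :: "'a list" and i assume *: "length vs = k \<and> i < k"
  have "linear (\<lambda>w. \<alpha> ((v # vs)[Suc i := w]))"
    using assms * unfolding alternating_def by (metis Suc_less_eq length_Cons)
  then show "linear (\<lambda>w. \<alpha> (v # vs[i := w]))" by simp
next
  fix vs :: "'a list" and i j assume *: "length vs = k \<and> i < j \<and> j < k \<and> vs ! i = vs ! j"
  then have "length (v # vs) = Suc k \<and> Suc i < Suc j \<and> Suc j < Suc k \<and> (v # vs) ! Suc i = (v # vs) ! Suc j"
    by simp
  then show "\<alpha> (v # vs) = 0" using assms unfolding alternating_def by blast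
qed (use assms in \<open>auto simp: alternating_def\<close>)

lemma alternating_linear_first:
  assumes "alternating k \<alpha>" shows "linear (\<lambda>v. \<alpha> (v # vs))"
proof (cases "length vs + 1 = k")
  case True
  have "linear (\<lambda>w. \<alpha> ((undefined # vs)[0 := w]))"
    using assms True unfolding alternating_def
    by (metis Suc_eq_plus1 length_Cons zero_less_Suc)
  then show ?thesis by simp
next
  case False
  then have "(\<lambda>v. \<alpha> (v # vs)) = (\<lambda>v. 0)" using assms by (auto simp: alternating_def)
  then show ?thesis by (simp add: linear_iff)
qed

lemma alternating_repeat:
  assumes "alternating k \<alpha>" shows "\<alpha> (v # v # vs) = 0"
proof (cases "length vs + 2 = k")
  case True
  then have "length (v # v # vs) = k \<and> 0 < (1::nat) \<and> 1 < k \<and> (v # v # vs) ! 0 = (v # v # vs) ! 1"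
    by simp
  then show ?thesis using assms unfolding alternating_def by blast
qed (use assms in \<open>auto simp: alternating_def\<close>)

lemma swap_if_linear_repeat:
  assumes "\<And>us. linear (\<lambda>v. \<alpha> (v # us))" and "\<And>w us. linear (\<lambda>v. \<alpha> (w # v # us))"
    and "\<And>v us. \<alpha> (v # v # us) = (0::real)"
  shows "\<alpha> (v # w # vs) = - \<alpha> (w # v # vs)"
proof -
  have "0 = \<alpha> ((v + w) # (v + w) # vs)" using assms(3) by simp
  also have "\<dots> = \<alpha> (v # (v + w) # vs) + \<alpha> (w # (v + w) # vs)"
    by (rule linear_add[OF assms(1)])
  also have "\<dots> = \<alpha> (v # w # vs) + \<alpha> (w # v # vs)"
    using linear_add[OF assms(2)[of v vs], of v w] linear_add[OF assms(2)[of w vs], of v w] assms(3)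
    by simp
  finally show ?thesis by simp
qed

text \<open>Alternation need only be tested on the first two arguments once it is known for all
  contractions: a repetition further back is moved to the tail by one exchange.\<close>

lemma alternating_SucI:
  fixes \<alpha> :: "'a::real_vector covector"
  assumes Nil: "\<alpha> [] = 0" and con: "\<And>v. alternating k (contract v \<alpha>)"
    and lin: "\<And>vs. linear (\<lambda>v. \<alpha> (v # vs))" and rep: "\<And>v vs. \<alpha> (v # v # vs) = 0"
  shows "alternating (Suc k) \<alpha>"
  unfolding alternating_def
proof (intro conjI allI impI)
  fix vs :: "'a list" assume "length vs \<noteq> Suc k"
  then show "\<alpha> vs = 0"
    using Nil alternating_length[OF con] by (cases vs) (auto simp: contract_def)
next
  fix vs :: "'a list" and i assume *: "length vs = Suc k \<and> i < Suc k"
  then obtain w us where vs: "vs = w # us" by (cases vs) auto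
  show "linear (\<lambda>v. \<alpha> (vs[i := v]))"
  proof (cases i)
    case 0 then show ?thesis using lin vs by simp
  next
    case (Suc i')
    have "linear (\<lambda>v. contract w \<alpha> (us[i' := v]))" using con * vs Suc unfolding alternating_def by simp
    then show ?thesis using vs Suc by (simp add: contract_def)
  qed
next
  have lin2: "linear (\<lambda>v. \<alpha> (w # v # us))" for w us
    using alternating_linear_first[OF con] by (simp add: contract_def)
  fix vs :: "'a list" and i j assume *: "length vs = Suc k \<and> i < j \<and> j < Suc k \<and> vs ! i = vs ! j"
  then obtain v us where vs: "vs = v # us" by (cases vs) auto
  from * obtain j' where j: "j = Suc j'" by (cases j) auto
  have con0: "\<alpha> (w # ws) = 0" if "length ws = k" "a < b" "b < k" "ws ! a = ws ! b" for w ws a b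
    using con[of w] that unfolding alternating_def contract_def by blast
  show "\<alpha> vs = 0"
  proof (cases i)
    case (Suc i')
    then show ?thesis using * vs j con0[of us i' j'] by auto
  next
    case 0
    then have v: "us ! j' = v" using * vs j by simp
    show ?thesis
    proof (cases us)
      case Nil then show ?thesis using * vs j by auto
    next
      case (Cons w ws)
      show ?thesis
      proof (cases j')
        case 0 then show ?thesis using v Cons vs rep by simp
      next
        case (Suc m)
        \<comment> \<open>Exchanging the first two arguments moves the repetition behind the first argument.\<close>
        have "\<alpha> (w # v # ws) = 0"
          by (rule con0[of "v # ws" 0 "Suc m"]) (use * vs j Cons v Suc in auto)
        then show ?thesis
          using swap_if_linear_repeat[of \<alpha> v w ws, OF lin lin2 rep] vs Cons by simp
      qed
    qed
  qed
qed

lemma alternating_swap: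
  assumes "alternating k \<alpha>" shows "\<alpha> (v # w # vs) = - \<alpha> (w # v # vs)"
proof (cases k)
  case 0 then show ?thesis using assms by (simp add: alternating_def)
next
  case (Suc m)
  show ?thesis
  proof (rule swap_if_linear_repeat)
    fix u us show "linear (\<lambda>v. \<alpha> (u # v # us))"
      using alternating_linear_first[OF alternating_contract[OF assms[unfolded Suc]]]
      by (simp add: contract_def)
  qed (use assms alternating_linear_first alternating_repeat in auto)
qed

lemma alternating_0_contract: "alternating 0 \<alpha> \<Longrightarrow> contract v \<alpha> = 0"
  by (rule ext) (simp add: contract_def alternating_def)

lemma alternating_zero: "alternating k (0 :: 'e::real_vector covector)"
proof -
  have "linear (\<lambda>v :: 'e. 0 :: real)" by (rule linearI) auto
  then show ?thesis by (simp add: alternating_def)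
qed

lemma alternating_add: "alternating k \<alpha> \<Longrightarrow> alternating k \<beta> \<Longrightarrow> alternating k (\<alpha> + \<beta>)"
  unfolding alternating_def by (auto intro: linear_compose_add)

lemma alternating_scale: "alternating k \<alpha> \<Longrightarrow> alternating k (a \<cdot>\<^sub>c \<alpha>)"
  unfolding alternating_def cov_scale_def
  by (auto simp flip: scaleR_conv_of_real real_scaleR_def intro: linear_compose_scale_right)

lemma uminus_as_scale: "- \<alpha> = (-1) \<cdot>\<^sub>c \<alpha>" and diff_as_scale: "\<alpha> - \<beta> = \<alpha> + (-1) \<cdot>\<^sub>c \<beta>"
  by (rule ext, simp add: cov_scale_def)+

lemma alternating_parity: "alternating k \<alpha> \<Longrightarrow> alternating k (parity \<alpha>)"
proof -
  assume a: "alternating k \<alpha>"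
  have "parity \<alpha> = (-1) ^ k \<cdot>\<^sub>c \<alpha>"
    using a by (auto simp: parity_def cov_scale_def alternating_def fun_eq_iff)
  then show ?thesis using a alternating_scale by simp
qed

text \<open>Contracting twice with the same vector \<open>v\<close> gives zero: the two mixed terms
  cancel because \<open>contract v\<close> anticommutes with \<open>parity\<close>.\<close>

lemma alternating_wedge:
  "alternating p \<alpha> \<Longrightarrow> alternating q \<beta> \<Longrightarrow> alternating (p + q) (\<alpha> \<and>\<^sub>w \<beta>)"
proof (induction "p + q" arbitrary: p q \<alpha> \<beta>)
  case 0
  then have "contract v (\<alpha> \<and>\<^sub>w \<beta>) = 0" for v
    by (simp add: contract_wedge alternating_0_contract wedge_bilinear)
  then have "(\<alpha> \<and>\<^sub>w \<beta>) vs = 0" if "vs \<noteq> []" for vs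
    using that by (metis contract_def list.exhaust zero_fun_apply)
  then show ?case using 0 by (auto simp: alternating_def[of 0])
next
  case (Suc n)
  have left: "alternating n (contract v \<alpha> \<and>\<^sub>w \<beta>)" for v
  proof (cases p)
    case 0
    then show ?thesis using Suc.prems by (simp add: alternating_0_contract wedge_bilinear alternating_zero)
  next
    case (Suc p')
    then show ?thesis using Suc.hyps Suc.prems alternating_contract by (metis add_Suc nat.inject)
  qed
  have right: "alternating n (parity \<alpha> \<and>\<^sub>w contract v \<beta>)" for v
  proof (cases q)
    case 0
    then show ?thesis using Suc.prems by (simp add: alternating_0_contract wedge_bilinear alternating_zero)
  next
    case (Suc q')
    then show ?thesis using Suc.hyps Suc.prems alternating_contract alternating_parity
      by (metis add_Suc_right nat.inject)
  qed
  have "alternating (Suc n) (\<alpha> \<and>\<^sub>w \<beta>)"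
  proof (rule alternating_SucI)
    have "p \<noteq> 0 \<or> q \<noteq> 0" using Suc.hyps(2) by auto
    then show "(\<alpha> \<and>\<^sub>w \<beta>) [] = 0"
      using alternating_length[OF Suc.prems(1), of "[]"] alternating_length[OF Suc.prems(2), of "[]"]
      by (auto simp: wedge_Nil)
    show "alternating n (contract v (\<alpha> \<and>\<^sub>w \<beta>))" for v
      unfolding contract_wedge by (intro alternating_add left right)
    have lin: "linear (\<lambda>v. \<gamma> (v # us))" if "\<gamma> = \<alpha> \<or> \<gamma> = \<beta>" for \<gamma> us
      using that Suc.prems alternating_linear_first by blast
    show "linear (\<lambda>v. (\<alpha> \<and>\<^sub>w \<beta>) (v # vs))" for vs
    proof (rule linearI)
      fix b1 b2 and r :: real
      have "contract (b1 + b2) \<gamma> = contract b1 \<gamma> + contract b2 \<gamma>"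
        "contract (r *\<^sub>R b1) \<gamma> = r \<cdot>\<^sub>c contract b1 \<gamma>" if "\<gamma> = \<alpha> \<or> \<gamma> = \<beta>" for \<gamma>
        using linear_add[OF lin[OF that]] linear_scale[OF lin[OF that]]
        by (auto simp: contract_def cov_scale_def fun_eq_iff)
      then show "(\<alpha> \<and>\<^sub>w \<beta>) ((b1 + b2) # vs) = (\<alpha> \<and>\<^sub>w \<beta>) (b1 # vs) + (\<alpha> \<and>\<^sub>w \<beta>) (b2 # vs)"
        "(\<alpha> \<and>\<^sub>w \<beta>) ((r *\<^sub>R b1) # vs) = r *\<^sub>R (\<alpha> \<and>\<^sub>w \<beta>) (b1 # vs)"
        by (simp_all add: wedge_Cons wedge_bilinear cov_scale_apply algebra_simps)
    qed
    have "contract v (contract v \<gamma>) = 0" if "\<gamma> = \<alpha> \<or> \<gamma> = \<beta>" for v \<gamma>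
      using that Suc.prems alternating_repeat by (auto simp: contract_def fun_eq_iff)
    then show "(\<alpha> \<and>\<^sub>w \<beta>) (v # v # vs) = 0" for v vs
      by (simp add: wedge_Cons contract_wedge contract_parity wedge_bilinear parity_linear)
  qed
  then show ?case using Suc.hyps(2) by simp
qed

section \<open>Products of one-forms\<close>

definition cov_one :: "'e covector" where
  "cov_one = (\<lambda>vs. if vs = [] then 1 else 0)"

definition one_form :: "'e covector \<Rightarrow> bool" where
  "one_form \<theta> \<longleftrightarrow> (\<forall>vs. length vs \<noteq> 1 \<longrightarrow> \<theta> vs = 0)"

lemma alternating_one_form: "alternating 1 \<theta> \<Longrightarrow> one_form \<theta>"
  by (simp add: alternating_def one_form_def)

lemma contract_one_form: "one_form \<theta> \<Longrightarrow> contract v \<theta> = \<theta> [v] \<cdot>\<^sub>c cov_one"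
  by (rule ext) (simp add: contract_def cov_scale_def cov_one_def one_form_def)

lemma parity_one_form: "one_form \<theta> \<Longrightarrow> parity \<theta> = - \<theta>"
  by (rule ext, rename_tac vs, case_tac "length vs = 1") (auto simp: parity_def one_form_def)

lemma contract_cov_one: "contract v cov_one = 0"
  by (rule ext) (simp add: contract_def cov_one_def)

lemma parity_cov_one: "parity cov_one = cov_one"
  by (rule ext) (simp add: parity_def cov_one_def)

lemma cov_one_wedge: "cov_one \<and>\<^sub>w \<alpha> = \<alpha>"
proof -
  have "(cov_one \<and>\<^sub>w \<alpha>) vs = \<alpha> vs" for vs
    by (induction vs arbitrary: \<alpha>)
      (simp_all add: wedge_Nil wedge_Cons contract_cov_one parity_cov_one wedge_bilinear,
        simp_all add: cov_one_def contract_def)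
  then show ?thesis by auto
qed

lemma wedge_cov_one: "\<alpha> \<and>\<^sub>w cov_one = \<alpha>"
proof -
  have "(\<alpha> \<and>\<^sub>w cov_one) vs = \<alpha> vs" for vs
    by (induction vs arbitrary: \<alpha>)
      (simp_all add: wedge_Nil wedge_Cons contract_cov_one wedge_bilinear,
        simp_all add: cov_one_def contract_def)
  then show ?thesis by auto
qed

lemma contract_one_form_wedge:
  "one_form \<theta> \<Longrightarrow> contract v (\<theta> \<and>\<^sub>w \<alpha>) = \<theta> [v] \<cdot>\<^sub>c \<alpha> - \<theta> \<and>\<^sub>w contract v \<alpha>"
  by (simp add: contract_wedge contract_one_form parity_one_form wedge_bilinear cov_one_wedge)

lemma wedge_swap:
  assumes "one_form \<theta>" "one_form \<eta>" shows "\<theta> \<and>\<^sub>w \<eta> = - (\<eta> \<and>\<^sub>w \<theta>)"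
proof (rule covector_eqI)
  show "(\<theta> \<and>\<^sub>w \<eta>) [] = (- (\<eta> \<and>\<^sub>w \<theta>)) []" using assms by (simp add: wedge_Nil one_form_def)
  show "contract v (\<theta> \<and>\<^sub>w \<eta>) = contract v (- (\<eta> \<and>\<^sub>w \<theta>))" for v
    using assms
    by (simp add: contract_one_form_wedge contract_one_form contract_linear wedge_bilinear wedge_cov_one)
qed

lemma wedge_swap_left:
  assumes "one_form \<theta>" "one_form \<eta>" shows "\<theta> \<and>\<^sub>w \<eta> \<and>\<^sub>w \<alpha> = - (\<eta> \<and>\<^sub>w \<theta> \<and>\<^sub>w \<alpha>)"
  using wedge_swap[OF assms] by (simp add: wedge_assoc[symmetric] wedge_bilinear)

lemma wedge_self:
  assumes "one_form \<theta>" shows "\<theta> \<and>\<^sub>w \<theta> = 0"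
proof (rule covector_eqI)
  show "(\<theta> \<and>\<^sub>w \<theta>) [] = 0 []" using assms by (simp add: wedge_Nil one_form_def)
  show "contract v (\<theta> \<and>\<^sub>w \<theta>) = contract v 0" for v
    using assms
    by (simp add: contract_one_form_wedge contract_one_form contract_linear wedge_bilinear wedge_cov_one)
qed

lemma wedge_self_left:
  assumes "one_form \<theta>" shows "\<theta> \<and>\<^sub>w \<theta> \<and>\<^sub>w \<alpha> = 0"
  using wedge_self[OF assms] by (simp add: wedge_assoc[symmetric] wedge_bilinear)

lemma monomial_Nil: "monomial e [] = cov_one"
  by (simp add: cov_one_def)

lemma monomial_Cons: "monomial e (i # L) = e i \<and>\<^sub>w monomial e L"
  by (cases L) (simp_all add: monomial_Nil wedge_cov_one del: monomial.simps(1))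

lemma monomial_append: "monomial e (L @ K) = monomial e L \<and>\<^sub>w monomial e K"
  by (induction L)
    (simp_all add: monomial_Nil monomial_Cons cov_one_wedge wedge_assoc del: monomial.simps)

lemma alternating_cov_one: "alternating 0 cov_one"
  by (simp add: alternating_def cov_one_def)

lemma alternating_monomial:
  assumes "\<And>i. i \<in> set L \<Longrightarrow> alternating 1 (e i)" shows "alternating (length L) (monomial e L)"
  using assms
proof (induction L)
  case Nil then show ?case by (simp add: monomial_Nil alternating_cov_one del: monomial.simps)
next
  case (Cons i L)
  then have "alternating (1 + length L) (e i \<and>\<^sub>w monomial e L)"
    by (intro alternating_wedge) auto
  then show ?case by (simp add: monomial_Cons del: monomial.simps)
qed

lemma alternating_contract_pred: "alternating k \<alpha> \<Longrightarrow> alternating (k - 1) (contract v \<alpha>)"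
  by (cases k) (simp_all add: alternating_contract alternating_0_contract alternating_zero)


section \<open>Dual frames and the Hodge star of a monomial\<close>

definition dual_frame :: "nat \<Rightarrow> (nat \<Rightarrow> 'e::real_vector covector) \<Rightarrow> (nat \<Rightarrow> 'e) \<Rightarrow> bool" where
  "dual_frame n e v \<longleftrightarrow>
     (\<forall>i\<in>{1..n}. \<forall>j\<in>{1..n}. e i [v j] = (if i = j then 1 else 0)) \<and>
     (\<forall>u. u = (\<Sum>i=1..n. e i [u] *\<^sub>R v i))"

lemma alternating_1_linear: "alternating 1 \<theta> \<Longrightarrow> linear (\<lambda>v. \<theta> [v])"
  by (rule alternating_linear_first)

lemma coframe_alternating: "coframe n e \<Longrightarrow> i \<in> {1..n} \<Longrightarrow> alternating 1 (e i)"
  unfolding coframe_def by blast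

lemma coframe_one_form: "coframe n e \<Longrightarrow> i \<in> {1..n} \<Longrightarrow> one_form (e i)"
  by (rule alternating_one_form[OF coframe_alternating])

text \<open>The components of the coframe form a linear map between spaces of the same dimension;
  independence makes it bijective, and the dual frame consists of the preimages of a standard
  basis.\<close>

lemma coframe_has_dual_frame:
  fixes e :: "nat \<Rightarrow> 'e::euclidean_space covector"
  assumes "coframe n e" obtains v where "dual_frame n e v"
proof -
  have dim: "DIM('e) = n" and alt: "\<And>i. i \<in> {1..n} \<Longrightarrow> alternating 1 (e i)"
    and indep: "\<And>a i. (\<And>v. (\<Sum>i=1..n. a i * e i [v]) = 0) \<Longrightarrow> i \<in> {1..n} \<Longrightarrow> a i = 0"
    using assms unfolding coframe_def by auto
  have lin: "linear (\<lambda>u. e i [u])" if "i \<in> {1..n}" for i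
    using alternating_1_linear alt that by blast
  obtain b :: "nat \<Rightarrow> 'e" where b: "bij_betw b {1..n} Basis"
    using dim by (metis ex_bij_betw_nat_finite_1 finite_Basis)
  have ortho: "b i \<bullet> b j = (if i = j then 1 else 0)" if "i \<in> {1..n}" "j \<in> {1..n}" for i j
  proof -
    have "b i \<in> Basis" "b j \<in> Basis" using b that bij_betwE by blast+
    then show ?thesis using b that inner_Basis[of "b i" "b j"] by (auto simp: bij_betw_def inj_on_eq_iff)
  qed
  define T where "T u = (\<Sum>i=1..n. e i [u] *\<^sub>R b i)" for u
  have linT: "linear T"
  proof (rule linearI)
    fix x y and r :: real
    show "T (x + y) = T x + T y" unfolding T_def sum.distrib[symmetric]
      by (intro sum.cong refl) (simp add: linear_add[OF lin] scaleR_left_distrib)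
    show "T (r *\<^sub>R x) = r *\<^sub>R T x" unfolding T_def scaleR_sum_right
      by (intro sum.cong refl) (simp add: linear_scale[OF lin])
  qed
  have Tb: "T u \<bullet> b j = e j [u]" if "j \<in> {1..n}" for u j
  proof -
    have "T u \<bullet> b j = (\<Sum>i=1..n. if i = j then e i [u] else 0)"
      unfolding T_def inner_sum_left using ortho that by (intro sum.cong) auto
    then show ?thesis using that by simp
  qed
  \<comment> \<open>The coordinates of a vector orthogonal to the range are the coefficients of a linear relation
      between the covectors.\<close>
  have "surj T"
  proof (rule ccontr)
    assume "\<not> surj T"
    then have "span (range T) \<noteq> UNIV"
      by (metis linT linear_span_image span_UNIV)
    then obtain a where "a \<noteq> 0" and a: "\<And>x. x \<in> range T \<Longrightarrow> a \<bullet> x = 0"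
      using span_not_UNIV_orthogonal[of "range T"] by (metis span_base)
    have "(\<Sum>i=1..n. (a \<bullet> b i) * e i [u]) = 0" for u
      using a[of "T u"] unfolding T_def by (simp add: inner_sum_right mult.commute)
    then have "a \<bullet> b i = 0" if "i \<in> {1..n}" for i using indep[of "\<lambda>i. a \<bullet> b i" i] that by auto
    then have "a \<bullet> c = 0" if "c \<in> Basis" for c using b that by (metis bij_betw_imp_surj_on imageE)
    then show False using \<open>a \<noteq> 0\<close> euclidean_all_zero_iff by metis
  qed
  then have inj: "inj T" using linT linear_surjective_imp_injective by blast
  define v where "v j = inv T (b j)" for j
  have Tv: "T (v j) = b j" for j unfolding v_def using \<open>surj T\<close> by (simp add: surj_f_inv_f)
  have dual: "e i [v j] = (if i = j then 1 else 0)" if "i \<in> {1..n}" "j \<in> {1..n}" for i j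
    using Tb[OF that(1), of "v j"] ortho[OF that(2,1)] Tv by auto
  have "u = (\<Sum>i=1..n. e i [u] *\<^sub>R v i)" for u
  proof -
    have "T (\<Sum>i=1..n. e i [u] *\<^sub>R v i) = (\<Sum>i=1..n. e i [u] *\<^sub>R b i)"
      by (simp add: linear_sum[OF linT] linear_scale[OF linT] Tv)
    then show ?thesis using inj by (metis T_def injD)
  qed
  then have "dual_frame n e v" unfolding dual_frame_def using dual by blast
  then show ?thesis using that by blast
qed

lemma sharp_eqI:
  assumes "coframe n e" "g = coframe_metric n e" "\<And>u. g w u = b \<bullet> u"
  shows "sharp g b = w"
proof -
  obtain v where v: "dual_frame n e v" using coframe_has_dual_frame assms(1) by blast
  have coord: "g w' (v j) = e j [w']" if "j \<in> {1..n}" for w' j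
  proof -
    have "g w' (v j) = (\<Sum>i=1..n. if i = j then e i [w'] else 0)"
      unfolding assms(2) coframe_metric_def using v that
      by (intro sum.cong) (auto simp: dual_frame_def)
    then show ?thesis using that by simp
  qed
  show ?thesis unfolding sharp_def
  proof (rule the_equality)
    fix w' assume "\<forall>u. g w' u = b \<bullet> u"
    then have "e j [w'] = e j [w]" if "j \<in> {1..n}" for j
      using coord[OF that] assms(3) by metis
    then have "(\<Sum>i=1..n. e i [w'] *\<^sub>R v i) = (\<Sum>i=1..n. e i [w] *\<^sub>R v i)" by (intro sum.cong) auto
    then show "w' = w" using v unfolding dual_frame_def by metis
  qed (use assms in blast)
qed

lemma coframe_metric_dual_frame:
  assumes e: "coframe n e" and v: "dual_frame n e v"
  shows "coframe_metric n e (\<Sum>i=1..n. (b \<bullet> v i) *\<^sub>R v i) u = b \<bullet> u"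
proof -
  have "e j [\<Sum>i=1..n. (b \<bullet> v i) *\<^sub>R v i] = b \<bullet> v j" if j: "j \<in> {1..n}" for j
  proof -
    have lin: "linear (\<lambda>u. e j [u])" using alternating_1_linear e j unfolding coframe_def by blast
    have "e j [\<Sum>i=1..n. (b \<bullet> v i) *\<^sub>R v i] = (\<Sum>i=1..n. if j = i then b \<bullet> v i else 0)"
      unfolding linear_sum[OF lin] linear_scale[OF lin]
      using v j by (intro sum.cong refl) (auto simp: dual_frame_def)
    then show ?thesis using j by simp
  qed
  then have "coframe_metric n e (\<Sum>i=1..n. (b \<bullet> v i) *\<^sub>R v i) u = (\<Sum>i=1..n. (b \<bullet> v i) * e i [u])"
    by (simp add: coframe_metric_def)
  also have "\<dots> = b \<bullet> (\<Sum>i=1..n. e i [u] *\<^sub>R v i)" by (simp add: inner_sum_right mult.commute)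
  also have "\<dots> = b \<bullet> u" using v unfolding dual_frame_def by metis
  finally show "coframe_metric n e (\<Sum>i=1..n. (b \<bullet> v i) *\<^sub>R v i) u = b \<bullet> u" .
qed

lemma sharp_coframe_metric:
  assumes e: "coframe n e" and v: "dual_frame n e v"
  shows "sharp (coframe_metric n e) b = (\<Sum>i=1..n. (b \<bullet> v i) *\<^sub>R v i)"
  by (rule sharp_eqI[OF e refl coframe_metric_dual_frame[OF e v]])

lemma coframe_metric_sharp:
  assumes "coframe n e" shows "coframe_metric n e (sharp (coframe_metric n e) b) u = b \<bullet> u"
proof -
  obtain v where v: "dual_frame n e v" using coframe_has_dual_frame assms by blast
  show ?thesis unfolding sharp_coframe_metric[OF assms v] by (rule coframe_metric_dual_frame[OF assms v])
qed


abbreviation lists_of_length :: "'a set \<Rightarrow> nat \<Rightarrow> 'a list set" where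
  "lists_of_length A k \<equiv> {xs. set xs \<subseteq> A \<and> length xs = k}"

lemma sum_lists_Suc:
  "(\<Sum>xs\<in>lists_of_length A (Suc k). f xs) = (\<Sum>a\<in>A. \<Sum>xs\<in>lists_of_length A k. f (a # xs))"
proof -
  have "(\<Sum>xs\<in>lists_of_length A (Suc k). f xs) = (\<Sum>(xs, a)\<in>lists_of_length A k \<times> A. f (a # xs))"
    unfolding lists_length_Suc_eq by (subst sum.reindex) (auto simp: inj_on_def case_prod_unfold)
  also have "\<dots> = (\<Sum>xs\<in>lists_of_length A k. \<Sum>a\<in>A. f (a # xs))"
    by (rule sum.cartesian_product[symmetric])
  finally show ?thesis by (simp add: sum.swap[of _ A])
qed

lemma sum_lists_0: "(\<Sum>xs\<in>lists_of_length A 0. f xs) = f []"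
proof -
  have "lists_of_length A 0 = {[]}" by auto
  then show ?thesis by simp
qed

text \<open>Contraction of the \<open>k\<close> arguments of \<open>\<alpha>\<close> with the first
  \<open>k\<close> arguments of \<open>\<beta>\<close> along a frame. The sum runs over all lists of
  indices, so that each increasing list is counted \<open>k!\<close> times for alternating
  forms.\<close>

definition full_contraction ::
  "nat \<Rightarrow> (nat \<Rightarrow> 'e) \<Rightarrow> nat \<Rightarrow> 'e covector \<Rightarrow> 'e covector \<Rightarrow> 'e covector" where
  "full_contraction n v k \<alpha> \<beta> = (\<lambda>ws.
     \<Sum>js\<in>lists_of_length {1..n} k. \<alpha> (map v js) * \<beta> (map v js @ ws))"

lemma full_contraction_0: "full_contraction n v 0 \<alpha> \<beta> = \<alpha> [] \<cdot>\<^sub>c \<beta>"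
  by (rule ext) (simp add: full_contraction_def sum_lists_0 cov_scale_def del: length_0_conv)

lemma full_contraction_Suc:
  "full_contraction n v (Suc k) \<alpha> \<beta> ws =
     (\<Sum>i=1..n. full_contraction n v k (contract (v i) \<alpha>) (contract (v i) \<beta>) ws)"
  unfolding full_contraction_def contract_def by (simp add: sum_lists_Suc)

lemma full_contraction_linear:
  "full_contraction n v k (\<alpha> - \<alpha>') \<beta> ws = full_contraction n v k \<alpha> \<beta> ws - full_contraction n v k \<alpha>' \<beta> ws"
  "full_contraction n v k (a \<cdot>\<^sub>c \<alpha>) \<beta> ws = a * full_contraction n v k \<alpha> \<beta> ws"
  "full_contraction n v k \<alpha> (- \<beta>) ws = - full_contraction n v k \<alpha> \<beta> ws"
  by (simp_all add: full_contraction_def cov_scale_def algebra_simps sum_subtractf sum_distrib_left sum_negf)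

text \<open>Both sides contract \<open>k\<close> pairs of slots with the inverse metric, written as
  \<open>\<Sum>b. sharp b \<otimes> b\<close> on the left and as \<open>\<Sum>i. v i \<otimes> v
  i\<close> on the right. In particular the right-hand side does not depend on the orthonormal
  frame, which is used again to compare two adapted coframes.\<close>

lemma sharp_contraction:
  assumes e: "coframe n e" and v: "dual_frame n e v"
  shows "alternating p \<alpha> \<Longrightarrow> alternating q \<beta> \<Longrightarrow>
    (\<Sum>bs\<in>lists_of_length Basis k. \<alpha> (map (sharp (coframe_metric n e)) bs) * \<beta> (bs @ ws)) =
      full_contraction n v k \<alpha> \<beta> ws"
proof (induction k arbitrary: \<alpha> \<beta> p q)
  case 0 then show ?case by (simp add: sum_lists_0 full_contraction_0 cov_scale_def del: length_0_conv)
next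
  case (Suc k)
  let ?s = "sharp (coframe_metric n e)"
  have bilinear: "(\<Sum>b\<in>Basis. F (?s b) * G b) = (\<Sum>i=1..n. F (v i) * G (v i))"
    if F: "linear F" and G: "linear G" for F G :: "_ \<Rightarrow> real"
  proof -
    have "(\<Sum>b\<in>Basis. F (?s b) * G b) = (\<Sum>b\<in>Basis. \<Sum>i=1..n. F (v i) * ((v i \<bullet> b) * G b))"
      unfolding sharp_coframe_metric[OF e v] linear_sum[OF F] linear_scale[OF F] sum_distrib_right
      by (intro sum.cong refl) (simp add: inner_commute)
    also have "\<dots> = (\<Sum>i=1..n. \<Sum>b\<in>Basis. F (v i) * ((v i \<bullet> b) * G b))" by (rule sum.swap)
    also have "\<dots> = (\<Sum>i=1..n. F (v i) * G (\<Sum>b\<in>Basis. (v i \<bullet> b) *\<^sub>R b))"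
      unfolding linear_sum[OF G] linear_scale[OF G] sum_distrib_left by simp
    finally show ?thesis unfolding euclidean_representation .
  qed
  have "(\<Sum>bs\<in>lists_of_length Basis (Suc k). \<alpha> (map ?s bs) * \<beta> (bs @ ws)) =
     (\<Sum>b\<in>Basis. full_contraction n v k (contract (?s b) \<alpha>) (contract b \<beta>) ws)"
    unfolding sum_lists_Suc
      Suc.IH[OF alternating_contract_pred[OF Suc.prems(1)] alternating_contract_pred[OF Suc.prems(2)], symmetric]
    by (simp add: contract_def)
  also have "\<dots> = (\<Sum>js\<in>lists_of_length {1..n} k. \<Sum>b\<in>Basis. \<alpha> (?s b # map v js) * \<beta> (b # map v js @ ws))"
    unfolding full_contraction_def contract_def by (rule sum.swap)
  also have "\<dots> = (\<Sum>js\<in>lists_of_length {1..n} k. \<Sum>i=1..n. \<alpha> (v i # map v js) * \<beta> (v i # map v js @ ws))"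
  proof (rule sum.cong[OF refl])
    fix js
    show "(\<Sum>b\<in>Basis. \<alpha> (?s b # map v js) * \<beta> (b # map v js @ ws)) =
        (\<Sum>i=1..n. \<alpha> (v i # map v js) * \<beta> (v i # map v js @ ws))"
      by (rule bilinear[of "\<lambda>x. \<alpha> (x # map v js)" "\<lambda>x. \<beta> (x # map v js @ ws)"])
        (rule alternating_linear_first[OF Suc.prems(1)] alternating_linear_first[OF Suc.prems(2)])+
  qed
  also have "\<dots> = full_contraction n v (Suc k) \<alpha> \<beta> ws"
    unfolding full_contraction_Suc unfolding full_contraction_def contract_def
    by (rule sum.swap)
  finally show ?case .
qed

lemma contract_contract:
  assumes "alternating q \<beta>" shows "contract v (contract w \<beta>) = - contract w (contract v \<beta>)"
  unfolding contract_def fun_Compl_def using alternating_swap[OF assms] by blast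

text \<open>Contracting a factor \<open>e l\<close> inserts \<open>v l\<close> into
  \<open>\<beta>\<close>. There are \<open>k + 1\<close> slots in which \<open>e l\<close> can meet
  \<open>\<beta>\<close>, and by alternation each contributes the same amount.\<close>

lemma full_contraction_wedge:
  assumes v: "dual_frame n e v" and l: "l \<in> {1..n}" and one: "one_form (e l)"
  shows "alternating q \<beta> \<Longrightarrow>
    full_contraction n v (Suc k) (e l \<and>\<^sub>w \<alpha>) \<beta> ws = Suc k * full_contraction n v k \<alpha> (contract (v l) \<beta>) ws"
proof (induction k arbitrary: \<alpha> \<beta> q)
  case (0 \<alpha> \<beta> q)
  have "full_contraction n v (Suc 0) (e l \<and>\<^sub>w \<alpha>) \<beta> ws
    = (\<Sum>i=1..n. if l = i then \<alpha> [] * contract (v i) \<beta> ws else 0)"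
    unfolding full_contraction_Suc full_contraction_0 contract_one_form_wedge[OF one] cov_scale_apply
    using v l one by (intro sum.cong) (auto simp: cov_scale_def wedge_Nil one_form_def dual_frame_def)
  then show ?case using l by (simp add: full_contraction_0 cov_scale_def)
next
  case (Suc k \<alpha> \<beta> q)
  let ?C = "full_contraction n v"
  have "?C (Suc (Suc k)) (e l \<and>\<^sub>w \<alpha>) \<beta> ws =
    (\<Sum>i=1..n. e l [v i] * ?C (Suc k) \<alpha> (contract (v i) \<beta>) ws
       - ?C (Suc k) (e l \<and>\<^sub>w contract (v i) \<alpha>) (contract (v i) \<beta>) ws)"
    by (subst full_contraction_Suc) (simp add: contract_one_form_wedge[OF one] full_contraction_linear)
  also have "\<dots> = (\<Sum>i=1..n. e l [v i] * ?C (Suc k) \<alpha> (contract (v i) \<beta>) ws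
       + Suc k * ?C k (contract (v i) \<alpha>) (contract (v i) (contract (v l) \<beta>)) ws)"
    unfolding Suc.IH[OF alternating_contract_pred[OF Suc.prems]]
      contract_contract[OF Suc.prems, of "v l"] full_contraction_linear by simp
  also have "\<dots> = (\<Sum>i=1..n. e l [v i] * ?C (Suc k) \<alpha> (contract (v i) \<beta>) ws)
       + Suc k * ?C (Suc k) \<alpha> (contract (v l) \<beta>) ws"
    by (simp add: sum.distrib sum_distrib_left full_contraction_Suc[of n v k \<alpha>])
  also have "(\<Sum>i=1..n. e l [v i] * ?C (Suc k) \<alpha> (contract (v i) \<beta>) ws)
     = (\<Sum>i=1..n. (if l = i then ?C (Suc k) \<alpha> (contract (v i) \<beta>) ws else 0))"
    using v l by (intro sum.cong) (auto simp: dual_frame_def)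
  also have "\<dots> = ?C (Suc k) \<alpha> (contract (v l) \<beta>) ws" using l by simp
  finally show ?case by (simp add: algebra_simps)
qed

lemma full_contraction_monomial:
  assumes v: "dual_frame n e v" and one: "\<And>i. i \<in> {1..n} \<Longrightarrow> one_form (e i)"
  shows "set L \<subseteq> {1..n} \<Longrightarrow> alternating q \<beta> \<Longrightarrow>
    full_contraction n v (length L) (monomial e L) \<beta> ws = fact (length L) * \<beta> (map v L @ ws)"
proof (induction L arbitrary: \<beta> q)
  case Nil
  then show ?case by (simp add: full_contraction_0 cov_scale_def)
next
  case (Cons l L)
  then have l: "l \<in> {1..n}" and L: "set L \<subseteq> {1..n}" by auto
  have "full_contraction n v (length (l # L)) (monomial e (l # L)) \<beta> ws
    = Suc (length L) * full_contraction n v (length L) (monomial e L) (contract (v l) \<beta>) ws"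
    unfolding monomial_Cons list.size(4) using full_contraction_wedge[OF v l one[OF l] Cons.prems(2)] by simp
  also have "\<dots> = Suc (length L) * (fact (length L) * contract (v l) \<beta> (map v L @ ws))"
    using Cons.IH[OF L alternating_contract_pred[OF Cons.prems(2)]] by simp
  finally show ?case by (simp add: contract_def)
qed

lemma contract_monomial_notin:
  assumes v: "dual_frame n e v" and one: "\<And>i. i \<in> {1..n} \<Longrightarrow> one_form (e i)"
    and "l \<in> {1..n}" "set L \<subseteq> {1..n}" "l \<notin> set L"
  shows "contract (v l) (monomial e L) = 0"
  using assms(4,5)
proof (induction L)
  case Nil then show ?case by (simp add: monomial_Nil contract_cov_one del: monomial.simps)
next
  case (Cons i L)
  then have "e i [v l] = 0" "one_form (e i)" using v assms(3) one by (auto simp: dual_frame_def)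
  then have "contract (v l) (monomial e (i # L)) = 0 \<cdot>\<^sub>c monomial e L - e i \<and>\<^sub>w 0"
    using Cons by (simp add: monomial_Cons contract_one_form_wedge del: monomial.simps zero_fun_apply)
  also have "\<dots> = 0" by (rule ext) (simp add: cov_scale_def wedge_zero_right)
  finally show ?case .
qed

lemma monomial_append_dual_frame:
  assumes v: "dual_frame n e v" and one: "\<And>i. i \<in> {1..n} \<Longrightarrow> one_form (e i)"
  shows "set L \<subseteq> {1..n} \<Longrightarrow> set J \<subseteq> {1..n} \<Longrightarrow> distinct (L @ J) \<Longrightarrow>
    monomial e (L @ J) (map v L @ ws) = monomial e J ws"
proof (induction L)
  case (Cons l L)
  have l: "l \<in> {1..n}" using Cons by auto
  have "monomial e ((l # L) @ J) (map v (l # L) @ ws)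
     = contract (v l) (e l \<and>\<^sub>w monomial e (L @ J)) (map v L @ ws)"
    by (simp add: contract_def monomial_Cons del: monomial.simps)
  also have "contract (v l) (e l \<and>\<^sub>w monomial e (L @ J)) = e l [v l] \<cdot>\<^sub>c monomial e (L @ J)"
    using contract_monomial_notin[OF v one l, of "L @ J"] Cons
    by (simp add: contract_one_form_wedge[OF one[OF l]] wedge_bilinear)
  also have "e l [v l] = 1" using v l by (auto simp: dual_frame_def)
  finally show ?case using Cons by (simp add: cov_scale_def)
qed simp

text \<open>Raising the indices of \<open>e L\<close> gives the vectors \<open>v L\<close>, and
  inserting these into the volume \<open>e L \<and> e J\<close> removes the factor \<open>e
  L\<close>. When the volume is the monomial of all indices in increasing order, \<open>s\<close> is
  the sign of the permutation sorting \<open>L @ J\<close>.\<close>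

lemma hodge_star_monomial:
  fixes e :: "nat \<Rightarrow> 'e::euclidean_space covector"
  assumes e: "coframe n e" and vol: "vol = s \<cdot>\<^sub>c monomial e (L @ J)"
    and LJ: "set (L @ J) \<subseteq> {1..n}" "distinct (L @ J)"
  shows "hodge_star (coframe_metric n e) vol (length L) (monomial e L) = s \<cdot>\<^sub>c monomial e J"
proof
  fix ws
  obtain v where v: "dual_frame n e v" using coframe_has_dual_frame e by blast
  have alt: "alternating 1 (e i)" and one: "one_form (e i)" if "i \<in> {1..n}" for i
    using e that alternating_one_form unfolding coframe_def by blast+
  have altm: "alternating (length K) (monomial e K)" if "set K \<subseteq> {1..n}" for K
    using alternating_monomial alt that by blast
  have altvol: "alternating (length (L @ J)) vol" unfolding vol using altm LJ alternating_scale by blast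
  have "hodge_star (coframe_metric n e) vol (length L) (monomial e L) ws =
    full_contraction n v (length L) (monomial e L) vol ws / fact (length L)"
    unfolding hodge_star_def using sharp_contraction[OF e v altm altvol, where k = "length L" and ws = ws] LJ by simp
  also have "\<dots> = vol (map v L @ ws)"
    using full_contraction_monomial[OF v one _ altvol, where L = L and ws = ws] LJ by simp
  also have "\<dots> = s * monomial e J ws"
    unfolding vol cov_scale_apply using monomial_append_dual_frame[OF v one, of L J ws] LJ by simp
  finally show "hodge_star (coframe_metric n e) vol (length L) (monomial e L) ws = (s \<cdot>\<^sub>c monomial e J) ws"
    by (simp add: cov_scale_apply)
qed

lemma hodge_star_linear:
  "hodge_star g vol k (\<alpha> + \<beta>) = hodge_star g vol k \<alpha> + hodge_star g vol k \<beta>"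
  "hodge_star g vol k (\<alpha> - \<beta>) = hodge_star g vol k \<alpha> - hodge_star g vol k \<beta>"
  "hodge_star g vol k (- \<alpha>) = - hodge_star g vol k \<alpha>"
  "hodge_star g vol k (a \<cdot>\<^sub>c \<alpha>) = a \<cdot>\<^sub>c hodge_star g vol k \<alpha>"
  by (rule ext, simp add: hodge_star_def cov_scale_def algebra_simps sum.distrib sum_subtractf sum_negf
      sum_distrib_left add_divide_distrib diff_divide_distrib)+

section \<open>The metric and the orientation of a G2-structure\<close>

text \<open>Oriented by the order of the indices, so that rewriting sorts a product of one-forms and
  collects its sign.\<close>

lemma wedge_sort:
  assumes "one_form (e i)" "one_form (e j)" "j < (i::nat)"
  shows "e i \<and>\<^sub>w e j = - (e j \<and>\<^sub>w e i)" "e i \<and>\<^sub>w e j \<and>\<^sub>w \<alpha> = - (e j \<and>\<^sub>w e i \<and>\<^sub>w \<alpha>)"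
  using wedge_swap wedge_swap_left assms by blast+

lemma cov_scale_simps:
  "0 \<cdot>\<^sub>c \<alpha> = 0" "1 \<cdot>\<^sub>c \<alpha> = \<alpha>" "a \<cdot>\<^sub>c 0 = 0"
  "a \<cdot>\<^sub>c b \<cdot>\<^sub>c \<alpha> = (a * b) \<cdot>\<^sub>c \<alpha>" "a \<cdot>\<^sub>c (- \<alpha>) = - (a \<cdot>\<^sub>c \<alpha>)"
  by (rule ext, simp add: cov_scale_def)+

lemmas normal_order = wedge_sort wedge_self wedge_self_left wedge_bilinear wedge_assoc
  cov_one_wedge wedge_cov_one

definition g2_form :: "(nat \<Rightarrow> 'e covector) \<Rightarrow> 'e covector" where
  "g2_form e = monomial e [1,2,7] + monomial e [3,4,7] + monomial e [5,6,7]
       + monomial e [1,3,5] - monomial e [1,4,6] - monomial e [2,3,6] - monomial e [2,4,5]"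

lemma g2_adapted_iff: "g2_adapted e \<phi> \<longleftrightarrow> coframe 7 e \<and> \<phi> = g2_form e"
  unfolding g2_adapted_def g2_form_def ..

context
  fixes e :: "nat \<Rightarrow> 'e::euclidean_space covector" and v
  assumes e: "coframe 7 e" and v: "dual_frame 7 e v"
begin

lemma g2_dual_frame_eval: "i \<in> {1..7} \<Longrightarrow> j \<in> {1..7} \<Longrightarrow> e i [v j] = (if i = j then 1 else 0)"
  using v unfolding dual_frame_def by blast

lemma contract_g2_form:
    "contract (v 1) (g2_form e) = monomial e [2,7] + monomial e [3,5] - monomial e [4,6]"
    "contract (v 2) (g2_form e) = - monomial e [1,7] - monomial e [3,6] - monomial e [4,5]"
    "contract (v 3) (g2_form e) = monomial e [4,7] - monomial e [1,5] + monomial e [2,6]"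
    "contract (v 4) (g2_form e) = - monomial e [3,7] + monomial e [1,6] + monomial e [2,5]"
    "contract (v 5) (g2_form e) = monomial e [6,7] + monomial e [1,3] - monomial e [2,4]"
    "contract (v 6) (g2_form e) = - monomial e [5,7] - monomial e [1,4] - monomial e [2,3]"
    "contract (v 7) (g2_form e) = monomial e [1,2] + monomial e [3,4] + monomial e [5,6]"
  by (simp_all add: g2_form_def contract_linear contract_one_form_wedge contract_one_form
      coframe_one_form[OF e] g2_dual_frame_eval cov_scale_simps wedge_bilinear wedge_cov_one
      del: One_nat_def)

text \<open>The intermediate 5-forms of Bryant's formula; computing them once keeps the number of
  products to be sorted in \<open>g2_form_bilinear_on_frame\<close> small.\<close>

lemma contract_g2_form_wedge_g2_form:
    "contract (v 1) (g2_form e) \<and>\<^sub>w g2_form e = 2 \<cdot>\<^sub>c (monomial e [1,2,3,5,7] - monomial e [1,2,4,6,7] + monomial e [1,3,4,5,6])"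
    "contract (v 2) (g2_form e) \<and>\<^sub>w g2_form e = 2 \<cdot>\<^sub>c (- monomial e [1,2,3,6,7] - monomial e [1,2,4,5,7] + monomial e [2,3,4,5,6])"
    "contract (v 3) (g2_form e) \<and>\<^sub>w g2_form e = 2 \<cdot>\<^sub>c (- monomial e [1,3,4,5,7] + monomial e [2,3,4,6,7] + monomial e [1,2,3,5,6])"
    "contract (v 4) (g2_form e) \<and>\<^sub>w g2_form e = 2 \<cdot>\<^sub>c (monomial e [1,3,4,6,7] + monomial e [2,3,4,5,7] + monomial e [1,2,4,5,6])"
    "contract (v 5) (g2_form e) \<and>\<^sub>w g2_form e = 2 \<cdot>\<^sub>c (monomial e [1,3,5,6,7] - monomial e [2,4,5,6,7] + monomial e [1,2,3,4,5])"
    "contract (v 6) (g2_form e) \<and>\<^sub>w g2_form e = 2 \<cdot>\<^sub>c (- monomial e [1,4,5,6,7] - monomial e [2,3,5,6,7] + monomial e [1,2,3,4,6])"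
    "contract (v 7) (g2_form e) \<and>\<^sub>w g2_form e = 2 \<cdot>\<^sub>c (monomial e [1,2,3,4,7] + monomial e [1,2,5,6,7] + monomial e [3,4,5,6,7])"
  by (simp_all only: contract_g2_form, unfold g2_form_def)
    (rule ext, simp add: normal_order coframe_one_form[OF e] cov_scale_apply del: One_nat_def)+

lemma g2_form_bilinear_on_frame:
  assumes "i \<in> {1..7}" "j \<in> {1..7}"
  shows "contract (v i) (g2_form e) \<and>\<^sub>w contract (v j) (g2_form e) \<and>\<^sub>w g2_form e =
    (if i = j then 6 else 0) \<cdot>\<^sub>c monomial e [1,2,3,4,5,6,7]"
proof -
  have i: "i = 1 \<or> i = 2 \<or> i = 3 \<or> i = 4 \<or> i = 5 \<or> i = 6 \<or> i = 7"
    and j: "j = 1 \<or> j = 2 \<or> j = 3 \<or> j = 4 \<or> j = 5 \<or> j = 6 \<or> j = 7"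
    using assms unfolding atLeastAtMost_iff by presburger+
  show ?thesis
    using i
  proof (elim disjE)
    assume i: "i = 1"
    show ?thesis using j unfolding i
      by (elim disjE) (simp_all only: contract_g2_form_wedge_g2_form, simp_all only: contract_g2_form,
        (rule ext, simp add: normal_order coframe_one_form[OF e] cov_scale_apply del: One_nat_def)+)
  next
    assume i: "i = 2"
    show ?thesis using j unfolding i
      by (elim disjE) (simp_all only: contract_g2_form_wedge_g2_form, simp_all only: contract_g2_form,
        (rule ext, simp add: normal_order coframe_one_form[OF e] cov_scale_apply del: One_nat_def)+)
  next
    assume i: "i = 3"
    show ?thesis using j unfolding i
      by (elim disjE) (simp_all only: contract_g2_form_wedge_g2_form, simp_all only: contract_g2_form,
        (rule ext, simp add: normal_order coframe_one_form[OF e] cov_scale_apply del: One_nat_def)+)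
  next
    assume i: "i = 4"
    show ?thesis using j unfolding i
      by (elim disjE) (simp_all only: contract_g2_form_wedge_g2_form, simp_all only: contract_g2_form,
        (rule ext, simp add: normal_order coframe_one_form[OF e] cov_scale_apply del: One_nat_def)+)
  next
    assume i: "i = 5"
    show ?thesis using j unfolding i
      by (elim disjE) (simp_all only: contract_g2_form_wedge_g2_form, simp_all only: contract_g2_form,
        (rule ext, simp add: normal_order coframe_one_form[OF e] cov_scale_apply del: One_nat_def)+)
  next
    assume i: "i = 6"
    show ?thesis using j unfolding i
      by (elim disjE) (simp_all only: contract_g2_form_wedge_g2_form, simp_all only: contract_g2_form,
        (rule ext, simp add: normal_order coframe_one_form[OF e] cov_scale_apply del: One_nat_def)+)
  next
    assume i: "i = 7"
    show ?thesis using j unfolding i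
      by (elim disjE) (simp_all only: contract_g2_form_wedge_g2_form, simp_all only: contract_g2_form,
        (rule ext, simp add: normal_order coframe_one_form[OF e] cov_scale_apply del: One_nat_def)+)
  qed
qed

end

lemma contract_vec_linear:
  assumes "alternating k \<alpha>"
  shows "contract (u + w) \<alpha> = contract u \<alpha> + contract w \<alpha>" "contract (r *\<^sub>R u) \<alpha> = r \<cdot>\<^sub>c contract u \<alpha>"
  using linear_add[OF alternating_linear_first[OF assms]] linear_scale[OF alternating_linear_first[OF assms]]
  by (auto simp: contract_def cov_scale_def)

lemma alternating_diff: "alternating k \<alpha> \<Longrightarrow> alternating k \<beta> \<Longrightarrow> alternating k (\<alpha> - \<beta>)"
  unfolding diff_as_scale by (intro alternating_add alternating_scale)

lemma alternating_minus: "alternating k \<alpha> \<Longrightarrow> alternating k (- \<alpha>)"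
  unfolding uminus_as_scale by (rule alternating_scale)

lemma alternating_monomial_coframe:
  assumes "coframe n e" "set L \<subseteq> {1..n}" "length L = k" shows "alternating k (monomial e L)"
  using alternating_monomial[of L e] assms unfolding coframe_def by blast

lemma alternating_g2_form:
  assumes "coframe 7 e" shows "alternating 3 (g2_form e)"
  unfolding g2_form_def
  by (intro alternating_add alternating_diff alternating_monomial_coframe[OF assms]) simp_all

text \<open>Bryant's formula: the 7-form valued bilinear form that a 3-form induces is the metric
  times the volume of an adapted coframe. It follows from its values on the dual frame by
  bilinearity.\<close>

lemma g2_form_bilinear:
  assumes e: "coframe 7 e"
  shows "contract u (g2_form e) \<and>\<^sub>w contract w (g2_form e) \<and>\<^sub>w g2_form e =
    (6 * coframe_metric 7 e u w) \<cdot>\<^sub>c monomial e [1,2,3,4,5,6,7]"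
proof
  fix vs
  let ?\<phi> = "g2_form e" and ?vol = "monomial e [1,2,3,4,5,6,7] vs"
  obtain v where v: "dual_frame 7 e v" using coframe_has_dual_frame e by blast
  define B where "B u w = (contract u ?\<phi> \<and>\<^sub>w contract w ?\<phi> \<and>\<^sub>w ?\<phi>) vs" for u w
  have lin: "linear (\<lambda>u. B u w)" "linear (\<lambda>u. B w u)" for w
    by (rule linearI; simp add: B_def contract_vec_linear[OF alternating_g2_form[OF e]] wedge_bilinear
        cov_scale_apply)+
  have expand: "u = (\<Sum>i=1..7. e i [u] *\<^sub>R v i)" for u using v unfolding dual_frame_def by blast
  have "B u w = (\<Sum>i=1..7. e i [u] * B (v i) w)"
    by (subst expand[of u]) (simp add: linear_sum[OF lin(1)] linear_scale[OF lin(1)])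
  also have "\<dots> = (\<Sum>i=1..7. e i [u] * (\<Sum>j=1..7. e j [w] * B (v i) (v j)))"
    by (subst expand[of w]) (simp add: linear_sum[OF lin(2)] linear_scale[OF lin(2)])
  also have "\<dots> = (\<Sum>i=1..7. e i [u] * (\<Sum>j=1..7. if i = j then e j [w] * (6 * ?vol) else 0))"
    unfolding B_def
    by (intro sum.cong refl arg_cong2[where f = "(*)"])
      (simp add: g2_form_bilinear_on_frame[OF e v] cov_scale_apply del: One_nat_def monomial.simps)
  also have "\<dots> = 6 * coframe_metric 7 e u w * ?vol"
    unfolding coframe_metric_def
    by (simp add: sum_distrib_left sum_distrib_right mult_ac del: One_nat_def monomial.simps)
  finally show "(contract u ?\<phi> \<and>\<^sub>w contract w ?\<phi> \<and>\<^sub>w ?\<phi>) vs =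
     ((6 * coframe_metric 7 e u w) \<cdot>\<^sub>c monomial e [1,2,3,4,5,6,7]) vs"
    unfolding B_def cov_scale_apply .
qed

lemma monomial_cong: "(\<And>i. i \<in> set L \<Longrightarrow> e i = e' i) \<Longrightarrow> monomial e L = monomial e' L"
  by (induction L) (simp_all add: monomial_Cons monomial_Nil del: monomial.simps)

lemma monomial_map: "monomial e L (map f vs) = monomial (\<lambda>i us. e i (map f us)) L vs"
proof -
  have "(\<lambda>us. monomial e L (map f us)) = monomial (\<lambda>i us. e i (map f us)) L"
    by (induction L)
      (simp_all add: monomial_Cons monomial_Nil wedge_map cov_one_def del: monomial.simps)
  then show ?thesis by metis
qed

lemma alternating_scale_arguments:
  "alternating k \<alpha> \<Longrightarrow> \<alpha> (map (\<lambda>x. c *\<^sub>R f x) bs) = c ^ length bs * \<alpha> (map f bs)"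
proof (induction bs arbitrary: k \<alpha>)
  case (Cons b bs)
  have "\<alpha> (map (\<lambda>x. c *\<^sub>R f x) (b # bs)) = c * contract (f b) \<alpha> (map (\<lambda>x. c *\<^sub>R f x) bs)"
    using linear_scale[OF alternating_linear_first[OF Cons.prems]] by (simp add: contract_def)
  also have "\<dots> = c * (c ^ length bs * contract (f b) \<alpha> (map f bs))"
    using Cons.IH[OF alternating_contract_pred[OF Cons.prems]] by simp
  finally show ?case by (simp add: contract_def)
qed simp

text \<open>The linear map carrying one dual frame to the other pulls the second coframe back to the
  first, and with it every expression in the coframe.\<close>

lemma g2_form_transport:
  assumes "coframe 7 e" "coframe 7 e'" "dual_frame 7 e v" "dual_frame 7 e' v'" "set js \<subseteq> {1..7}"
  shows "g2_form e (map v js) = g2_form e' (map v' js)"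
proof -
  define A where "A u = (\<Sum>i=1..7. e i [u] *\<^sub>R v' i)" for u
  have Av: "A (v j) = v' j" if "j \<in> {1..7}" for j
  proof -
    have "A (v j) = (\<Sum>i=1..7. if i = j then v' i else 0)"
      unfolding A_def using assms(3) that by (intro sum.cong) (auto simp: dual_frame_def)
    then show ?thesis using that by simp
  qed
  have eA: "e i = (\<lambda>us. e' i (map A us))" if i: "i \<in> {1..7}" for i
  proof
    fix us
    have one: "one_form (e i)" "one_form (e' i)" and lin: "linear (\<lambda>u. e' i [u])"
      using assms(1,2) i alternating_one_form alternating_1_linear unfolding coframe_def by blast+
    have "e' i [A u] = e i [u]" for u
    proof -
      have "e' i [A u] = (\<Sum>k=1..7. if k = i then e k [u] else 0)"
        unfolding A_def linear_sum[OF lin] linear_scale[OF lin]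
        using assms(4) i by (intro sum.cong) (auto simp: dual_frame_def)
      then show ?thesis using i by simp
    qed
    moreover have "e i us = e' i (map A us)" if "length us \<noteq> 1"
      using that one by (simp add: one_form_def)
    ultimately show "e i us = e' i (map A us)"
      by (cases "length us = 1") (auto simp: length_Suc_conv)
  qed
  have "monomial e L us = monomial e' L (map A us)" if "set L \<subseteq> {1..7}" for L us
    unfolding monomial_map using monomial_cong[of L e "\<lambda>i us. e' i (map A us)"] eA that by (metis subsetD)
  then have "g2_form e us = g2_form e' (map A us)" for us
    unfolding g2_form_def by (simp del: One_nat_def monomial.simps)
  moreover have "map A (map v js) = map v' js" using Av assms(5) by auto
  ultimately show ?thesis by metis
qed

lemma g2_form_nonzero:
  assumes e: "coframe 7 e" and v: "dual_frame 7 e v"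
  shows "g2_form e (map v [1,2,7]) = 1"
proof -
  have "g2_form e (map v [1,2,7]) = contract (v 1) (g2_form e) [v 2, v 7]"
    by (simp add: contract_def)
  also have "\<dots> = 1"
    unfolding contract_g2_form[OF e v]
    using coframe_one_form[OF e] g2_dual_frame_eval[OF e v]
    by (simp add: wedge_Cons wedge_Nil contract_def parity_def one_form_def del: One_nat_def)
  finally show ?thesis .
qed

text \<open>By Bryant's formula the two metrics differ by a positive factor \<open>r\<close>. The
  square norm of a 3-form scales with the third power of the inverse metric, whereas the square norm
  of \<open>\<phi>\<close> in an adapted coframe is a universal constant; hence \<open>r =
  1\<close>, and Bryant's formula then identifies the volumes.\<close>

lemma g2_adapted_unique:
  fixes e e' :: "nat \<Rightarrow> 'e::euclidean_space covector"
  assumes "g2_adapted e \<phi>" "g2_adapted e' \<phi>"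
  shows "coframe_metric 7 e = coframe_metric 7 e'"
    and "monomial e [1,2,3,4,5,6,7] = monomial e' [1,2,3,4,5,6,7]"
proof -
  have e: "coframe 7 e" and e': "coframe 7 e'" and \<phi>: "\<phi> = g2_form e" "\<phi> = g2_form e'"
    using assms unfolding g2_adapted_iff by auto
  define g g' where "g = coframe_metric 7 e" and "g' = coframe_metric 7 e'"
  define vol vol' where "vol = monomial e [1,2,3,4,5,6,7]" and "vol' = monomial e' [1,2,3,4,5,6,7]"
  obtain v where v: "dual_frame 7 e v" using coframe_has_dual_frame e by blast
  obtain v' where v': "dual_frame 7 e' v'" using coframe_has_dual_frame e' by blast
  have B: "g u w * vol vs = g' u w * vol' vs" for u w vs
  proof -
    have "(6 * g u w) \<cdot>\<^sub>c vol = (6 * g' u w) \<cdot>\<^sub>c vol'"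
      using g2_form_bilinear[OF e, of u w] g2_form_bilinear[OF e', of u w] \<phi>
      unfolding g_def g'_def vol_def vol'_def by argo
    then show ?thesis by (metis cov_scale_apply mult.assoc mult_left_cancel zero_neq_numeral)
  qed
  define r where "r = vol' (map v [1,2,3,4,5,6,7])"
  have "vol (map v [1,2,3,4,5,6,7]) = 1"
    using monomial_append_dual_frame[OF v coframe_one_form[OF e], where L = "[1,2,3,4,5,6,7]" and J = "[]" and ws = "[]"]
    unfolding vol_def by simp
  then have gg': "g u w = r * g' u w" for u w
    using B[of u w "map v [1,2,3,4,5,6,7]"] by (simp add: r_def mult.commute)
  have g11: "g (v 1) (v 1) = 1"
  proof -
    have "g (v 1) (v 1) = (\<Sum>i\<in>{1..7::nat}. if i = 1 then 1 else 0)"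
      unfolding g_def coframe_metric_def using v by (intro sum.cong) (auto simp: dual_frame_def)
    then show ?thesis by simp
  qed
  have "g' (v 1) (v 1) \<ge> 0" unfolding g'_def coframe_metric_def by (intro sum_nonneg) simp
  then have pos: "r > 0" using g11 gg'[of "v 1" "v 1"]
    by (metis mult_nonpos_nonneg not_less zero_less_one order.strict_trans1 less_irrefl)
  have sharp: "sharp g' b = r *\<^sub>R sharp g b" for b
  proof (rule sharp_eqI[OF e' g'_def])
    fix u
    have "g' (r *\<^sub>R sharp g b) u = r * g' (sharp g b) u"
    proof -
      have "e' i [r *\<^sub>R x] = r * e' i [x]" if "i \<in> {1..7}" for i x
        using linear_scale[OF alternating_1_linear[OF coframe_alternating[OF e' that]]] by simp
      then show ?thesis unfolding g'_def coframe_metric_def sum_distrib_left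
        by (intro sum.cong) (simp_all add: mult_ac)
    qed
    also have "\<dots> = b \<bullet> u"
      using coframe_metric_sharp[OF e, of b u] gg' unfolding g_def by simp
    finally show "g' (r *\<^sub>R sharp g b) u = b \<bullet> u" .
  qed
  have alt: "alternating 3 \<phi>" using alternating_g2_form e \<phi>(1) by blast
  \<comment> \<open>The square norm of \<open>\<phi>\<close>, up to the factor 3!, computed in the frame dual to \<open>e\<close>.\<close>
  define N where "N = full_contraction 7 v 3 \<phi> \<phi> []"
  have "full_contraction 7 v' 3 \<phi> \<phi> [] = (\<Sum>bs\<in>lists_of_length Basis 3. \<phi> (map (sharp g') bs) * \<phi> bs)"
    using sharp_contraction[OF e' v' alt alt, where k = 3 and ws = "[]"] unfolding g'_def by simp
  also have "\<dots> = (\<Sum>bs\<in>lists_of_length Basis 3. r ^ 3 * (\<phi> (map (sharp g) bs) * \<phi> bs))"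
    unfolding sharp by (intro sum.cong refl) (simp add: alternating_scale_arguments[OF alt])
  also have "\<dots> = r ^ 3 * N"
    using sharp_contraction[OF e v alt alt, where k = 3 and ws = "[]"] unfolding N_def g_def
    by (simp add: sum_distrib_left[symmetric])
  finally have "full_contraction 7 v' 3 \<phi> \<phi> [] = r ^ 3 * N" .
  moreover have "full_contraction 7 v' 3 \<phi> \<phi> [] = N"
    unfolding N_def full_contraction_def
  proof (intro sum.cong refl)
    fix js assume "js \<in> lists_of_length {1..7::nat} 3"
    then have "\<phi> (map v' js) = \<phi> (map v js)" using g2_form_transport[OF e e' v v'] \<phi> by auto
    then show "\<phi> (map v' js) * \<phi> (map v' js @ []) = \<phi> (map v js) * \<phi> (map v js @ [])" by simp
  qed
  moreover have "N > 0"
  proof -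
    have "finite (lists_of_length {1..7::nat} 3)" by (rule finite_lists_length_eq) simp
    then have "0 < (\<Sum>js\<in>lists_of_length {1..7} 3. (\<phi> (map v js))\<^sup>2)"
      by (rule sum_pos2[of _ "[1,2,7]"]) (use g2_form_nonzero[OF e v] \<phi> in auto)
    then show ?thesis unfolding N_def full_contraction_def by (simp add: power2_eq_square)
  qed
  ultimately have "r ^ 3 = 1" by simp
  then have "r = 1" using pos power_eq_1_iff[of r 3] by auto
  then have "g = g'" using gg' by (auto simp: fun_eq_iff)
  then show "coframe_metric 7 e = coframe_metric 7 e'" unfolding g_def g'_def .
  have "vol = vol'" using B[of "v 1" "v 1"] g11 \<open>g = g'\<close> by (auto simp: fun_eq_iff)
  then show "monomial e [1,2,3,4,5,6,7] = monomial e' [1,2,3,4,5,6,7]" unfolding vol_def vol'_def .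
qed

lemma g2_metric_eq: "g2_adapted e \<phi> \<Longrightarrow> g2_metric \<phi> = coframe_metric 7 e"
  unfolding g2_metric_def using g2_adapted_unique(1) by (intro the_equality) blast+

lemma g2_volume_eq: "g2_adapted e \<phi> \<Longrightarrow> g2_volume \<phi> = monomial e [1,2,3,4,5,6,7]"
  unfolding g2_volume_def using g2_adapted_unique(2) by (intro the_equality) blast+

section \<open>From SU(3) to G2 by adding a line\<close>

lemma hodge_star_monomial_split:
  assumes e: "coframe 7 e" and "monomial e [1,2,3,4,5,6,7] = s \<cdot>\<^sub>c monomial e (L @ J)"
    and "set (L @ J) \<subseteq> {1..7}" "distinct (L @ J)" "length L = k"
  shows "hodge_star (coframe_metric 7 e) (monomial e [1,2,3,4,5,6,7]) k (monomial e L) = s \<cdot>\<^sub>c monomial e J"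
  using hodge_star_monomial[OF assms(1-4)] assms(5) by simp

context
  fixes e :: "nat \<Rightarrow> 'e::euclidean_space covector"
  assumes e: "coframe 7 e"
begin

text \<open>The argument is \<open>\<omega>\<^sup>2 / 2\<close> for the SU(3)-structure of the first
  six covectors, and the value is \<open>\<omega> \<and> e 7\<close>.\<close>

lemma hodge_star_4_squares:
  "hodge_star (coframe_metric 7 e) (monomial e [1,2,3,4,5,6,7]) 4
     (monomial e [1,2,3,4] + monomial e [1,2,5,6] + monomial e [3,4,5,6]) =
   monomial e [1,2,7] + monomial e [3,4,7] + monomial e [5,6,7]"
  (is "hodge_star ?g ?vol 4 _ = _")
proof -
  note sort = normal_order coframe_one_form[OF e] cov_scale_simps
  have "hodge_star ?g ?vol 4 (monomial e [1,2,3,4]) = 1 \<cdot>\<^sub>c monomial e [5,6,7]"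
    "hodge_star ?g ?vol 4 (monomial e [1,2,5,6]) = 1 \<cdot>\<^sub>c monomial e [3,4,7]"
    "hodge_star ?g ?vol 4 (monomial e [3,4,5,6]) = 1 \<cdot>\<^sub>c monomial e [1,2,7]"
    by (rule hodge_star_monomial_split[OF e]; simp add: sort del: One_nat_def)+
  then show ?thesis by (simp add: hodge_star_linear cov_scale_simps add_ac del: One_nat_def monomial.simps)
qed

text \<open>The argument is \<open>\<psi>m \<and> e 7\<close> and the value is
  \<open>\<psi>p\<close> for the SU(3)-structure of the first six covectors.\<close>

lemma hodge_star_4_rest:
  "hodge_star (coframe_metric 7 e) (monomial e [1,2,3,4,5,6,7]) 4
     (- monomial e [2,4,6,7] + monomial e [2,3,5,7] + monomial e [1,4,5,7] + monomial e [1,3,6,7]) =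
   monomial e [1,3,5] - monomial e [1,4,6] - monomial e [2,3,6] - monomial e [2,4,5]"
  (is "hodge_star ?g ?vol 4 _ = _")
proof -
  note sort = normal_order coframe_one_form[OF e] cov_scale_simps
  have "hodge_star ?g ?vol 4 (monomial e [2,4,6,7]) = (-1) \<cdot>\<^sub>c monomial e [1,3,5]"
    "hodge_star ?g ?vol 4 (monomial e [2,3,5,7]) = (-1) \<cdot>\<^sub>c monomial e [1,4,6]"
    "hodge_star ?g ?vol 4 (monomial e [1,4,5,7]) = (-1) \<cdot>\<^sub>c monomial e [2,3,6]"
    "hodge_star ?g ?vol 4 (monomial e [1,3,6,7]) = (-1) \<cdot>\<^sub>c monomial e [2,4,5]"
    by (rule hodge_star_monomial_split[OF e]; simp add: sort uminus_as_scale[symmetric] del: One_nat_def)+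
  then show ?thesis
    by (simp add: hodge_star_linear uminus_as_scale[symmetric] del: One_nat_def monomial.simps)
qed

lemma hodge_star_g2_form:
  "hodge_star (coframe_metric 7 e) (monomial e [1,2,3,4,5,6,7]) 3 (g2_form e) =
     (monomial e [1,2,3,4] + monomial e [1,2,5,6] + monomial e [3,4,5,6]) +
     (- monomial e [2,4,6,7] + monomial e [2,3,5,7] + monomial e [1,4,5,7] + monomial e [1,3,6,7])"
  (is "hodge_star ?g ?vol 3 _ = _")
proof -
  note sort = normal_order coframe_one_form[OF e] cov_scale_simps
  have "hodge_star ?g ?vol 3 (monomial e [1,2,7]) = 1 \<cdot>\<^sub>c monomial e [3,4,5,6]"
    "hodge_star ?g ?vol 3 (monomial e [3,4,7]) = 1 \<cdot>\<^sub>c monomial e [1,2,5,6]"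
    "hodge_star ?g ?vol 3 (monomial e [5,6,7]) = 1 \<cdot>\<^sub>c monomial e [1,2,3,4]"
    "hodge_star ?g ?vol 3 (monomial e [1,3,5]) = (-1) \<cdot>\<^sub>c monomial e [2,4,6,7]"
    "hodge_star ?g ?vol 3 (monomial e [1,4,6]) = (-1) \<cdot>\<^sub>c monomial e [2,3,5,7]"
    "hodge_star ?g ?vol 3 (monomial e [2,3,6]) = (-1) \<cdot>\<^sub>c monomial e [1,4,5,7]"
    "hodge_star ?g ?vol 3 (monomial e [2,4,5]) = (-1) \<cdot>\<^sub>c monomial e [1,3,6,7]"
    by (rule hodge_star_monomial_split[OF e]; simp add: sort uminus_as_scale[symmetric] del: One_nat_def)+
  then show ?thesis
    by (simp add: g2_form_def hodge_star_linear cov_scale_simps uminus_as_scale[symmetric]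
        add_ac del: One_nat_def monomial.simps)
qed

end

definition pull_cov :: "'e covector \<Rightarrow> ('e \<times> real) covector" where
  "pull_cov \<alpha> = (\<lambda>vs. \<alpha> (map fst vs))"

definition ds_cov :: "('e \<times> real) covector" where
  "ds_cov = (\<lambda>vs. if length vs = 1 then snd (hd vs) else 0)"

lemma pull_cov_linear:
  "pull_cov (\<alpha> + \<beta>) = pull_cov \<alpha> + pull_cov \<beta>" "pull_cov (\<alpha> - \<beta>) = pull_cov \<alpha> - pull_cov \<beta>"
  "pull_cov (- \<alpha>) = - pull_cov \<alpha>" "pull_cov (a \<cdot>\<^sub>c \<alpha>) = a \<cdot>\<^sub>c pull_cov \<alpha>"
  "pull_cov 0 = 0"
  by (rule ext, simp add: pull_cov_def cov_scale_def)+

lemma pull_cov_wedge: "pull_cov (\<alpha> \<and>\<^sub>w \<beta>) = pull_cov \<alpha> \<and>\<^sub>w pull_cov \<beta>"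
  unfolding pull_cov_def by (rule ext) (rule wedge_map)

lemma pull_cov_monomial: "pull_cov (monomial e L) = monomial (\<lambda>i. pull_cov (e i)) L"
  unfolding pull_cov_def by (rule ext) (rule monomial_map)

lemma alternating_pull_cov:
  fixes \<alpha> :: "'e::real_vector covector"
  assumes "alternating k \<alpha>" shows "alternating k (pull_cov \<alpha>)"
  unfolding alternating_def pull_cov_def
proof (intro conjI allI impI)
  fix vs :: "('e \<times> real) list" and i assume "length vs = k \<and> i < k"
  then have "linear (\<lambda>v. \<alpha> ((map fst vs)[i := v]))"
    using assms unfolding alternating_def by auto
  then have "linear ((\<lambda>v. \<alpha> ((map fst vs)[i := v])) \<circ> fst)"
    by (intro linear_compose linear_fst)
  then show "linear (\<lambda>v. \<alpha> (map fst (vs[i := v])))" by (simp add: o_def map_update)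
next
  fix vs :: "('e \<times> real) list" and i j
  assume *: "length vs = k \<and> i < j \<and> j < k \<and> vs ! i = vs ! j"
  then have "length (map fst vs) = k \<and> i < j \<and> j < k \<and> map fst vs ! i = map fst vs ! j" by simp
  then show "\<alpha> (map fst vs) = 0" using assms unfolding alternating_def by blast
qed (use assms in \<open>auto simp: alternating_def\<close>)

lemma alternating_1I:
  assumes "one_form \<theta>" "linear (\<lambda>v. \<theta> [v])" shows "alternating 1 \<theta>"
  unfolding alternating_def
proof (intro conjI allI impI)
  fix vs :: "'a list" and i :: nat assume "length vs = 1 \<and> i < 1"
  then show "linear (\<lambda>v. \<theta> (vs[i := v]))" using assms(2) by (auto simp: length_Suc_conv)
qed (use assms(1) in \<open>auto simp: one_form_def\<close>)

lemma alternating_ds_cov: "alternating 1 (ds_cov :: ('e::real_vector \<times> real) covector)"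
  by (rule alternating_1I) (auto simp: one_form_def ds_cov_def linear_snd)

text \<open>The coframe on the product with a line that is orthonormal for \<open>g + f\<^sup>2
  ds\<^sup>2\<close>.\<close>

definition warp :: "real \<Rightarrow> (nat \<Rightarrow> 'e covector) \<Rightarrow> nat \<Rightarrow> ('e \<times> real) covector" where
  "warp f e = (\<lambda>i. if i = 7 then f \<cdot>\<^sub>c ds_cov else pull_cov (e i))"

lemma warp_eval:
  "warp f e 7 [(u, h)] = f * h" "i \<noteq> 7 \<Longrightarrow> warp f e i [(u, h)] = e i [u]"
  by (simp_all add: warp_def pull_cov_def ds_cov_def cov_scale_def)

lemma coframe_warp:
  fixes e :: "nat \<Rightarrow> 'e::euclidean_space covector"
  assumes e: "coframe 6 e" and "f \<noteq> 0" shows "coframe 7 (warp f e)"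
  unfolding coframe_def
proof (intro conjI ballI allI impI)
  have dim: "DIM('e) = 6" and alt: "\<And>i. i \<in> {1..6} \<Longrightarrow> alternating 1 (e i)"
    and indep: "\<And>a i. (\<And>v. (\<Sum>i=1..6. a i * e i [v]) = 0) \<Longrightarrow> i \<in> {1..6} \<Longrightarrow> a i = 0"
    using e unfolding coframe_def by auto
  show "DIM('e \<times> real) = 7" using dim by simp
  have split: "{1..7} = insert 7 {1..6::nat}" by auto
  show "alternating 1 (warp f e i)" if "i \<in> {1..7}" for i
  proof (cases "i = 7")
    case True
    then show ?thesis using alternating_scale[OF alternating_ds_cov] by (simp add: warp_def)
  next
    case False
    then show ?thesis using that alternating_pull_cov[OF alt[of i]] by (simp add: warp_def)
  qed
  fix a and i :: nat assume rel: "\<forall>v. (\<Sum>i=1..7. a i * warp f e i [v]) = 0" and i: "i \<in> {1..7}"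
  have sum: "(\<Sum>i=1..7. a i * warp f e i [(u, h)]) = a 7 * (f * h) + (\<Sum>i=1..6. a i * e i [u])" for u h
    unfolding split by (simp add: warp_eval)
  have lin: "linear (\<lambda>v. e i [v])" if "i \<in> {1..6}" for i using alternating_1_linear alt that by blast
  have "(\<Sum>i=1..6. a i * e i [0]) = 0" using linear_0[OF lin] by (intro sum.neutral) auto
  then have "a 7 * f = 0" using sum[of 0 1] rel by auto
  then have "a 7 = 0" using \<open>f \<noteq> 0\<close> by simp
  moreover from this have "(\<Sum>i=1..6. a i * e i [u]) = 0" for u using sum[of u 0] rel by auto
  ultimately show "a i = 0" using indep[of a i] i unfolding split by auto
qed

lemma coframe_metric_warp:
  "coframe_metric 7 (warp f e) (u, h) (v, k) = coframe_metric 6 e u v + f\<^sup>2 * h * k"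
proof -
  have split: "{1..7} = insert 7 {1..6::nat}" by auto
  show ?thesis unfolding coframe_metric_def split
    by (simp add: warp_eval power2_eq_square mult_ac)
qed

lemma monomial_warp:
  assumes "7 \<notin> set L" shows "monomial (warp f e) L = pull_cov (monomial e L)"
  unfolding pull_cov_monomial using assms by (intro monomial_cong) (auto simp: warp_def)

lemma monomial_warp_7:
  assumes "7 \<notin> set L" shows "monomial (warp f e) (L @ [7]) = f \<cdot>\<^sub>c (pull_cov (monomial e L) \<and>\<^sub>w ds_cov)"
  unfolding monomial_append monomial_warp[OF assms] by (simp add: warp_def wedge_bilinear)

text \<open>The instances needed for rewriting, since unification does not split a literal list at
  its end.\<close>

lemmas monomial_warp_simps =
  monomial_warp_7[where L = "[i, j]" for i j, simplified append_Cons append_Nil]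
  monomial_warp_7[where L = "[i, j, k]" for i j k, simplified append_Cons append_Nil]
  monomial_warp_7[where L = "[i, j, k, l, m, n]" for i j k l m n, simplified append_Cons append_Nil]

text \<open>Multiplication of the complex one-form \<open>e 1 + \<i> e 2\<close> by
  \<open>\<i>\<close>. The complex volume form \<open>(e 1 + \<i> e 2) \<and> (e 3 + \<i> e 4)
  \<and> (e 5 + \<i> e 6)\<close>, whose real and imaginary parts are \<open>\<psi>p\<close> and
  \<open>\<psi>m\<close>, is multiplied by \<open>\<i>\<close> as well.\<close>

definition phase_rotate :: "(nat \<Rightarrow> 'e covector) \<Rightarrow> nat \<Rightarrow> 'e covector" where
  "phase_rotate e = (\<lambda>i. if i = 1 then - e 2 else if i = 2 then e 1 else e i)"

lemma su3_adapted_one_form: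
  assumes "su3_adapted e \<omega> \<psi>p \<psi>m" "i \<in> {1..6}" shows "one_form (e i)"
  using assms alternating_one_form unfolding su3_adapted_def coframe_def by blast

lemma coframe_rotate:
  fixes e :: "nat \<Rightarrow> 'e::euclidean_space covector"
  assumes e: "coframe 6 e" shows "coframe 6 (phase_rotate e)"
  unfolding coframe_def
proof (intro conjI ballI allI impI)
  have alt: "\<And>i. i \<in> {1..6} \<Longrightarrow> alternating 1 (e i)"
    and indep: "\<And>a i. (\<And>v. (\<Sum>i=1..6. a i * e i [v]) = 0) \<Longrightarrow> i \<in> {1..6} \<Longrightarrow> a i = 0"
    using e unfolding coframe_def by auto
  show "DIM('e) = 6" using e unfolding coframe_def by blast
  show "alternating 1 (phase_rotate e i)" if "i \<in> {1..6}" for i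
    using that alt by (auto simp: phase_rotate_def intro!: alternating_minus)
  fix a and i :: nat assume rel: "\<forall>v. (\<Sum>i=1..6. a i * phase_rotate e i [v]) = 0" and i: "i \<in> {1..6}"
  \<comment> \<open>The coefficients of the given relation with respect to the coframe before rotation.\<close>
  define a' where "a' = (\<lambda>i::nat. if i = 1 then a 2 else if i = 2 then - a 1 else a i)"
  have "(\<Sum>i=1..6. a' i * e i [v]) = (\<Sum>i=1..6. a i * phase_rotate e i [v])" for v
    by (simp add: a'_def phase_rotate_def eval_nat_numeral)
  then have a': "a' j = 0" if "j \<in> {1..6}" for j using indep[of a' j] rel that by auto
  show "a i = 0" using a'[of 1] a'[of 2] a'[of i] i by (auto simp: a'_def split: if_splits)
qed

lemma coframe_metric_rotate: "coframe_metric 6 (phase_rotate e) = coframe_metric 6 e"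
  by (intro ext) (simp add: coframe_metric_def phase_rotate_def eval_nat_numeral)

text \<open>This reconciles the warped form \<open>f \<omega> \<and> ds - \<psi>m\<close> with the
  model G2-form, in which \<open>\<psi>p\<close> stands in the place of \<open>-
  \<psi>m\<close>.\<close>

lemma su3_adapted_rotate:
  assumes "su3_adapted e \<omega> \<psi>p \<psi>m" shows "su3_adapted (phase_rotate e) \<omega> (- \<psi>m) \<psi>p"
proof -
  have one: "one_form (e i)" if "i \<in> {1..6}" for i using su3_adapted_one_form assms that by blast
  show ?thesis using assms coframe_rotate unfolding su3_adapted_def
    by (auto simp: phase_rotate_def normal_order one simp del: One_nat_def)
qed

lemma g2_adapted_warp:
  fixes e :: "nat \<Rightarrow> 'e::euclidean_space covector"
  assumes "su3_adapted e \<omega> \<psi>p \<psi>m" "f \<noteq> 0"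
  shows "g2_adapted (warp f e) (f \<cdot>\<^sub>c (pull_cov \<omega> \<and>\<^sub>w ds_cov) + pull_cov \<psi>p)"
proof -
  have "coframe 7 (warp f e)" using assms coframe_warp unfolding su3_adapted_def by blast
  moreover have "f \<cdot>\<^sub>c (pull_cov \<omega> \<and>\<^sub>w ds_cov) + pull_cov \<psi>p = g2_form (warp f e)"
  proof -
    have "\<omega> = monomial e [1,2] + monomial e [3,4] + monomial e [5,6]"
      "\<psi>p = monomial e [1,3,5] - monomial e [1,4,6] - monomial e [2,3,6] - monomial e [2,4,5]"
      using assms(1) unfolding su3_adapted_def by auto
    then show ?thesis unfolding g2_form_def
      by (simp add: monomial_warp_simps monomial_warp pull_cov_linear wedge_bilinear
          del: One_nat_def monomial.simps)
        (rule ext, simp add: cov_scale_def algebra_simps)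
  qed
  ultimately show ?thesis unfolding g2_adapted_iff by blast
qed

text \<open>Two coframes adapted to the same SU(3)-structure become adapted to the same G2-structure
  on the product with a line, whose metric restricts to both.\<close>

lemma su3_metric_eq:
  fixes e :: "nat \<Rightarrow> 'e::euclidean_space covector"
  assumes "su3_adapted e \<omega> \<psi>p \<psi>m" shows "su3_metric \<omega> \<psi>p \<psi>m = coframe_metric 6 e"
  unfolding su3_metric_def
proof (rule the_equality)
  fix g assume "\<exists>e'. su3_adapted e' \<omega> \<psi>p \<psi>m \<and> g = coframe_metric 6 e'"
  then obtain e' where e': "su3_adapted e' \<omega> \<psi>p \<psi>m" "g = coframe_metric 6 e'" by blast
  have "coframe_metric 7 (warp 1 e) = coframe_metric 7 (warp 1 e')"
    using g2_adapted_unique(1) g2_adapted_warp[OF assms, of 1] g2_adapted_warp[OF e'(1), of 1] by simp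
  then have "coframe_metric 6 e u v = coframe_metric 6 e' u v" for u v
    using coframe_metric_warp[of 1 e u 0 v 0] coframe_metric_warp[of 1 e' u 0 v 0] by simp
  then show "g = coframe_metric 6 e" unfolding e'(2) by (simp add: fun_eq_iff)
qed (use assms in blast)

lemma su3_omega_square:
  assumes "su3_adapted e \<omega> \<psi>p \<psi>m"
  shows "\<omega> \<and>\<^sub>w \<omega> = 2 \<cdot>\<^sub>c (monomial e [1,2,3,4] + monomial e [1,2,5,6] + monomial e [3,4,5,6])"
proof -
  have \<omega>: "\<omega> = monomial e [1,2] + monomial e [3,4] + monomial e [5,6]"
    using assms unfolding su3_adapted_def by auto
  have one: "one_form (e i)" if "i \<in> {1..6}" for i using su3_adapted_one_form assms that by blast
  show ?thesis unfolding \<omega>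
    by (rule ext, simp add: normal_order one cov_scale_apply del: One_nat_def)
qed

lemma su3_omega_cube:
  assumes "su3_adapted e \<omega> \<psi>p \<psi>m"
  shows "\<omega> \<and>\<^sub>w \<omega> \<and>\<^sub>w \<omega> = 6 \<cdot>\<^sub>c monomial e [1,2,3,4,5,6]"
proof -
  have \<omega>: "\<omega> = monomial e [1,2] + monomial e [3,4] + monomial e [5,6]"
    using assms unfolding su3_adapted_def by auto
  have one: "one_form (e i)" if "i \<in> {1..6}" for i using su3_adapted_one_form assms that by blast
  show ?thesis unfolding su3_omega_square[OF assms] unfolding \<omega>
    by (rule ext, simp add: normal_order one cov_scale_apply del: One_nat_def)
qed

text \<open>The forms are of complex type (1,1) and (3,0) + (0,3), so their product would have type
  (4,1) + (1,4) in complex dimension 3.\<close>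

lemma su3_omega_psi:
  assumes "su3_adapted e \<omega> \<psi>p \<psi>m"
  shows "\<omega> \<and>\<^sub>w \<psi>p = 0" "\<psi>p \<and>\<^sub>w \<omega> = 0"
proof -
  have *: "\<omega> = monomial e [1,2] + monomial e [3,4] + monomial e [5,6]"
    "\<psi>p = monomial e [1,3,5] - monomial e [1,4,6] - monomial e [2,3,6] - monomial e [2,4,5]"
    using assms unfolding su3_adapted_def by auto
  have one: "one_form (e i)" if "i \<in> {1..6}" for i using su3_adapted_one_form assms that by blast
  show "\<omega> \<and>\<^sub>w \<psi>p = 0" "\<psi>p \<and>\<^sub>w \<omega> = 0" unfolding *
    by (rule ext, simp add: normal_order one del: One_nat_def)+
qed

lemma su3_adapted_scale:
  assumes "su3_adapted e \<omega> \<psi>p \<psi>m" "r \<noteq> 0"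
  shows "su3_adapted (\<lambda>i. r \<cdot>\<^sub>c e i) (r\<^sup>2 \<cdot>\<^sub>c \<omega>) (r ^ 3 \<cdot>\<^sub>c \<psi>p) (r ^ 3 \<cdot>\<^sub>c \<psi>m)"
proof -
  have monomial: "monomial (\<lambda>i. r \<cdot>\<^sub>c e i) L = r ^ length L \<cdot>\<^sub>c monomial e L" for L
    by (induction L) (simp_all add: monomial_Cons monomial_Nil wedge_bilinear cov_scale_simps mult.commute
        del: monomial.simps)
  have e: "coframe 6 e" using assms(1) unfolding su3_adapted_def by blast
  have "coframe 6 (\<lambda>i. r \<cdot>\<^sub>c e i)" unfolding coframe_def
  proof (intro conjI ballI allI impI)
    show "DIM('a) = 6" using e unfolding coframe_def by blast
    show "alternating 1 (r \<cdot>\<^sub>c e i)" if "i \<in> {1..6}" for i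
      using e that alternating_scale unfolding coframe_def by blast
    fix a and i :: nat assume rel: "\<forall>v. (\<Sum>i=1..6. a i * (r \<cdot>\<^sub>c e i) [v]) = 0" and i: "i \<in> {1..6}"
    have "(\<Sum>i=1..6. a i * e i [v]) = (\<Sum>i=1..6. a i * (r \<cdot>\<^sub>c e i) [v]) / r" for v
      using assms(2) by (simp add: cov_scale_apply sum_divide_distrib)
    then show "a i = 0" using e rel i unfolding coframe_def by simp
  qed
  then show ?thesis using assms(1) unfolding su3_adapted_def
    by (auto simp: monomial simp del: One_nat_def monomial.simps)
      (rule ext, simp add: cov_scale_apply algebra_simps power2_eq_square power3_eq_cube
        del: One_nat_def monomial.simps)+
qed

context
  fixes e :: "nat \<Rightarrow> 'e::euclidean_space covector" and \<omega> \<psi>p \<psi>m f \<phi>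
  assumes su3: "su3_adapted e \<omega> \<psi>p \<psi>m" and f: "f \<noteq> 0"
    and \<phi>: "\<phi> = f \<cdot>\<^sub>c (pull_cov \<omega> \<and>\<^sub>w ds_cov) - pull_cov \<psi>m"
begin

lemma g2_adapted_warped: "g2_adapted (warp f (phase_rotate e)) \<phi>"
proof -
  have "\<phi> = f \<cdot>\<^sub>c (pull_cov \<omega> \<and>\<^sub>w ds_cov) + pull_cov (- \<psi>m)"
    unfolding \<phi> pull_cov_linear by (rule diff_conv_add_uminus)
  then show ?thesis using g2_adapted_warp[OF su3_adapted_rotate[OF su3] f] by simp
qed

lemma g2_metric_warped:
  "g2_metric \<phi> (u, h) (v, k) = su3_metric \<omega> \<psi>p \<psi>m u v + f\<^sup>2 * h * k"
  unfolding g2_metric_eq[OF g2_adapted_warped] su3_metric_eq[OF su3] coframe_metric_warp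
    coframe_metric_rotate ..

lemma g2_volume_warped:
  "g2_volume \<phi> = f \<cdot>\<^sub>c (pull_cov ((1 / fact 3) \<cdot>\<^sub>c (\<omega> \<and>\<^sub>w \<omega> \<and>\<^sub>w \<omega>)) \<and>\<^sub>w ds_cov)"
proof -
  have "(1 / fact 3) \<cdot>\<^sub>c (\<omega> \<and>\<^sub>w \<omega> \<and>\<^sub>w \<omega>) = monomial (phase_rotate e) [1,2,3,4,5,6]"
    unfolding su3_omega_cube[OF su3_adapted_rotate[OF su3]]
    by (simp add: cov_scale_simps fact_numeral del: One_nat_def monomial.simps)
  then show ?thesis
    unfolding g2_volume_eq[OF g2_adapted_warped]
    using monomial_warp_7[of "[1,2,3,4,5,6]" f "phase_rotate e"] by simp
qed

lemma coframe_warped: "coframe 7 (warp f (phase_rotate e))"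
  using g2_adapted_warped unfolding g2_adapted_iff by blast

lemma omega_square_warped:
  "pull_cov \<omega> \<and>\<^sub>w pull_cov \<omega> = 2 \<cdot>\<^sub>c (monomial (warp f (phase_rotate e)) [1,2,3,4]
     + monomial (warp f (phase_rotate e)) [1,2,5,6] + monomial (warp f (phase_rotate e)) [3,4,5,6])"
  unfolding pull_cov_wedge[symmetric] su3_omega_square[OF su3_adapted_rotate[OF su3]]
  by (simp add: monomial_warp pull_cov_linear del: One_nat_def monomial.simps)

lemma psi_ds_warped:
  "f \<cdot>\<^sub>c (pull_cov \<psi>p \<and>\<^sub>w ds_cov) = - monomial (warp f (phase_rotate e)) [2,4,6,7]
     + monomial (warp f (phase_rotate e)) [2,3,5,7] + monomial (warp f (phase_rotate e)) [1,4,5,7]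
     + monomial (warp f (phase_rotate e)) [1,3,6,7]"
proof -
  let ?e = "phase_rotate e"
  have "\<psi>p = - monomial ?e [2,4,6] + monomial ?e [2,3,5] + monomial ?e [1,4,5] + monomial ?e [1,3,6]"
    using su3_adapted_rotate[OF su3] unfolding su3_adapted_def by blast
  then show ?thesis
    by (simp add: monomial_warp_simps pull_cov_linear wedge_bilinear del: One_nat_def monomial.simps)
      (rule ext, simp add: cov_scale_def algebra_simps)
qed

lemma hodge_star_warped_3_form:
  "hodge_star (g2_metric \<phi>) (g2_volume \<phi>) 3 \<phi> =
     (1/2) \<cdot>\<^sub>c (pull_cov \<omega> \<and>\<^sub>w pull_cov \<omega>) + f \<cdot>\<^sub>c (pull_cov \<psi>p \<and>\<^sub>w ds_cov)"
proof -
  have "\<phi> = g2_form (warp f (phase_rotate e))" using g2_adapted_warped unfolding g2_adapted_iff by blast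
  then show ?thesis
    unfolding g2_metric_eq[OF g2_adapted_warped] g2_volume_eq[OF g2_adapted_warped]
      omega_square_warped psi_ds_warped
    using hodge_star_g2_form[OF coframe_warped] by (simp add: cov_scale_simps del: One_nat_def monomial.simps)
qed

lemma hodge_star_warped_omega_square:
  "hodge_star (g2_metric \<phi>) (g2_volume \<phi>) 4 (pull_cov \<omega> \<and>\<^sub>w pull_cov \<omega>) =
     (2 * f) \<cdot>\<^sub>c (pull_cov \<omega> \<and>\<^sub>w ds_cov)"
proof -
  let ?e = "phase_rotate e"
  have "\<omega> = monomial ?e [1,2] + monomial ?e [3,4] + monomial ?e [5,6]"
    using su3_adapted_rotate[OF su3] unfolding su3_adapted_def by blast
  then have "monomial (warp f ?e) [1,2,7] + monomial (warp f ?e) [3,4,7] + monomial (warp f ?e) [5,6,7]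
      = f \<cdot>\<^sub>c (pull_cov \<omega> \<and>\<^sub>w ds_cov)"
    by (simp add: monomial_warp_simps pull_cov_linear wedge_bilinear del: One_nat_def monomial.simps)
      (rule ext, simp add: cov_scale_def algebra_simps)
  then show ?thesis
    unfolding g2_metric_eq[OF g2_adapted_warped] g2_volume_eq[OF g2_adapted_warped]
      omega_square_warped hodge_star_linear(4) hodge_star_4_squares[OF coframe_warped]
    by (simp add: cov_scale_simps del: One_nat_def monomial.simps)
qed

lemma hodge_star_warped_psi_ds:
  "hodge_star (g2_metric \<phi>) (g2_volume \<phi>) 4 (pull_cov \<psi>p \<and>\<^sub>w ds_cov) = - (1 / f) \<cdot>\<^sub>c pull_cov \<psi>m"
proof -
  let ?e = "phase_rotate e"
  have "- \<psi>m = monomial ?e [1,3,5] - monomial ?e [1,4,6] - monomial ?e [2,3,6] - monomial ?e [2,4,5]"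
    using su3_adapted_rotate[OF su3] unfolding su3_adapted_def by blast
  then have "monomial (warp f ?e) [1,3,5] - monomial (warp f ?e) [1,4,6] - monomial (warp f ?e) [2,3,6]
     - monomial (warp f ?e) [2,4,5] = pull_cov (- \<psi>m)"
    by (simp add: monomial_warp pull_cov_linear del: One_nat_def monomial.simps)
  then have "hodge_star (g2_metric \<phi>) (g2_volume \<phi>) 4 (f \<cdot>\<^sub>c (pull_cov \<psi>p \<and>\<^sub>w ds_cov)) = pull_cov (- \<psi>m)"
    unfolding g2_metric_eq[OF g2_adapted_warped] g2_volume_eq[OF g2_adapted_warped]
      psi_ds_warped hodge_star_4_rest[OF coframe_warped] .
  then have "(1 / f) \<cdot>\<^sub>c f \<cdot>\<^sub>c hodge_star (g2_metric \<phi>) (g2_volume \<phi>) 4 (pull_cov \<psi>p \<and>\<^sub>w ds_cov)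
      = (1 / f) \<cdot>\<^sub>c pull_cov (- \<psi>m)"
    unfolding hodge_star_linear by simp
  then show ?thesis using f by (simp add: cov_scale_simps pull_cov_linear) (auto simp: cov_scale_def)
qed

end

section \<open>Smooth functions and the exterior derivative\<close>

lemma frechet_derivative_works_at:
  "f differentiable (at x) \<Longrightarrow> (f has_derivative frechet_derivative f (at x)) (at x)"
  by (simp add: frechet_derivative_works)

lemma frechet_derivative_add:
  "f differentiable (at x) \<Longrightarrow> g differentiable (at x) \<Longrightarrow>
    frechet_derivative (\<lambda>y. f y + g y) (at x) v = frechet_derivative f (at x) v + frechet_derivative g (at x) v"
  using frechet_derivative_at[OF has_derivative_add[OF frechet_derivative_works_at frechet_derivative_works_at],
    of f x g] by metis

lemma frechet_derivative_diff:
  "f differentiable (at x) \<Longrightarrow> g differentiable (at x) \<Longrightarrow>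
    frechet_derivative (\<lambda>y. f y - g y) (at x) v = frechet_derivative f (at x) v - frechet_derivative g (at x) v"
  using frechet_derivative_at[OF has_derivative_diff[OF frechet_derivative_works_at frechet_derivative_works_at],
    of f x g] by metis

lemma frechet_derivative_cmult:
  fixes f :: "'a::real_normed_vector \<Rightarrow> real"
  shows "f differentiable (at x) \<Longrightarrow>
    frechet_derivative (\<lambda>y. c * f y) (at x) v = c * frechet_derivative f (at x) v"
  using frechet_derivative_at[OF has_derivative_mult_right[OF frechet_derivative_works_at], of f x c]
  by metis

lemma frechet_derivative_mult:
  fixes f g :: "'a::real_normed_vector \<Rightarrow> real"
  shows "f differentiable (at x) \<Longrightarrow> g differentiable (at x) \<Longrightarrow>
    frechet_derivative (\<lambda>y. f y * g y) (at x) v =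
      f x * frechet_derivative g (at x) v + frechet_derivative f (at x) v * g x"
  using frechet_derivative_at[OF has_derivative_mult[OF frechet_derivative_works_at frechet_derivative_works_at],
    of f x g] by metis

lemma frechet_derivative_sum:
  assumes "\<And>i. i \<in> I \<Longrightarrow> f i differentiable (at x)"
  shows "frechet_derivative (\<lambda>y. \<Sum>i\<in>I. f i y) (at x) v = (\<Sum>i\<in>I. frechet_derivative (f i) (at x) v)"
proof -
  have "((\<lambda>y. \<Sum>i\<in>I. f i y) has_derivative (\<lambda>v. \<Sum>i\<in>I. frechet_derivative (f i) (at x) v)) (at x)"
    by (intro has_derivative_sum frechet_derivative_works_at assms)
  then show ?thesis using frechet_derivative_at by metis
qed

lemma has_derivative_fst_arg:
  assumes "f differentiable (at (fst p))"
  shows "((\<lambda>q. f (fst q)) has_derivative (\<lambda>v. frechet_derivative f (at (fst p)) (fst v))) (at p)"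
proof -
  have "(f has_derivative frechet_derivative f (at (fst p))) (at (fst p))"
    using assms by (rule frechet_derivative_works_at)
  from has_derivative_compose[OF has_derivative_fst[OF has_derivative_ident] this]
  show ?thesis .
qed

lemma differentiable_fst_arg:
  "f differentiable (at (fst p)) \<Longrightarrow> (\<lambda>q. f (fst q)) differentiable (at p)"
  using has_derivative_fst_arg unfolding differentiable_def by blast

lemma frechet_derivative_fst_arg:
  "f differentiable (at (fst p)) \<Longrightarrow>
    frechet_derivative (\<lambda>q. f (fst q)) (at p) v = frechet_derivative f (at (fst p)) (fst v)"
  using frechet_derivative_at[OF has_derivative_fst_arg] by metis


text \<open>Derivatives at a point of an open set depend only on the values in that set. This lets
  the closure properties below replace the derivative of a combination by the combination of
  derivatives.\<close>

lemma Ck_on_cong: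
  assumes "open S" shows "(\<And>x. x \<in> S \<Longrightarrow> f x = g x) \<Longrightarrow> Ck_on k S f \<Longrightarrow> Ck_on k S g"
proof (induction k arbitrary: f g)
  case 0 then show ?case using continuous_on_cong[of S S f g] by simp
next
  case (Suc k)
  have diff: "f differentiable (at x)" if "x \<in> S" for x using Suc.prems that by simp
  have "g differentiable (at x)" if "x \<in> S" for x
    using frechet_derivative_works_at[OF diff[OF that]] has_derivative_transform_within_open[OF _ assms that]
      Suc.prems(1) unfolding differentiable_def by blast
  moreover have "Ck_on k S (\<lambda>x. frechet_derivative g (at x) v)" for v
  proof (rule Suc.IH)
    show "Ck_on k S (\<lambda>x. frechet_derivative f (at x) v)" using Suc.prems by simp
    show "frechet_derivative f (at x) v = frechet_derivative g (at x) v" if "x \<in> S" for x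
      using frechet_derivative_transform_within_open[OF diff[OF that] assms that] Suc.prems(1) by metis
  qed
  ultimately show ?case by simp
qed

lemma Ck_on_const: "Ck_on k S (\<lambda>x. c)"
  by (induction k arbitrary: c) simp_all

lemma Ck_on_add: "open S \<Longrightarrow> Ck_on k S f \<Longrightarrow> Ck_on k S g \<Longrightarrow> Ck_on k S (\<lambda>x. f x + g x)"
proof (induction k arbitrary: f g)
  case (Suc k)
  have "Ck_on k S (\<lambda>x. frechet_derivative (\<lambda>x. f x + g x) (at x) v)" for v
    by (rule Ck_on_cong[OF Suc.prems(1) _ Suc.IH[OF Suc.prems(1)]])
      (use Suc.prems in \<open>auto simp: frechet_derivative_add\<close>)
  then show ?case using Suc.prems by simp
qed (auto intro: continuous_on_add)

lemma Ck_on_cmult: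
  fixes f :: "'a::real_normed_vector \<Rightarrow> real"
  shows "open S \<Longrightarrow> Ck_on k S f \<Longrightarrow> Ck_on k S (\<lambda>x. c * f x)"
proof (induction k arbitrary: f)
  case (Suc k)
  have "Ck_on k S (\<lambda>x. frechet_derivative (\<lambda>x. c * f x) (at x) v)" for v
    by (rule Ck_on_cong[OF Suc.prems(1) _ Suc.IH[OF Suc.prems(1)]])
      (use Suc.prems in \<open>auto simp: frechet_derivative_cmult\<close>)
  then show ?case using Suc.prems by (simp add: differentiable_cmult_left_iff)
qed (auto intro: continuous_on_mult_left)

lemma Ck_on_fst:
  fixes f :: "'a::real_normed_vector \<Rightarrow> 'b::real_normed_vector" and T :: "'c::real_normed_vector set"
  shows "open S \<Longrightarrow> open T \<Longrightarrow> Ck_on k S f \<Longrightarrow> Ck_on k (S \<times> T) (\<lambda>p. f (fst p))"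
proof (induction k arbitrary: f)
  case 0
  then show ?case by (auto intro!: continuous_on_compose2[of S f] continuous_intros)
next
  case (Suc k)
  have "Ck_on k (S \<times> T) (\<lambda>p. frechet_derivative (\<lambda>p. f (fst p)) (at p) v)" for v
    by (rule Ck_on_cong[OF open_Times[OF Suc.prems(1,2)] _ Suc.IH[OF Suc.prems(1,2)]])
      (use Suc.prems in \<open>auto simp: frechet_derivative_fst_arg\<close>)
  then show ?case using Suc.prems by (auto intro!: differentiable_fst_arg)
qed

lemma smooth_on_const: "smooth_on S (\<lambda>x. c)"
  unfolding smooth_on_def using Ck_on_const by blast

lemma smooth_on_add: "open S \<Longrightarrow> smooth_on S f \<Longrightarrow> smooth_on S g \<Longrightarrow> smooth_on S (\<lambda>x. f x + g x)"
  unfolding smooth_on_def using Ck_on_add by blast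

lemma smooth_on_cmult:
  fixes f :: "'a::real_normed_vector \<Rightarrow> real"
  shows "open S \<Longrightarrow> smooth_on S f \<Longrightarrow> smooth_on S (\<lambda>x. c * f x)"
  unfolding smooth_on_def using Ck_on_cmult by blast

lemma smooth_on_sum:
  "open S \<Longrightarrow> finite I \<Longrightarrow> (\<And>i. i \<in> I \<Longrightarrow> smooth_on S (f i)) \<Longrightarrow> smooth_on S (\<lambda>x. \<Sum>i\<in>I. f i x)"
  by (induction I rule: infinite_finite_induct) (simp_all add: smooth_on_const smooth_on_add)

lemma smooth_on_fst:
  "open S \<Longrightarrow> open T \<Longrightarrow> smooth_on S f \<Longrightarrow> smooth_on (S \<times> T) (\<lambda>p. f (fst p))"
  unfolding smooth_on_def using Ck_on_fst by blast

lemma smooth_on_differentiable: "smooth_on S f \<Longrightarrow> x \<in> S \<Longrightarrow> f differentiable (at x)"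
  unfolding smooth_on_def using Ck_on.simps(2) by blast


text \<open>The exterior derivative of a form given in a single chart.\<close>

definition ext_deriv :: "('e::real_normed_vector \<Rightarrow> 'e covector) \<Rightarrow> 'e \<Rightarrow> 'e covector" where
  "ext_deriv \<alpha> x = (\<lambda>vs. \<Sum>k<length vs.
     (-1) ^ k * frechet_derivative (\<lambda>y. \<alpha> y (take k vs @ drop (Suc k) vs)) (at x) (vs ! k))"

lemma exterior_derivative_eq: "exterior_derivative \<alpha> i x = ext_deriv (\<alpha> i) x"
  unfolding exterior_derivative_def ext_deriv_def ..

definition differentiable_form :: "('e::real_normed_vector \<Rightarrow> 'e covector) \<Rightarrow> 'e \<Rightarrow> bool" where
  "differentiable_form \<alpha> x \<longleftrightarrow> (\<forall>vs. (\<lambda>y. \<alpha> y vs) differentiable (at x))"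

text \<open>The Lie derivative along the constant vector field \<open>v\<close>.\<close>

definition dir_deriv :: "'e \<Rightarrow> ('e::real_normed_vector \<Rightarrow> 'e covector) \<Rightarrow> 'e \<Rightarrow> 'e covector" where
  "dir_deriv v \<alpha> x = (\<lambda>vs. frechet_derivative (\<lambda>y. \<alpha> y vs) (at x) v)"

lemma differentiable_formD: "differentiable_form \<alpha> x \<Longrightarrow> (\<lambda>y. \<alpha> y vs) differentiable (at x)"
  by (simp add: differentiable_form_def)

lemma ext_deriv_Nil: "ext_deriv \<alpha> x [] = 0"
  by (simp add: ext_deriv_def)

text \<open>Cartan's formula for a constant vector field. It plays the part for \<open>d\<close>
  that \<open>wedge_Cons\<close> plays for the wedge product.\<close>

lemma contract_ext_deriv:
  "contract v (ext_deriv \<alpha> x) = dir_deriv v \<alpha> x - ext_deriv (\<lambda>y. contract v (\<alpha> y)) x"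
  by (rule ext) (simp add: contract_def ext_deriv_def dir_deriv_def sum.lessThan_Suc_shift sum_negf
      del: sum.lessThan_Suc)

lemma ext_deriv_Cons:
  "ext_deriv \<alpha> x (v # vs) = dir_deriv v \<alpha> x vs - ext_deriv (\<lambda>y. contract v (\<alpha> y)) x vs"
  using contract_ext_deriv[of v \<alpha> x] by (auto simp: contract_def fun_eq_iff)

lemma differentiable_form_contract:
  "differentiable_form \<alpha> x \<Longrightarrow> differentiable_form (\<lambda>y. contract v (\<alpha> y)) x"
  by (simp add: differentiable_form_def contract_def)

lemma differentiable_form_scale:
  "differentiable_form \<alpha> x \<Longrightarrow> differentiable_form (\<lambda>y. c \<cdot>\<^sub>c \<alpha> y) x"
  by (simp add: differentiable_form_def cov_scale_def)

lemma differentiable_form_parity: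
  "differentiable_form \<alpha> x \<Longrightarrow> differentiable_form (\<lambda>y. parity (\<alpha> y)) x"
  by (simp add: differentiable_form_def parity_def)

lemma differentiable_form_add:
  "differentiable_form \<alpha> x \<Longrightarrow> differentiable_form \<beta> x \<Longrightarrow> differentiable_form (\<lambda>y. \<alpha> y + \<beta> y) x"
  by (simp add: differentiable_form_def)

lemma differentiable_form_diff:
  "differentiable_form \<alpha> x \<Longrightarrow> differentiable_form \<beta> x \<Longrightarrow> differentiable_form (\<lambda>y. \<alpha> y - \<beta> y) x"
  by (simp add: differentiable_form_def)

lemma differentiable_form_const: "differentiable_form (\<lambda>y. \<beta>) x"
  by (simp add: differentiable_form_def)

lemma differentiable_form_wedge:
  "differentiable_form \<alpha> x \<Longrightarrow> differentiable_form \<beta> x \<Longrightarrow> differentiable_form (\<lambda>y. \<alpha> y \<and>\<^sub>w \<beta> y) x"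
  unfolding differentiable_form_def wedge_def
  by (auto intro!: differentiable_sum differentiable_mult)

lemma ext_deriv_add:
  "differentiable_form \<alpha> x \<Longrightarrow> differentiable_form \<beta> x \<Longrightarrow>
    ext_deriv (\<lambda>y. \<alpha> y + \<beta> y) x = ext_deriv \<alpha> x + ext_deriv \<beta> x"
  by (rule ext) (simp add: ext_deriv_def frechet_derivative_add differentiable_formD sum.distrib algebra_simps)

lemma ext_deriv_diff:
  "differentiable_form \<alpha> x \<Longrightarrow> differentiable_form \<beta> x \<Longrightarrow>
    ext_deriv (\<lambda>y. \<alpha> y - \<beta> y) x = ext_deriv \<alpha> x - ext_deriv \<beta> x"
  by (rule ext) (simp add: ext_deriv_def frechet_derivative_diff differentiable_formD sum_subtractf algebra_simps)

lemma ext_deriv_scale: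
  "differentiable_form \<alpha> x \<Longrightarrow> ext_deriv (\<lambda>y. c \<cdot>\<^sub>c \<alpha> y) x = c \<cdot>\<^sub>c ext_deriv \<alpha> x"
  by (rule ext) (simp add: ext_deriv_def cov_scale_def frechet_derivative_cmult differentiable_formD
      sum_distrib_left mult_ac)

lemma ext_deriv_const: "ext_deriv (\<lambda>y. \<beta>) x = 0"
  by (rule ext) (simp add: ext_deriv_def)

text \<open>The derivative raises the degree by one, so it anticommutes with the grading
  involution.\<close>

lemma ext_deriv_parity:
  assumes "differentiable_form \<alpha> x"
  shows "ext_deriv (\<lambda>y. parity (\<alpha> y)) x = - parity (ext_deriv \<alpha> x)"
proof
  fix vs :: "'a list"
  have "(-1) ^ k * frechet_derivative (\<lambda>y. parity (\<alpha> y) (take k vs @ drop (Suc k) vs)) (at x) (vs ! k)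
    = - ((-1) ^ length vs *
       ((-1) ^ k * frechet_derivative (\<lambda>y. \<alpha> y (take k vs @ drop (Suc k) vs)) (at x) (vs ! k)))"
    if "k < length vs" for k
  proof -
    have "length vs = Suc (length (take k vs @ drop (Suc k) vs))" using that by simp
    then have sign: "(-1) ^ length (take k vs @ drop (Suc k) vs) = - ((-1 :: real) ^ length vs)"
      by (metis power_Suc mult_minus1 minus_minus)
    show ?thesis
      unfolding parity_def frechet_derivative_cmult[OF differentiable_formD[OF assms]] sign by simp
  qed
  then show "ext_deriv (\<lambda>y. parity (\<alpha> y)) x vs = (- parity (ext_deriv \<alpha> x)) vs"
    unfolding ext_deriv_def[of "\<lambda>y. parity (\<alpha> y)"] uminus_apply
    unfolding parity_def[of "ext_deriv \<alpha> x"] unfolding ext_deriv_def[of \<alpha>] sum_distrib_left sum_negf[symmetric]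
    by (intro sum.cong) simp_all
qed

lemma dir_deriv_wedge:
  assumes "differentiable_form \<alpha> x" "differentiable_form \<beta> x"
  shows "dir_deriv v (\<lambda>y. \<alpha> y \<and>\<^sub>w \<beta> y) x = dir_deriv v \<alpha> x \<and>\<^sub>w \<beta> x + \<alpha> x \<and>\<^sub>w dir_deriv v \<beta> x"
proof
  fix vs
  have d: "(\<lambda>y. \<alpha> y us) differentiable (at x)" "(\<lambda>y. \<beta> y us) differentiable (at x)" for us
    using assms differentiable_formD by blast+
  show "dir_deriv v (\<lambda>y. \<alpha> y \<and>\<^sub>w \<beta> y) x vs =
    (dir_deriv v \<alpha> x \<and>\<^sub>w \<beta> x + \<alpha> x \<and>\<^sub>w dir_deriv v \<beta> x) vs"
    unfolding dir_deriv_def wedge_def plus_fun_apply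
    by (subst frechet_derivative_sum)
      (auto simp: d frechet_derivative_mult frechet_derivative_cmult mult.assoc sum.distrib[symmetric]
        algebra_simps intro!: sum.cong)
qed

text \<open>Both sides satisfy the same recursion in the first argument, by Cartan's formula and the
  Leibniz rule for contractions.\<close>

lemma ext_deriv_wedge:
  "differentiable_form \<alpha> x \<Longrightarrow> differentiable_form \<beta> x \<Longrightarrow>
    ext_deriv (\<lambda>y. \<alpha> y \<and>\<^sub>w \<beta> y) x = ext_deriv \<alpha> x \<and>\<^sub>w \<beta> x + parity (\<alpha> x) \<and>\<^sub>w ext_deriv \<beta> x"
proof
  fix vs
  assume "differentiable_form \<alpha> x" "differentiable_form \<beta> x"
  then show "ext_deriv (\<lambda>y. \<alpha> y \<and>\<^sub>w \<beta> y) x vs =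
    (ext_deriv \<alpha> x \<and>\<^sub>w \<beta> x + parity (\<alpha> x) \<and>\<^sub>w ext_deriv \<beta> x) vs"
  proof (induction vs arbitrary: \<alpha> \<beta>)
    case Nil
    then show ?case by (simp add: ext_deriv_Nil wedge_Nil)
  next
    case (Cons v vs)
    note diff = Cons.prems differentiable_form_contract[OF Cons.prems(1), of v]
      differentiable_form_contract[OF Cons.prems(2), of v] differentiable_form_parity[OF Cons.prems(1)]
    show ?case
      by (simp add: ext_deriv_Cons contract_wedge contract_ext_deriv dir_deriv_wedge ext_deriv_add
          differentiable_form_wedge diff Cons.IH wedge_Cons wedge_bilinear parity_linear
          contract_parity parity_parity)
        (simp only: ext_deriv_parity[OF Cons.prems(1)] wedge_bilinear, simp)
  qed
qed

lemma ext_deriv_cong: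
  assumes "open S" "x \<in> S" "\<And>y. y \<in> S \<Longrightarrow> \<alpha> y = \<beta> y" "differentiable_form \<alpha> x"
  shows "ext_deriv \<alpha> x = ext_deriv \<beta> x"
proof -
  have "frechet_derivative (\<lambda>y. \<alpha> y us) (at x) = frechet_derivative (\<lambda>y. \<beta> y us) (at x)" for us
    by (rule frechet_derivative_transform_within_open[OF differentiable_formD[OF assms(4)] assms(1,2)])
      (simp add: assms(3))
  then show ?thesis unfolding ext_deriv_def by simp
qed

lemma differentiable_form_pull:
  "differentiable_form \<alpha> (fst p) \<Longrightarrow> differentiable_form (\<lambda>q. pull_cov (\<alpha> (fst q))) p"
  unfolding differentiable_form_def pull_cov_def by (intro allI differentiable_fst_arg) blast

lemma ext_deriv_pull:
  assumes "differentiable_form \<alpha> (fst p)"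
  shows "ext_deriv (\<lambda>q. pull_cov (\<alpha> (fst q))) p = pull_cov (ext_deriv \<alpha> (fst p))"
  unfolding ext_deriv_def pull_cov_def
  by (rule ext) (simp add: frechet_derivative_fst_arg[OF differentiable_formD[OF assms]]
      take_map drop_map)

section \<open>The product with the circle\<close>

lemma cis_eq_imp:
  assumes "cis s = cis t" obtains n :: int where "s = t + 2 * pi * n"
proof -
  obtain n :: int where "\<i> * complex_of_real s = \<i> * complex_of_real t + of_real (of_int (2 * n) * pi) * \<i>"
    using assms unfolding cis_conv_exp exp_eq by blast
  then have "s = t + 2 * pi * n" by (auto simp: complex_eq_iff)
  then show ?thesis using that by blast
qed

lemma cis_add_multiple_2pi: "cis (t + 2 * pi * of_int n) = cis t"
  by (simp add: cis_mult[symmetric])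

lemma bij_betw_cis: "bij_betw cis {a<..<a + 2 * pi} (sphere 0 1 - {cis a})"
proof -
  have small: "n = 0" if "\<bar>2 * pi * real_of_int n\<bar> < 2 * pi" for n
  proof -
    have "\<bar>real_of_int n\<bar> < 1" using that by (simp add: abs_mult)
    then show ?thesis by linarith
  qed
  have "inj_on cis {a<..<a + 2 * pi}"
  proof (rule inj_onI)
    fix s t assume st: "s \<in> {a<..<a + 2 * pi}" "t \<in> {a<..<a + 2 * pi}" "cis s = cis t"
    obtain n :: int where n: "s = t + 2 * pi * n" using cis_eq_imp[OF st(3)] .
    then have "2 * pi * real_of_int n = s - t" by simp
    then have "\<bar>2 * pi * real_of_int n\<bar> < 2 * pi" using st by auto
    then show "s = t" using n small by simp
  qed
  moreover have "cis ` {a<..<a + 2 * pi} = sphere 0 1 - {cis a}"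
  proof (intro equalityI subsetI)
    fix z assume "z \<in> cis ` {a<..<a + 2 * pi}"
    then obtain s where s: "z = cis s" "a < s" "s < a + 2 * pi" by auto
    have "cis s \<noteq> cis a"
    proof
      assume "cis s = cis a"
      then obtain n :: int where n: "s = a + 2 * pi * n" using cis_eq_imp by blast
      then have "2 * pi * real_of_int n = s - a" by simp
      then have "\<bar>2 * pi * real_of_int n\<bar> < 2 * pi" using s by auto
      then have "n = 0" by (rule small)
      then show False using n s by simp
    qed
    then show "z \<in> sphere 0 1 - {cis a}" using s by simp
  next
    fix z :: complex assume z: "z \<in> sphere 0 1 - {cis a}"
    then have "norm z = 1" "z \<noteq> 0" by auto
    then have "z = cis (Arg z)" by (simp add: cis_Arg sgn_div_norm)
    \<comment> \<open>The number of turns that bring the argument into the fundamental interval starting at \<open>a\<close>.\<close>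
    define n where "n = \<lfloor>(Arg z - a) / (2 * pi)\<rfloor>"
    define s where "s = Arg z + 2 * pi * of_int (- n)"
    have "cis s = z" unfolding s_def cis_add_multiple_2pi using \<open>z = cis (Arg z)\<close> by simp
    have "of_int n \<le> (Arg z - a) / (2 * pi)" "(Arg z - a) / (2 * pi) < of_int n + 1"
      unfolding n_def by linarith+
    then have "a \<le> s" "s < a + 2 * pi" unfolding s_def by (simp_all add: field_simps)
    moreover have "s \<noteq> a" using z \<open>cis s = z\<close> by auto
    ultimately show "z \<in> cis ` {a<..<a + 2 * pi}" using \<open>cis s = z\<close> by force
  qed
  ultimately show ?thesis unfolding bij_betw_def ..
qed

lemma circle_simps:
  "Index circle = UNIV" "Dom circle a = sphere 0 1 - {cis a}"
  "Coord circle a = inv_into {a<..<a + 2 * pi} cis"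
  by (simp_all add: circle_def)

lemma Coord_circle_cis: "s \<in> {a<..<a + 2 * pi} \<Longrightarrow> Coord circle a (cis s) = s"
  unfolding circle_simps using bij_betw_cis[of a] by (simp add: bij_betw_def inv_into_f_f)

lemma bij_betw_Coord_circle: "bij_betw (Coord circle a) (Dom circle a) {a<..<a + 2 * pi}"
  unfolding circle_simps by (rule bij_betw_inv_into[OF bij_betw_cis])

lemma chart_image_circle: "chart_image circle a = {a<..<a + 2 * pi}"
  using bij_betw_Coord_circle unfolding chart_image_def bij_betw_def by blast

lemma chart_inv_circle: "s \<in> {a<..<a + 2 * pi} \<Longrightarrow> chart_inv circle a s = cis s"
  unfolding chart_inv_def
proof (rule inv_into_f_eq)
  assume s: "s \<in> {a<..<a + 2 * pi}"
  show "inj_on (Coord circle a) (Dom circle a)" using bij_betw_Coord_circle bij_betw_def by blast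
  show "cis s \<in> Dom circle a" unfolding circle_simps using s bij_betw_cis bij_betwE by blast
  show "Coord circle a (cis s) = s" using s by (rule Coord_circle_cis)
qed

text \<open>Two branches of the angle differ by a locally constant multiple of \<open>2 *
  pi\<close>. The derivative of the transition is thus the identity, which is why \<open>ds\<close>
  is a global form.\<close>

lemma transition_circle:
  assumes "s \<in> Coord circle a ` (Dom circle a \<inter> Dom circle b)"
  obtains c V where "open V" "s \<in> V" "V \<subseteq> {a<..<a + 2 * pi}" "\<And>t. t \<in> V \<Longrightarrow> transition circle a b t = t + c"
proof -
  obtain z where z: "z \<in> Dom circle a" "z \<in> Dom circle b" "s = Coord circle a z" using assms by auto
  have s: "s \<in> {a<..<a + 2 * pi}"
    using z bij_betw_Coord_circle[of a] by (auto simp: bij_betw_def)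
  have "cis s = z" using z bij_betw_cis[of a]
    unfolding z(3) circle_simps by (simp add: bij_betw_inv_into_right)
  define t where "t = Coord circle b z"
  have t: "t \<in> {b<..<b + 2 * pi}"
    using z bij_betw_Coord_circle[of b] by (auto simp: bij_betw_def t_def)
  have "cis t = z" using z bij_betw_cis[of b]
    unfolding t_def circle_simps by (simp add: bij_betw_inv_into_right)
  then obtain n :: int where n: "t = s + 2 * pi * n" using cis_eq_imp[of t s] \<open>cis s = z\<close> by metis
  define V where "V = {a<..<a + 2 * pi} \<inter> {b - 2 * pi * n<..<b + 2 * pi - 2 * pi * n}"
  have "transition circle a b u = u + 2 * pi * n" if "u \<in> V" for u
  proof -
    have "transition circle a b u = Coord circle b (cis u)"
      using that by (simp add: transition_def chart_inv_circle V_def)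
    also have "\<dots> = Coord circle b (cis (u + 2 * pi * n))" by (simp add: cis_add_multiple_2pi)
    also have "\<dots> = u + 2 * pi * n" using that by (intro Coord_circle_cis) (auto simp: V_def)
    finally show ?thesis .
  qed
  moreover have "open V" "s \<in> V" "V \<subseteq> {a<..<a + 2 * pi}" using s t n by (auto simp: V_def)
  ultimately show ?thesis using that by blast
qed

lemma smooth_manifold_chart:
  assumes "smooth_manifold M" "i \<in> Index M"
  shows "inj_on (Coord M i) (Dom M i)" "open (chart_image M i)"
    and "\<And>j. j \<in> Index M \<Longrightarrow> open (Coord M i ` (Dom M i \<inter> Dom M j))"
proof -
  let ?X = "subtopology (Space M) (Dom M i)"
  have open_i: "openin (Space M) (Dom M i)" and image: "open (chart_image M i)"
    and hom: "homeomorphic_map ?X (top_of_set (chart_image M i)) (Coord M i)"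
    using assms unfolding smooth_manifold_def by auto
  have "topspace ?X = Dom M i" using openin_subset[OF open_i] by auto
  then show "inj_on (Coord M i) (Dom M i)" using homeomorphic_imp_injective_map[OF hom] by simp
  show "open (chart_image M i)" by (rule image)
  show "open (Coord M i ` (Dom M i \<inter> Dom M j))" if "j \<in> Index M" for j
  proof -
    have "openin (Space M) (Dom M j)" using assms that unfolding smooth_manifold_def by auto
    then have "openin ?X (Dom M i \<inter> Dom M j)"
      unfolding openin_subtopology by blast
    then have "openin (top_of_set (chart_image M i)) (Coord M i ` (Dom M i \<inter> Dom M j))"
      using homeomorphic_imp_open_map[OF hom] unfolding open_map_def by blast
    then show ?thesis using image openin_open_trans by blast
  qed
qed

abbreviation circle_product :: "('i, 'p, 'e) manifold \<Rightarrow> ('i \<times> real, 'p \<times> complex, 'e \<times> real) manifold" where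
  "circle_product M \<equiv> product_manifold M circle"

lemma product_manifold_simps:
  "Index (product_manifold M N) = Index M \<times> Index N"
  "Dom (product_manifold M N) (i, j) = Dom M i \<times> Dom N j"
  "Coord (product_manifold M N) (i, j) = map_prod (Coord M i) (Coord N j)"
  by (simp_all add: product_manifold_def)

lemma chart_image_product:
  "chart_image (product_manifold M N) (i, j) = chart_image M i \<times> chart_image N j"
  unfolding chart_image_def product_manifold_simps by (auto simp: map_prod_def image_iff)

lemma chart_inv_product:
  assumes "inj_on (Coord M i) (Dom M i)" "inj_on (Coord N j) (Dom N j)"
    "x \<in> chart_image M i" "y \<in> chart_image N j"
  shows "chart_inv (product_manifold M N) (i, j) (x, y) = (chart_inv M i x, chart_inv N j y)"
  unfolding chart_inv_def product_manifold_simps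
proof (rule inv_into_f_eq)
  show "inj_on (map_prod (Coord M i) (Coord N j)) (Dom M i \<times> Dom N j)"
    using assms(1,2) by (rule map_prod_inj_on)
  show "(inv_into (Dom M i) (Coord M i) x, inv_into (Dom N j) (Coord N j) y) \<in> Dom M i \<times> Dom N j"
    using assms(3,4) unfolding chart_image_def by (auto intro: inv_into_into)
  show "map_prod (Coord M i) (Coord N j) (inv_into (Dom M i) (Coord M i) x, inv_into (Dom N j) (Coord N j) y) = (x, y)"
    using assms(3,4) unfolding chart_image_def by (simp add: f_inv_into_f)
qed

text \<open>Near \<open>p\<close> the transition is the product of the one on \<open>M\<close> with
  a translation.\<close>

lemma circle_product_transition:
  assumes M: "smooth_manifold M" and ij: "i \<in> Index M" "j \<in> Index M"
    and p: "p \<in> Coord (circle_product M) (i, a) ` (Dom (circle_product M) (i, a) \<inter> Dom (circle_product M) (j, b))"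
  shows "fst p \<in> Coord M i ` (Dom M i \<inter> Dom M j)"
    and "fst (transition (circle_product M) (i, a) (j, b) p) = transition M i j (fst p)"
    and "frechet_derivative (transition (circle_product M) (i, a) (j, b)) (at p) =
      (\<lambda>v. (frechet_derivative (transition M i j) (at (fst p)) (fst v), snd v))"
proof -
  obtain x s where xs: "p = (x, s)" by (cases p)
  let ?W = "Coord M i ` (Dom M i \<inter> Dom M j)" and ?T = "transition (circle_product M) (i, a) (j, b)"
  have x: "x \<in> ?W" and s: "s \<in> Coord circle a ` (Dom circle a \<inter> Dom circle b)"
    using p unfolding product_manifold_simps xs by auto
  then show "fst p \<in> ?W" by (simp add: xs)
  obtain c V where V: "open V" "s \<in> V" "V \<subseteq> {a<..<a + 2 * pi}"
    "\<And>t. t \<in> V \<Longrightarrow> transition circle a b t = t + c" by (rule transition_circle[OF s]) blast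
  have injM: "inj_on (Coord M i) (Dom M i)" and openW: "open ?W"
    by (rule smooth_manifold_chart[OF M ij(1)], rule smooth_manifold_chart(3)[OF M ij])
  have T: "?T q = (transition M i j (fst q), snd q + c)" if "q \<in> ?W \<times> V" for q
  proof -
    obtain y t where yt: "q = (y, t)" by (cases q)
    have "y \<in> chart_image M i" "t \<in> chart_image circle a"
      using that V(3) unfolding yt chart_image_circle by (auto simp: chart_image_def)
    then have "chart_inv (circle_product M) (i, a) q = (chart_inv M i y, chart_inv circle a t)"
      unfolding yt using bij_betw_imp_inj_on[OF bij_betw_Coord_circle] by (intro chart_inv_product[OF injM])
    then have "?T q = (transition M i j y, transition circle a b t)"
      unfolding transition_def by (simp add: product_manifold_simps)
    then show ?thesis using V(4) that by (simp add: yt)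
  qed
  have pW: "p \<in> ?W \<times> V" using x V(2) by (simp add: xs)
  then show "fst (?T p) = transition M i j (fst p)" using T by simp
  have "smooth_on ?W (transition M i j)" using M ij unfolding smooth_manifold_def by blast
  then have "transition M i j differentiable (at (fst p))"
    using x unfolding xs fst_conv by (rule smooth_on_differentiable)
  then have "((\<lambda>q. transition M i j (fst q)) has_derivative
      (\<lambda>v. frechet_derivative (transition M i j) (at (fst p)) (fst v))) (at p)"
    by (rule has_derivative_fst_arg)
  moreover have "((\<lambda>q. snd q + c) has_derivative snd) (at p)"
    by (intro has_derivative_add_const has_derivative_snd has_derivative_ident)
  ultimately have "((\<lambda>q. (transition M i j (fst q), snd q + c)) has_derivative
      (\<lambda>v. (frechet_derivative (transition M i j) (at (fst p)) (fst v), snd v))) (at p)"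
    by (rule has_derivative_Pair)
  then have "(?T has_derivative (\<lambda>v. (frechet_derivative (transition M i j) (at (fst p)) (fst v), snd v))) (at p)"
    by (rule has_derivative_transform_within_open[OF _ open_Times[OF openW V(1)] pW]) (simp add: T)
  then show "frechet_derivative ?T (at p) = (\<lambda>v. (frechet_derivative (transition M i j) (at (fst p)) (fst v), snd v))"
    by (rule frechet_derivative_at[symmetric])
qed


section \<open>Forms on the product\<close>

lemma form_apply:
  "(a \<cdot>\<^sub>f \<alpha>) i x = a \<cdot>\<^sub>c \<alpha> i x" "(\<alpha> \<and>\<^sub>f \<beta>) i x = \<alpha> i x \<and>\<^sub>w \<beta> i x"
  by (simp_all add: form_scale_def cov_scale_def form_wedge_def)

lemma pull_apply: "pull \<alpha> j p = pull_cov (\<alpha> (fst j) (fst p))"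
  by (cases j; cases p) (simp add: pull_def pull_cov_def)

lemma ds_apply: "ds j p = ds_cov"
  by (cases j; cases p) (simp add: ds_def ds_cov_def)

lemma differential_form_scale:
  assumes "differential_form M k \<alpha>" "\<And>i. i \<in> Index M \<Longrightarrow> open (chart_image M i)"
  shows "differential_form M k (a \<cdot>\<^sub>f \<alpha>)"
  using assms unfolding differential_form_def form_apply
  by (auto simp: alternating_scale smooth_on_cmult cov_scale_apply)

lemma differential_form_diff:
  assumes "differential_form M k \<alpha>" "differential_form M k \<beta>" "\<And>i. i \<in> Index M \<Longrightarrow> open (chart_image M i)"
  shows "differential_form M k (\<alpha> - \<beta>)"
  unfolding differential_form_def
proof (intro conjI ballI allI)
  fix i vs assume i: "i \<in> Index M"
  have "smooth_on (chart_image M i) (\<lambda>x. \<alpha> i x vs + (-1) * \<beta> i x vs)"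
    using assms i by (intro smooth_on_add smooth_on_cmult) (auto simp: differential_form_def)
  then show "smooth_on (chart_image M i) (\<lambda>x. (\<alpha> - \<beta>) i x vs)" by simp
next
  fix i x assume "i \<in> Index M" "x \<in> chart_image M i"
  then have "alternating k (\<alpha> i x - \<beta> i x)"
    using assms(1,2) unfolding differential_form_def by (blast intro: alternating_diff)
  then show "alternating k ((\<alpha> - \<beta>) i x)" by simp
next
  fix i j x vs assume "i \<in> Index M" "j \<in> Index M" "x \<in> Coord M i ` (Dom M i \<inter> Dom M j)"
  then have "\<gamma> i x vs = \<gamma> j (transition M i j x) (map (frechet_derivative (transition M i j) (at x)) vs)"
    if "\<gamma> = \<alpha> \<or> \<gamma> = \<beta>" for \<gamma> using that assms(1,2) unfolding differential_form_def by blast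
  then show "(\<alpha> - \<beta>) i x vs =
      (\<alpha> - \<beta>) j (transition M i j x) (map (frechet_derivative (transition M i j) (at x)) vs)"
    unfolding minus_apply by metis
qed

lemma circle_product_index: "j \<in> Index (circle_product M) \<longleftrightarrow> fst j \<in> Index M"
  by (cases j) (simp add: product_manifold_simps circle_simps)

lemma circle_product_chart_image:
  "chart_image (circle_product M) j = chart_image M (fst j) \<times> {snd j<..<snd j + 2 * pi}"
  by (cases j) (simp add: chart_image_product chart_image_circle)

lemma open_circle_product_chart_image:
  "smooth_manifold M \<Longrightarrow> j \<in> Index (circle_product M) \<Longrightarrow> open (chart_image (circle_product M) j)"
  unfolding circle_product_chart_image circle_product_index
  by (intro open_Times smooth_manifold_chart(2)) auto

lemma pull_transforms:
  assumes M: "smooth_manifold M" and \<alpha>: "differential_form M k \<alpha>"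
    and ij: "i \<in> Index (circle_product M)" "j \<in> Index (circle_product M)"
    and p: "p \<in> Coord (circle_product M) i ` (Dom (circle_product M) i \<inter> Dom (circle_product M) j)"
  shows "pull \<alpha> i p = (\<lambda>vs. pull \<alpha> j (transition (circle_product M) i j p)
      (map (frechet_derivative (transition (circle_product M) i j) (at p)) vs))"
    and "ds i p = (\<lambda>vs. ds j (transition (circle_product M) i j p)
      (map (frechet_derivative (transition (circle_product M) i j) (at p)) vs))"
proof -
  obtain i' a where i: "i = (i', a)" by (cases i)
  obtain j' b where j: "j = (j', b)" by (cases j)
  note tr = circle_product_transition[OF M _ _ p[unfolded i j]]
  have ij': "i' \<in> Index M" "j' \<in> Index M" using ij unfolding circle_product_index i j by auto
  have "\<alpha> i' (fst p) (map fst vs) = \<alpha> j' (transition M i' j' (fst p))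
      (map (frechet_derivative (transition M i' j') (at (fst p))) (map fst vs))" for vs
    using \<alpha> ij' tr(1)[OF ij'] unfolding differential_form_def by blast
  then show "pull \<alpha> i p = (\<lambda>vs. pull \<alpha> j (transition (circle_product M) i j p)
      (map (frechet_derivative (transition (circle_product M) i j) (at p)) vs))"
    unfolding pull_apply pull_cov_def i j tr(2,3)[OF ij'] by (intro ext) (simp add: o_def)
  show "ds i p = (\<lambda>vs. ds j (transition (circle_product M) i j p)
      (map (frechet_derivative (transition (circle_product M) i j) (at p)) vs))"
    unfolding ds_apply i j tr(2,3)[OF ij'] by (rule ext) (auto simp: ds_cov_def length_Suc_conv)
qed

lemma smooth_on_pull_component:
  assumes M: "smooth_manifold M" and \<alpha>: "differential_form M k \<alpha>" and i: "i \<in> Index (circle_product M)"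
  shows "smooth_on (chart_image (circle_product M) i) (\<lambda>p. pull_cov (\<alpha> (fst i) (fst p)) vs)"
proof -
  have i': "fst i \<in> Index M" using i unfolding circle_product_index .
  then have "smooth_on (chart_image M (fst i)) (\<lambda>x. \<alpha> (fst i) x (map fst vs))"
    using \<alpha> unfolding differential_form_def by blast
  then show ?thesis
    unfolding circle_product_chart_image pull_cov_def
    using smooth_on_fst[OF smooth_manifold_chart(2)[OF M i'] open_greaterThanLessThan] by blast
qed

lemma differential_form_pull:
  assumes M: "smooth_manifold M" and \<alpha>: "differential_form M k \<alpha>"
  shows "differential_form (circle_product M) k (pull \<alpha>)"
  unfolding differential_form_def
proof (intro conjI ballI allI)
  fix i p assume "i \<in> Index (circle_product M)" "p \<in> chart_image (circle_product M) i"
  then have "alternating k (\<alpha> (fst i) (fst p))"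
    using \<alpha> unfolding differential_form_def circle_product_index circle_product_chart_image by auto
  then show "alternating k (pull \<alpha> i p)" unfolding pull_apply by (rule alternating_pull_cov)
next
  fix i vs assume "i \<in> Index (circle_product M)"
  then show "smooth_on (chart_image (circle_product M) i) (\<lambda>p. pull \<alpha> i p vs)"
    unfolding pull_apply by (rule smooth_on_pull_component[OF assms])
next
  fix i j p vs
  assume "i \<in> Index (circle_product M)" "j \<in> Index (circle_product M)"
    "p \<in> Coord (circle_product M) i ` (Dom (circle_product M) i \<inter> Dom (circle_product M) j)"
  then show "pull \<alpha> i p vs = pull \<alpha> j (transition (circle_product M) i j p)
      (map (frechet_derivative (transition (circle_product M) i j) (at p)) vs)"
    using pull_transforms(1)[OF assms] by metis
qed

lemma differential_form_pull_wedge_ds: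
  assumes M: "smooth_manifold M" and \<alpha>: "differential_form M k \<alpha>"
  shows "differential_form (circle_product M) (k + 1) (pull \<alpha> \<and>\<^sub>f ds)"
  unfolding differential_form_def
proof (intro conjI ballI allI)
  fix i p assume "i \<in> Index (circle_product M)" "p \<in> chart_image (circle_product M) i"
  then have "alternating k (\<alpha> (fst i) (fst p))"
    using \<alpha> unfolding differential_form_def circle_product_index circle_product_chart_image by auto
  then show "alternating (k + 1) ((pull \<alpha> \<and>\<^sub>f ds) i p)"
    unfolding form_apply pull_apply ds_apply
    by (intro alternating_wedge alternating_pull_cov alternating_ds_cov)
next
  fix i vs assume i: "i \<in> Index (circle_product M)"
  have "smooth_on (chart_image (circle_product M) i) (\<lambda>p. \<Sum>I\<in>Pow {..<length vs}.
      (shuffle_sign (length vs) I * ds_cov (nths vs (- I))) * pull_cov (\<alpha> (fst i) (fst p)) (nths vs I))"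
    by (intro smooth_on_sum smooth_on_cmult smooth_on_pull_component[OF assms i]
        open_circle_product_chart_image[OF M i]) simp
  then show "smooth_on (chart_image (circle_product M) i) (\<lambda>p. (pull \<alpha> \<and>\<^sub>f ds) i p vs)"
    unfolding form_apply pull_apply ds_apply wedge_def by (simp add: mult_ac)
next
  fix i j p vs
  assume "i \<in> Index (circle_product M)" "j \<in> Index (circle_product M)"
    "p \<in> Coord (circle_product M) i ` (Dom (circle_product M) i \<inter> Dom (circle_product M) j)"
  then show "(pull \<alpha> \<and>\<^sub>f ds) i p vs = (pull \<alpha> \<and>\<^sub>f ds) j (transition (circle_product M) i j p)
      (map (frechet_derivative (transition (circle_product M) i j) (at p)) vs)"
    unfolding form_apply(2) wedge_map using pull_transforms[OF assms] by metis
qed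

section \<open>Warped structures with a constant warping function\<close>

lemma su3_structure_adapted:
  assumes "su3_structure M \<omega> \<psi>p \<psi>m" "i \<in> Index M" "x \<in> chart_image M i"
  obtains e where "su3_adapted e (\<omega> i x) (\<psi>p i x) (\<psi>m i x)"
  using assms unfolding su3_structure_def by blast

lemma su3_structure_frame:
  assumes "su3_structure M \<omega> \<psi>p \<psi>m" "i \<in> Index M" "x \<in> chart_image M i"
  obtains N e where "open N" "x \<in> N" "N \<subseteq> chart_image M i"
    and "\<And>k vs. k \<in> {1..6} \<Longrightarrow> smooth_on N (\<lambda>y. e k y vs)"
    and "\<And>y. y \<in> N \<Longrightarrow> su3_adapted (\<lambda>k. e k y) (\<omega> i y) (\<psi>p i y) (\<psi>m i y)"
proof -
  have "\<exists>N e. open N \<and> x \<in> N \<and> N \<subseteq> chart_image M i \<and>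
        (\<forall>k\<in>{1..6}. \<forall>vs. smooth_on N (\<lambda>y. e k y vs)) \<and>
        (\<forall>y\<in>N. su3_adapted (\<lambda>k. e k y) (\<omega> i y) (\<psi>p i y) (\<psi>m i y))"
    using assms(1)[unfolded su3_structure_def, THEN conjunct2, THEN conjunct2, THEN conjunct2,
        rule_format, OF assms(2,3)] by simp
  then obtain N where "\<exists>e. open N \<and> x \<in> N \<and> N \<subseteq> chart_image M i \<and>
        (\<forall>k\<in>{1..6}. \<forall>vs. smooth_on N (\<lambda>y. e k y vs)) \<and>
        (\<forall>y\<in>N. su3_adapted (\<lambda>k. e k y) (\<omega> i y) (\<psi>p i y) (\<psi>m i y))" ..
  then obtain e where e: "open N \<and> x \<in> N \<and> N \<subseteq> chart_image M i \<and>
        (\<forall>k\<in>{1..6}. \<forall>vs. smooth_on N (\<lambda>y. e k y vs)) \<and>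
        (\<forall>y\<in>N. su3_adapted (\<lambda>k. e k y) (\<omega> i y) (\<psi>p i y) (\<psi>m i y))" ..
  show ?thesis by (rule that[of N e]) (use e in simp_all)
qed

lemma su3_structure_scale:
  assumes M: "smooth_manifold M" and su3: "su3_structure M \<omega> \<psi>p \<psi>m" and "r \<noteq> 0"
  shows "su3_structure M (r\<^sup>2 \<cdot>\<^sub>f \<omega>) (r ^ 3 \<cdot>\<^sub>f \<psi>p) (r ^ 3 \<cdot>\<^sub>f \<psi>m)"
  unfolding su3_structure_def
proof (intro conjI ballI)
  show "differential_form M 2 (r\<^sup>2 \<cdot>\<^sub>f \<omega>)" "differential_form M 3 (r ^ 3 \<cdot>\<^sub>f \<psi>p)"
    "differential_form M 3 (r ^ 3 \<cdot>\<^sub>f \<psi>m)"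
    using su3 smooth_manifold_chart(2)[OF M] unfolding su3_structure_def
    by (blast intro: differential_form_scale)+
  fix i x assume "i \<in> Index M" "x \<in> chart_image M i"
  then obtain N e where N: "open N" "x \<in> N" "N \<subseteq> chart_image M i"
    and e: "\<And>k vs. k \<in> {1..6} \<Longrightarrow> smooth_on N (\<lambda>y. e k y vs)"
    and ad: "\<And>y. y \<in> N \<Longrightarrow> su3_adapted (\<lambda>k. e k y) (\<omega> i y) (\<psi>p i y) (\<psi>m i y)"
    by (rule su3_structure_frame[OF su3]) blast
  have "\<forall>k\<in>{1..6}. \<forall>vs. smooth_on N (\<lambda>y. (r \<cdot>\<^sub>c e k y) vs)"
    unfolding cov_scale_apply by (intro ballI allI smooth_on_cmult[OF N(1) e])
  moreover have "\<forall>y\<in>N. su3_adapted (\<lambda>k. r \<cdot>\<^sub>c e k y) ((r\<^sup>2 \<cdot>\<^sub>f \<omega>) i y) ((r ^ 3 \<cdot>\<^sub>f \<psi>p) i y) ((r ^ 3 \<cdot>\<^sub>f \<psi>m) i y)"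
    unfolding form_apply by (intro ballI su3_adapted_scale[OF ad assms(3)])
  ultimately show "\<exists>N e. open N \<and> x \<in> N \<and> N \<subseteq> chart_image M i \<and>
        (\<forall>k\<in>{1..6}. \<forall>vs. smooth_on N (\<lambda>y. e k y vs)) \<and>
        (\<forall>y\<in>N. su3_adapted (\<lambda>k. e k y) ((r\<^sup>2 \<cdot>\<^sub>f \<omega>) i y) ((r ^ 3 \<cdot>\<^sub>f \<psi>p) i y) ((r ^ 3 \<cdot>\<^sub>f \<psi>m) i y))"
    using N by - (rule exI[of _ N], rule exI[of _ "\<lambda>k y. r \<cdot>\<^sub>c e k y"], intro conjI)
qed

lemma smooth_on_warp_frame:
  assumes N: "open N" and "open V" and e: "\<And>k vs. k \<in> {1..6} \<Longrightarrow> smooth_on N (\<lambda>y. e k y vs)"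
    and k: "k \<in> {1..7}"
  shows "smooth_on (N \<times> V) (\<lambda>q. warp f (phase_rotate (\<lambda>k. e k (fst q))) k vs)"
proof -
  have pull: "smooth_on (N \<times> V) (\<lambda>q. e k (fst q) us)" if "k \<in> {1..6}" for k us
    using smooth_on_fst[OF N \<open>open V\<close> e[OF that]] .
  consider "k = 7" | "k = 1" | "k = 2" | "k \<in> {3..6}" using k by fastforce
  then show ?thesis
  proof cases
    case 1 then show ?thesis by (simp add: warp_def smooth_on_const)
  next
    case 2
    have "smooth_on (N \<times> V) (\<lambda>q. (-1) * e 2 (fst q) (map fst vs))"
      by (intro smooth_on_cmult open_Times N \<open>open V\<close> pull) simp
    then show ?thesis using 2 by (simp add: warp_def phase_rotate_def pull_cov_def)
  next
    case 3
    then show ?thesis using pull[of 1 "map fst vs"] by (simp add: warp_def phase_rotate_def pull_cov_def)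
  next
    case 4
    then show ?thesis using pull[of k "map fst vs"] by (simp add: warp_def phase_rotate_def pull_cov_def)
  qed
qed

text \<open>A coframe adapted to the SU(3)-structure near a point of \<open>M\<close> gives, after
  rotation of its phase and with \<open>f ds\<close> added, a coframe adapted to
  \<open>\<phi>\<close> over the same neighbourhood times an interval; metric and volume are read
  off from it.\<close>

lemma warped_g2_structure_const:
  fixes \<omega> \<psi>p \<psi>m :: "('i, 'e::euclidean_space) form"
  assumes M: "smooth_manifold M" and su3: "su3_structure M \<omega> \<psi>p \<psi>m" and f: "f \<noteq> 0"
    and \<phi>: "\<phi> = f \<cdot>\<^sub>f (pull \<omega> \<and>\<^sub>f ds) - pull \<psi>m"
  shows "warped_g2_structure M (\<lambda>p. f) \<omega> \<psi>p \<psi>m \<phi>"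
proof -
  let ?P = "circle_product M"
  have \<phi>_at: "\<phi> j p = f \<cdot>\<^sub>c (pull_cov (\<omega> (fst j) (fst p)) \<and>\<^sub>w ds_cov) - pull_cov (\<psi>m (fst j) (fst p))" for j p
    unfolding \<phi> by (simp add: form_apply pull_apply ds_apply)
  have forms: "differential_form M 2 \<omega>" "differential_form M 3 \<psi>m"
    using su3 unfolding su3_structure_def by auto
  have g2: "g2_structure ?P \<phi>" unfolding g2_structure_def
  proof (intro conjI ballI)
    have "differential_form ?P 3 (pull \<omega> \<and>\<^sub>f ds)"
      using differential_form_pull_wedge_ds[OF M forms(1)] by simp
    then show "differential_form ?P 3 \<phi>" unfolding \<phi>
      by (intro differential_form_diff differential_form_scale differential_form_pull[OF M forms(2)]
          open_circle_product_chart_image[OF M])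
    fix j p assume j: "j \<in> Index ?P" and p: "p \<in> chart_image ?P j"
    define V where "V = {snd j<..<snd j + 2 * pi}"
    have x: "fst j \<in> Index M" "fst p \<in> chart_image M (fst j)" "snd p \<in> V"
      using j p unfolding circle_product_index circle_product_chart_image V_def by auto
    obtain N e where N: "open N" "fst p \<in> N" "N \<subseteq> chart_image M (fst j)"
      and e: "\<And>k vs. k \<in> {1..6} \<Longrightarrow> smooth_on N (\<lambda>y. e k y vs)"
      and ad: "\<And>y. y \<in> N \<Longrightarrow> su3_adapted (\<lambda>k. e k y) (\<omega> (fst j) y) (\<psi>p (fst j) y) (\<psi>m (fst j) y)"
      by (rule su3_structure_frame[OF su3 x(1,2)]) blast
    let ?E = "\<lambda>k q. warp f (phase_rotate (\<lambda>k. e k (fst q))) k"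
    have V: "open V" by (simp add: V_def)
    have "open (N \<times> V)" "p \<in> N \<times> V" "N \<times> V \<subseteq> chart_image ?P j"
      using N V x unfolding circle_product_chart_image V_def by (auto simp: open_Times mem_Times_iff)
    moreover have "\<forall>k\<in>{1..7}. \<forall>vs. smooth_on (N \<times> V) (\<lambda>q. ?E k q vs)"
      by (intro ballI allI smooth_on_warp_frame[OF N(1) V e])
    moreover have "\<forall>q\<in>N \<times> V. g2_adapted (\<lambda>k. ?E k q) (\<phi> j q)"
      using g2_adapted_warped[OF ad f \<phi>_at] by auto
    ultimately show "\<exists>N e. open N \<and> p \<in> N \<and> N \<subseteq> chart_image ?P j \<and>
        (\<forall>k\<in>{1..7}. \<forall>vs. smooth_on N (\<lambda>y. e k y vs)) \<and> (\<forall>y\<in>N. g2_adapted (\<lambda>k. e k y) (\<phi> j y))"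
      by - (rule exI[of _ "N \<times> V"], rule exI[of _ ?E], intro conjI)
  qed
  have form: "form_eq ?P \<phi> (warped_3form M (\<lambda>p. f) \<omega> \<psi>m)"
    unfolding form_eq_def warped_3form_def form_mult_def \<phi> form_scale_def o_def by simp
  have metric: "g2_metric (\<phi> (i, a) (x, s)) = (\<lambda>(u, h) (v, k).
          su3_metric (\<omega> i x) (\<psi>p i x) (\<psi>m i x) u v + f\<^sup>2 * h * k)"
    if i: "i \<in> Index M" and xs: "(x, s) \<in> chart_image ?P (i, a)" for i a x s
  proof -
    have "x \<in> chart_image M i" using xs unfolding circle_product_chart_image by simp
    then obtain e where "su3_adapted e (\<omega> i x) (\<psi>p i x) (\<psi>m i x)"
      using su3_structure_adapted[OF su3 i] by blast
    from g2_metric_warped[OF this f \<phi>_at[of "(i, a)" "(x, s)", unfolded fst_conv]]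
    show ?thesis by (auto simp: fun_eq_iff)
  qed
  have volume: "form_eq ?P (\<lambda>j y. g2_volume (\<phi> j y)) (form_mult ?P ((\<lambda>p. f) \<circ> fst) (pull (vol6 \<omega>) \<and>\<^sub>f ds))"
    unfolding form_eq_def
  proof (intro ballI)
    fix j p assume "j \<in> Index ?P" "p \<in> chart_image ?P j"
    then have "fst j \<in> Index M" "fst p \<in> chart_image M (fst j)"
      unfolding circle_product_index circle_product_chart_image by auto
    then obtain e where "su3_adapted e (\<omega> (fst j) (fst p)) (\<psi>p (fst j) (fst p)) (\<psi>m (fst j) (fst p))"
      using su3_structure_adapted[OF su3] by blast
    from g2_volume_warped[OF this f \<phi>_at]
    show "g2_volume (\<phi> j p) = form_mult ?P ((\<lambda>p. f) \<circ> fst) (pull (vol6 \<omega>) \<and>\<^sub>f ds) j p"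
      unfolding form_mult_def form_apply pull_apply ds_apply vol6_def o_def
      by (simp add: cov_scale_def)
  qed
  show ?thesis unfolding warped_g2_structure_def
    using su3 f g2 form metric volume by (auto simp: o_def smooth_on_const)
qed

section \<open>The Laplacian along the coflow\<close>

lemma differential_form_differentiable:
  assumes "differential_form M k \<alpha>" "i \<in> Index M" "x \<in> chart_image M i"
  shows "differentiable_form (\<alpha> i) x"
  using assms smooth_on_differentiable unfolding differential_form_def differentiable_form_def by blast

lemma cov_scale_cancel: "a \<cdot>\<^sub>c \<alpha> = b \<cdot>\<^sub>c \<beta> \<Longrightarrow> a \<noteq> 0 \<Longrightarrow> \<alpha> = (b / a) \<cdot>\<^sub>c \<beta>"
  by (auto simp: cov_scale_def fun_eq_iff field_simps)

text \<open>The number \<open>r\<close> is the factor by which the adapted coframes of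
  \<open>M\<close> have been stretched at a given time, so \<open>r\<^sup>2\<close> is the value of
  \<open>h\<close>.\<close>

definition coflow_form :: "real \<Rightarrow> real \<Rightarrow> ('i, 'e) form \<Rightarrow> ('i, 'e) form \<Rightarrow> ('i \<times> real, 'e \<times> real) form" where
  "coflow_form c r \<omega> \<psi>m = r ^ 3 \<cdot>\<^sub>f (c \<cdot>\<^sub>f (pull \<omega> \<and>\<^sub>f ds) - pull \<psi>m)"

lemma coflow_form_at:
  "coflow_form c r \<omega> \<psi>m j q =
     r ^ 3 \<cdot>\<^sub>c (c \<cdot>\<^sub>c (pull_cov (\<omega> (fst j) (fst q)) \<and>\<^sub>w ds_cov) - pull_cov (\<psi>m (fst j) (fst q)))"
  unfolding coflow_form_def by (simp add: form_apply pull_apply ds_apply)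

text \<open>Only \<open>c * r * r\<^sup>2 = c * r ^ 3\<close> has to be checked: this fixes the
  warping function as \<open>c * r\<close>.\<close>

lemma coflow_form_warped:
  "coflow_form c r \<omega> \<psi>m = (c * r) \<cdot>\<^sub>f (pull (r\<^sup>2 \<cdot>\<^sub>f \<omega>) \<and>\<^sub>f ds) - pull (r ^ 3 \<cdot>\<^sub>f \<psi>m)"
proof (intro ext)
  fix j q vs
  show "coflow_form c r \<omega> \<psi>m j q vs =
    ((c * r) \<cdot>\<^sub>f (pull (r\<^sup>2 \<cdot>\<^sub>f \<omega>) \<and>\<^sub>f ds) - pull (r ^ 3 \<cdot>\<^sub>f \<psi>m)) j q vs"
    unfolding coflow_form_at minus_apply form_apply pull_apply ds_apply pull_cov_linear wedge_bilinear
    by (simp add: cov_scale_apply algebra_simps power2_eq_square power3_eq_cube)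
qed

context
  fixes M :: "('i, 'p, 'e::euclidean_space) manifold" and \<omega> \<psi>p \<psi>m :: "('i, 'e) form"
    and \<sigma>0 c r :: real
  assumes M: "smooth_manifold M" and nk: "nearly_Kaehler M \<sigma>0 \<omega> \<psi>p \<psi>m" and c: "c \<noteq> 0" and r: "r \<noteq> 0"
begin

abbreviation (input) "omega_at j q \<equiv> pull_cov (\<omega> (fst j) (fst q))"
abbreviation (input) "psi_plus_at j q \<equiv> pull_cov (\<psi>p (fst j) (fst q))"
abbreviation (input) "psi_minus_at j q \<equiv> pull_cov (\<psi>m (fst j) (fst q))"
abbreviation (input) "flow_form \<equiv> coflow_form c r \<omega> \<psi>m"
abbreviation (input) "flow_star j q \<equiv> hodge_star (g2_metric (flow_form j q)) (g2_volume (flow_form j q))"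

lemma nearly_Kaehler_su3: "su3_structure M \<omega> \<psi>p \<psi>m"
  using nk unfolding nearly_Kaehler_def by blast

lemma nearly_Kaehler_forms:
  "differential_form M 2 \<omega>" "differential_form M 3 \<psi>p" "differential_form M 3 \<psi>m"
  using nearly_Kaehler_su3 unfolding su3_structure_def by auto

context
  fixes j
  assumes j: "j \<in> Index (circle_product M)"
begin

abbreviation (input) "chart \<equiv> chart_image (circle_product M) j"

lemma chart_point: "q \<in> chart \<Longrightarrow> fst j \<in> Index M \<and> fst q \<in> chart_image M (fst j)"
  using j unfolding circle_product_index circle_product_chart_image by auto

lemma open_chart: "open chart"
  by (rule open_circle_product_chart_image[OF M j])

text \<open>The formulas for the rescaled SU(3)-structure and the warping function \<open>c *
  r\<close>, expressed in the original forms. The powers of \<open>r\<close> come from the warping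
  function and from the number of covectors of \<open>M\<close> before and after taking the
  star.\<close>

lemma coflow_stars:
  assumes q: "q \<in> chart"
  shows "flow_star j q 3 (flow_form j q) = r ^ 4 \<cdot>\<^sub>c ((1/2) \<cdot>\<^sub>c (omega_at j q \<and>\<^sub>w omega_at j q) + c \<cdot>\<^sub>c (psi_plus_at j q \<and>\<^sub>w ds_cov))"
    and "flow_star j q 4 (omega_at j q \<and>\<^sub>w omega_at j q) = (2 * c / r) \<cdot>\<^sub>c (omega_at j q \<and>\<^sub>w ds_cov)"
    and "flow_star j q 4 (psi_plus_at j q \<and>\<^sub>w ds_cov) = - (1 / (c * r)) \<cdot>\<^sub>c psi_minus_at j q"
proof -
  obtain e where e: "su3_adapted e (\<omega> (fst j) (fst q)) (\<psi>p (fst j) (fst q)) (\<psi>m (fst j) (fst q))"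
    using su3_structure_adapted[OF nearly_Kaehler_su3] chart_point[OF q] by blast
  have cr: "c * r \<noteq> 0" using c r by simp
  have form: "flow_form j q = (c * r) \<cdot>\<^sub>c (pull_cov (r\<^sup>2 \<cdot>\<^sub>c \<omega> (fst j) (fst q)) \<and>\<^sub>w ds_cov)
     - pull_cov (r ^ 3 \<cdot>\<^sub>c \<psi>m (fst j) (fst q))"
    unfolding coflow_form_warped by (simp add: form_apply pull_apply ds_apply)
  note stars = hodge_star_warped_3_form[OF su3_adapted_scale[OF e r] cr form]
    hodge_star_warped_omega_square[OF su3_adapted_scale[OF e r] cr form]
    hodge_star_warped_psi_ds[OF su3_adapted_scale[OF e r] cr form]
  show "flow_star j q 3 (flow_form j q) = r ^ 4 \<cdot>\<^sub>c ((1/2) \<cdot>\<^sub>c (omega_at j q \<and>\<^sub>w omega_at j q) + c \<cdot>\<^sub>c (psi_plus_at j q \<and>\<^sub>w ds_cov))"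
    unfolding stars(1) pull_cov_linear wedge_bilinear
    by (rule ext) (simp add: cov_scale_apply algebra_simps power2_eq_square power3_eq_cube power4_eq_xxxx)
  have "r ^ 4 \<cdot>\<^sub>c flow_star j q 4 (omega_at j q \<and>\<^sub>w omega_at j q) = (2 * (c * r) * r\<^sup>2) \<cdot>\<^sub>c (omega_at j q \<and>\<^sub>w ds_cov)"
    using stars(2) unfolding pull_cov_linear wedge_bilinear hodge_star_linear(4) cov_scale_simps
    by (simp add: power2_eq_square power4_eq_xxxx mult.assoc)
  from cov_scale_cancel[OF this]
  show "flow_star j q 4 (omega_at j q \<and>\<^sub>w omega_at j q) = (2 * c / r) \<cdot>\<^sub>c (omega_at j q \<and>\<^sub>w ds_cov)"
    using r by (simp add: power2_eq_square power4_eq_xxxx)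
  have "r ^ 3 \<cdot>\<^sub>c flow_star j q 4 (psi_plus_at j q \<and>\<^sub>w ds_cov) = (- (1 / (c * r)) * r ^ 3) \<cdot>\<^sub>c psi_minus_at j q"
    using stars(3) unfolding pull_cov_linear wedge_bilinear hodge_star_linear(4) cov_scale_simps .
  from cov_scale_cancel[OF this]
  show "flow_star j q 4 (psi_plus_at j q \<and>\<^sub>w ds_cov) = - (1 / (c * r)) \<cdot>\<^sub>c psi_minus_at j q"
    using r by simp
qed

lemma pulled_derivatives:
  assumes q: "q \<in> chart"
  shows "ext_deriv (omega_at j) q = (- (3/2) * \<sigma>0) \<cdot>\<^sub>c psi_plus_at j q" "ext_deriv (psi_plus_at j) q = 0"
    "ext_deriv (psi_minus_at j) q = \<sigma>0 \<cdot>\<^sub>c (omega_at j q \<and>\<^sub>w omega_at j q)"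
    and "differentiable_form (omega_at j) q" "differentiable_form (psi_plus_at j) q" "differentiable_form (psi_minus_at j) q"
proof -
  have x: "fst j \<in> Index M" "fst q \<in> chart_image M (fst j)" using chart_point[OF q] by auto
  note d = differential_form_differentiable[OF _ x]
  note diff = d[OF nearly_Kaehler_forms(1)] d[OF nearly_Kaehler_forms(2)] d[OF nearly_Kaehler_forms(3)]
  have "exterior_derivative \<omega> (fst j) (fst q) = ((- (3 / 2) * \<sigma>0) \<cdot>\<^sub>f \<psi>p) (fst j) (fst q)"
    "exterior_derivative \<psi>p (fst j) (fst q) = 0 (fst j) (fst q)"
    "exterior_derivative \<psi>m (fst j) (fst q) = (\<sigma>0 \<cdot>\<^sub>f (\<omega> \<and>\<^sub>f \<omega>)) (fst j) (fst q)"
    using nk x unfolding nearly_Kaehler_def form_eq_def by blast+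
  then have nk_at: "ext_deriv (\<omega> (fst j)) (fst q) = (- (3 / 2) * \<sigma>0) \<cdot>\<^sub>c \<psi>p (fst j) (fst q)"
    "ext_deriv (\<psi>p (fst j)) (fst q) = 0"
    "ext_deriv (\<psi>m (fst j)) (fst q) = \<sigma>0 \<cdot>\<^sub>c (\<omega> (fst j) (fst q) \<and>\<^sub>w \<omega> (fst j) (fst q))"
    unfolding exterior_derivative_eq form_apply zero_fun_apply .
  show "ext_deriv (omega_at j) q = (- (3/2) * \<sigma>0) \<cdot>\<^sub>c psi_plus_at j q"
    unfolding ext_deriv_pull[OF diff(1)] nk_at pull_cov_linear ..
  show "ext_deriv (psi_plus_at j) q = 0"
    unfolding ext_deriv_pull[OF diff(2)] nk_at pull_cov_linear ..
  show "ext_deriv (psi_minus_at j) q = \<sigma>0 \<cdot>\<^sub>c (omega_at j q \<and>\<^sub>w omega_at j q)"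
    unfolding ext_deriv_pull[OF diff(3)] nk_at pull_cov_linear pull_cov_wedge ..
  show "differentiable_form (omega_at j) q" "differentiable_form (psi_plus_at j) q" "differentiable_form (psi_minus_at j) q"
    by (rule differentiable_form_pull, rule diff)+
qed

text \<open>The square of \<open>\<omega>\<close> is closed because \<open>d\<omega>\<close> is a
  multiple of \<open>\<psi>p\<close>, whose products with \<open>\<omega>\<close> vanish.\<close>

lemma pulled_wedge_derivatives:
  assumes q: "q \<in> chart"
  shows "ext_deriv (\<lambda>q. omega_at j q \<and>\<^sub>w ds_cov) q = (- (3/2) * \<sigma>0) \<cdot>\<^sub>c (psi_plus_at j q \<and>\<^sub>w ds_cov)"
    and "ext_deriv (\<lambda>q. psi_plus_at j q \<and>\<^sub>w ds_cov) q = 0"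
    and "ext_deriv (\<lambda>q. omega_at j q \<and>\<^sub>w omega_at j q) q = 0"
proof -
  note d = pulled_derivatives[OF q]
  show "ext_deriv (\<lambda>q. omega_at j q \<and>\<^sub>w ds_cov) q = (- (3/2) * \<sigma>0) \<cdot>\<^sub>c (psi_plus_at j q \<and>\<^sub>w ds_cov)"
    "ext_deriv (\<lambda>q. psi_plus_at j q \<and>\<^sub>w ds_cov) q = 0"
    unfolding ext_deriv_wedge[OF d(4) differentiable_form_const]
      ext_deriv_wedge[OF d(5) differentiable_form_const] ext_deriv_const d(1,2) wedge_bilinear
    by simp_all
  obtain e where e: "su3_adapted e (\<omega> (fst j) (fst q)) (\<psi>p (fst j) (fst q)) (\<psi>m (fst j) (fst q))"
    using su3_structure_adapted[OF nearly_Kaehler_su3] chart_point[OF q] by blast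
  have zero: "omega_at j q \<and>\<^sub>w psi_plus_at j q = 0" "psi_plus_at j q \<and>\<^sub>w omega_at j q = 0"
    unfolding pull_cov_wedge[symmetric] su3_omega_psi[OF e] pull_cov_linear by simp_all
  have "alternating 2 (\<omega> (fst j) (fst q))"
    using nearly_Kaehler_forms(1) chart_point[OF q] unfolding differential_form_def by blast
  then have "parity (omega_at j q) = omega_at j q"
    by (intro ext, rename_tac vs, case_tac "length vs = 2")
      (simp_all add: parity_def pull_cov_def alternating_length)
  then show "ext_deriv (\<lambda>q. omega_at j q \<and>\<^sub>w omega_at j q) q = 0"
    unfolding ext_deriv_wedge[OF d(4,4)] d(1) wedge_bilinear zero by (simp add: cov_scale_simps zero)
qed

lemma star_3_eq:
  "q \<in> chart \<Longrightarrow> g2_star flow_form 3 flow_form j q =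
     r ^ 4 \<cdot>\<^sub>c ((1/2) \<cdot>\<^sub>c (omega_at j q \<and>\<^sub>w omega_at j q) + c \<cdot>\<^sub>c (psi_plus_at j q \<and>\<^sub>w ds_cov))"
  unfolding g2_star_def by (rule coflow_stars(1))

text \<open>The star is an involution in dimension 7.\<close>

lemma star_4_eq:
  assumes q: "q \<in> chart" shows "g2_star flow_form 4 (g2_star flow_form 3 flow_form) j q = flow_form j q"
proof -
  have "g2_star flow_form 4 (g2_star flow_form 3 flow_form) j q = flow_star j q 4 (g2_star flow_form 3 flow_form j q)" by (simp add: g2_star_def)
  also have "\<dots> = r ^ 4 \<cdot>\<^sub>c ((1/2) \<cdot>\<^sub>c (2 * c / r) \<cdot>\<^sub>c (omega_at j q \<and>\<^sub>w ds_cov)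
      + c \<cdot>\<^sub>c - (1 / (c * r)) \<cdot>\<^sub>c psi_minus_at j q)"
    unfolding star_3_eq[OF q] hodge_star_linear coflow_stars(2,3)[OF q] ..
  also have "\<dots> = flow_form j q"
    unfolding coflow_form_at
    using c r by (intro ext) (simp add: cov_scale_apply field_simps power3_eq_cube power4_eq_xxxx)
  finally show ?thesis .
qed

lemma d_star_3:
  assumes q: "q \<in> chart" shows "exterior_derivative (g2_star flow_form 3 flow_form) j q = 0"
proof -
  note d = pulled_derivatives[OF q]
  have "differentiable_form (\<lambda>q. omega_at j q \<and>\<^sub>w omega_at j q) q" "differentiable_form (\<lambda>q. psi_plus_at j q \<and>\<^sub>w ds_cov) q"
    by (intro differentiable_form_wedge d differentiable_form_const)+
  note diff = this this[THEN differentiable_form_scale]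
  have "ext_deriv (\<lambda>q. r ^ 4 \<cdot>\<^sub>c ((1/2) \<cdot>\<^sub>c (omega_at j q \<and>\<^sub>w omega_at j q) + c \<cdot>\<^sub>c (psi_plus_at j q \<and>\<^sub>w ds_cov))) q =
      exterior_derivative (g2_star flow_form 3 flow_form) j q"
    unfolding exterior_derivative_eq
    by (rule ext_deriv_cong[OF open_chart q], erule star_3_eq[symmetric])
      (intro differentiable_form_scale differentiable_form_add diff)+
  also have "ext_deriv (\<lambda>q. r ^ 4 \<cdot>\<^sub>c ((1/2) \<cdot>\<^sub>c (omega_at j q \<and>\<^sub>w omega_at j q) + c \<cdot>\<^sub>c (psi_plus_at j q \<and>\<^sub>w ds_cov))) q = 0"
    by (simp add: ext_deriv_scale ext_deriv_add differentiable_form_add diff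
        pulled_wedge_derivatives[OF q] cov_scale_simps)
  finally show ?thesis by (rule sym)
qed

lemma d_phi:
  assumes q: "q \<in> chart"
  shows "exterior_derivative (g2_star flow_form 4 (g2_star flow_form 3 flow_form)) j q =
    r ^ 3 \<cdot>\<^sub>c (c \<cdot>\<^sub>c (- (3/2) * \<sigma>0) \<cdot>\<^sub>c (psi_plus_at j q \<and>\<^sub>w ds_cov) - \<sigma>0 \<cdot>\<^sub>c (omega_at j q \<and>\<^sub>w omega_at j q))"
proof -
  note d = pulled_derivatives[OF q]
  have diff: "differentiable_form (\<lambda>q. omega_at j q \<and>\<^sub>w ds_cov) q"
    by (intro differentiable_form_wedge d differentiable_form_const)
  have "ext_deriv (\<lambda>q. r ^ 3 \<cdot>\<^sub>c (c \<cdot>\<^sub>c (omega_at j q \<and>\<^sub>w ds_cov) - psi_minus_at j q)) q =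
      exterior_derivative (g2_star flow_form 4 (g2_star flow_form 3 flow_form)) j q"
    unfolding exterior_derivative_eq
    by (rule ext_deriv_cong[OF open_chart q],
        rule trans[OF coflow_form_at[symmetric] star_4_eq[symmetric]], assumption)
      (intro differentiable_form_scale differentiable_form_diff diff d)+
  also have "ext_deriv (\<lambda>q. r ^ 3 \<cdot>\<^sub>c (c \<cdot>\<^sub>c (omega_at j q \<and>\<^sub>w ds_cov) - psi_minus_at j q)) q =
    r ^ 3 \<cdot>\<^sub>c (c \<cdot>\<^sub>c (- (3/2) * \<sigma>0) \<cdot>\<^sub>c (psi_plus_at j q \<and>\<^sub>w ds_cov) - \<sigma>0 \<cdot>\<^sub>c (omega_at j q \<and>\<^sub>w omega_at j q))"
    by (simp only: ext_deriv_scale[OF differentiable_form_diff[OF differentiable_form_scale[OF diff] d(6)]]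
        ext_deriv_diff[OF differentiable_form_scale[OF diff] d(6)]
        ext_deriv_scale[OF diff] pulled_wedge_derivatives[OF q] d)
  finally show ?thesis by simp
qed

lemma codiff_star_3:
  assumes q: "q \<in> chart"
  shows "g2_codiff flow_form 4 (g2_star flow_form 3 flow_form) j q =
    (3/2 * \<sigma>0 * r\<^sup>2) \<cdot>\<^sub>c psi_minus_at j q - (2 * \<sigma>0 * c * r\<^sup>2) \<cdot>\<^sub>c (omega_at j q \<and>\<^sub>w ds_cov)"
proof -
  have "g2_codiff flow_form 4 (g2_star flow_form 3 flow_form) j q =
    flow_star j q 4 (exterior_derivative (g2_star flow_form 4 (g2_star flow_form 3 flow_form)) j q)"
    by (simp add: g2_codiff_def form_apply g2_star_def cov_scale_simps)
  also have "\<dots> = (3/2 * \<sigma>0 * r\<^sup>2) \<cdot>\<^sub>c psi_minus_at j q - (2 * \<sigma>0 * c * r\<^sup>2) \<cdot>\<^sub>c (omega_at j q \<and>\<^sub>w ds_cov)"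
    unfolding d_phi[OF q] hodge_star_linear coflow_stars(2,3)[OF q]
    using c r by (intro ext) (simp add: cov_scale_apply field_simps power2_eq_square power3_eq_cube)
  finally show ?thesis .
qed

text \<open>The summand \<open>d\<^sup>* d\<close> vanishes because the 4-form is closed; the other
  one is the derivative of \<open>codiff_star_3\<close>.\<close>

lemma coflow_laplacian:
  assumes q: "q \<in> chart"
  shows "g2_laplacian flow_form 4 (g2_star flow_form 3 flow_form) j q =
    (3 * \<sigma>0\<^sup>2 * r\<^sup>2) \<cdot>\<^sub>c ((1/2) \<cdot>\<^sub>c (omega_at j q \<and>\<^sub>w omega_at j q) + c \<cdot>\<^sub>c (psi_plus_at j q \<and>\<^sub>w ds_cov))"
proof -
  note d = pulled_derivatives[OF q]
  let ?a = "3/2 * \<sigma>0 * r\<^sup>2" and ?b = "2 * \<sigma>0 * c * r\<^sup>2"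
  have diff: "differentiable_form (\<lambda>q. omega_at j q \<and>\<^sub>w ds_cov) q"
    by (intro differentiable_form_wedge d differentiable_form_const)
  have "ext_deriv (\<lambda>q. ?a \<cdot>\<^sub>c psi_minus_at j q - ?b \<cdot>\<^sub>c (omega_at j q \<and>\<^sub>w ds_cov)) q =
      exterior_derivative (g2_codiff flow_form 4 (g2_star flow_form 3 flow_form)) j q"
    unfolding exterior_derivative_eq
    by (rule ext_deriv_cong[OF open_chart q], erule codiff_star_3[symmetric])
      (intro differentiable_form_scale differentiable_form_diff diff d)+
  moreover have "ext_deriv (\<lambda>q. ?a \<cdot>\<^sub>c psi_minus_at j q - ?b \<cdot>\<^sub>c (omega_at j q \<and>\<^sub>w ds_cov)) q =
      ?a \<cdot>\<^sub>c \<sigma>0 \<cdot>\<^sub>c (omega_at j q \<and>\<^sub>w omega_at j q) - ?b \<cdot>\<^sub>c (- (3/2) * \<sigma>0) \<cdot>\<^sub>c (psi_plus_at j q \<and>\<^sub>w ds_cov)"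
    by (simp only: ext_deriv_diff[OF differentiable_form_scale[OF d(6)] differentiable_form_scale[OF diff]]
        ext_deriv_scale[OF diff] ext_deriv_scale[OF d(6)] pulled_wedge_derivatives[OF q] d)
  moreover have "g2_codiff flow_form 5 (exterior_derivative (g2_star flow_form 3 flow_form)) j q = 0"
  proof -
    have star0: "flow_star j q' k 0 = 0" for q' k by (rule ext) (simp add: hodge_star_def)
    have "g2_star flow_form 5 (exterior_derivative (g2_star flow_form 3 flow_form)) j q' = 0" if "q' \<in> chart" for q'
      unfolding g2_star_def[of _ 5] d_star_3[OF that] by (rule star0)
    then have "exterior_derivative (g2_star flow_form 5 (exterior_derivative (g2_star flow_form 3 flow_form))) j q = 0"
      unfolding exterior_derivative_eq
      using ext_deriv_cong[OF open_chart q, of "\<lambda>q. 0"] differentiable_form_const ext_deriv_const by metis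
    then show ?thesis
      by (simp add: g2_codiff_def form_apply g2_star_def[of _ 3] star0 cov_scale_simps del: zero_fun_apply)
  qed
  ultimately have "g2_laplacian flow_form 4 (g2_star flow_form 3 flow_form) j q = ?a \<cdot>\<^sub>c \<sigma>0 \<cdot>\<^sub>c (omega_at j q \<and>\<^sub>w omega_at j q)
      - ?b \<cdot>\<^sub>c (- (3/2) * \<sigma>0) \<cdot>\<^sub>c (psi_plus_at j q \<and>\<^sub>w ds_cov)"
    unfolding g2_laplacian_def by simp
  then show ?thesis
    by (simp only:) (rule ext, simp add: cov_scale_apply field_simps power2_eq_square)
qed

end
end

theorem proposition4p4:
  fixes M :: "('i, 'p, real ^ 6) manifold"
    and \<omega> \<psi>p \<psi>m :: "('i, real ^ 6) form"
    and \<sigma>0 c :: real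
  assumes "smooth_manifold M"
    and "nearly_Kaehler M \<sigma>0 \<omega> \<psi>p \<psi>m"
    and "c \<noteq> 0"
  shows "let h = (\<lambda>t :: real. 1 - 3 * \<sigma>0\<^sup>2 / 2 * t);
             T = {..< 2 / (3 * \<sigma>0\<^sup>2)};
             \<phi> = (\<lambda>t. (h t powr (3 / 2)) \<cdot>\<^sub>f (c \<cdot>\<^sub>f (pull \<omega> \<and>\<^sub>f ds) - pull \<psi>m))
         in (\<forall>t\<in>T.
               warped_g2_structure M (\<lambda>p. c * h t powr (1 / 2))
                 (h t \<cdot>\<^sub>f \<omega>) ((h t powr (3 / 2)) \<cdot>\<^sub>f \<psi>p) ((h t powr (3 / 2)) \<cdot>\<^sub>f \<psi>m) (\<phi> t) \<and>
               form_eq (product_manifold M circle) (g2_star (\<phi> t) 3 (\<phi> t))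
                 ((h t)\<^sup>2 \<cdot>\<^sub>f ((1 / 2) \<cdot>\<^sub>f (pull \<omega> \<and>\<^sub>f pull \<omega>) + c \<cdot>\<^sub>f (pull \<psi>p \<and>\<^sub>f ds)))) \<and>
            laplacian_coflow (product_manifold M circle) T \<phi>"
proof -
  define h where "h = (\<lambda>t :: real. 1 - 3 * \<sigma>0\<^sup>2 / 2 * t)"
  define T where "T = {..< 2 / (3 * \<sigma>0\<^sup>2)}"
  define \<phi> where "\<phi> = (\<lambda>t. (h t powr (3 / 2)) \<cdot>\<^sub>f (c \<cdot>\<^sub>f (pull \<omega> \<and>\<^sub>f ds) - pull \<psi>m))"
  define \<Phi> where "\<Phi> = (1 / 2) \<cdot>\<^sub>f (pull \<omega> \<and>\<^sub>f pull \<omega>) + c \<cdot>\<^sub>f (pull \<psi>p \<and>\<^sub>f ds)"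
  note M = assms(1) and nk = assms(2) and c = assms(3)
  let ?P = "circle_product M"
  have "\<sigma>0 \<noteq> 0" and su3: "su3_structure M \<omega> \<psi>p \<psi>m" using nk unfolding nearly_Kaehler_def by auto
  have h_pos: "h t > 0" if "t \<in> T" for t
  proof -
    have "t * (3 * \<sigma>0\<^sup>2) < 2" using that \<open>\<sigma>0 \<noteq> 0\<close> unfolding T_def by (simp add: pos_less_divide_eq)
    then show ?thesis unfolding h_def by (simp add: mult.commute)
  qed
  define r where "r t = h t powr (1 / 2)" for t
  have r: "r t \<noteq> 0" "h t = (r t)\<^sup>2" "h t powr (3 / 2) = r t ^ 3" "(h t)\<^sup>2 = r t ^ 4" if "t \<in> T" for t
  proof -
    have "h t > 0" using h_pos that .
    then show "r t \<noteq> 0" by (simp add: r_def)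
    show "h t = (r t)\<^sup>2" "h t powr (3 / 2) = r t ^ 3" "(h t)\<^sup>2 = r t ^ 4"
      using \<open>h t > 0\<close> unfolding r_def by (simp_all add: powr_power)
  qed
  have \<phi>_eq: "\<phi> t = coflow_form c (r t) \<omega> \<psi>m" if "t \<in> T" for t
    unfolding \<phi>_def coflow_form_def r(3)[OF that] ..
  have \<Phi>_at: "\<Phi> j q = (1/2) \<cdot>\<^sub>c (pull_cov (\<omega> (fst j) (fst q)) \<and>\<^sub>w pull_cov (\<omega> (fst j) (fst q)))
      + c \<cdot>\<^sub>c (pull_cov (\<psi>p (fst j) (fst q)) \<and>\<^sub>w ds_cov)" for j q
    unfolding \<Phi>_def by (simp add: form_apply pull_apply ds_apply)
  have star: "g2_star (\<phi> t) 3 (\<phi> t) j q = (h t)\<^sup>2 \<cdot>\<^sub>c \<Phi> j q"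
    if "t \<in> T" "j \<in> Index ?P" "q \<in> chart_image ?P j" for t j q
    unfolding \<phi>_eq[OF that(1)] \<Phi>_at r(4)[OF that(1)]
    using star_3_eq[OF M nk c r(1)[OF that(1)] that(2,3)] .
  have warped: "warped_g2_structure M (\<lambda>p. c * h t powr (1 / 2))
       (h t \<cdot>\<^sub>f \<omega>) ((h t powr (3 / 2)) \<cdot>\<^sub>f \<psi>p) ((h t powr (3 / 2)) \<cdot>\<^sub>f \<psi>m) (\<phi> t)" if "t \<in> T" for t
    using warped_g2_structure_const[OF M su3_structure_scale[OF M su3 r(1)[OF that]] _ coflow_form_warped]
      c r(1)[OF that]
    unfolding \<phi>_eq[OF that] r(2,3)[OF that, symmetric] r_def[symmetric] by simp
  have "laplacian_coflow ?P T \<phi>"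
    unfolding laplacian_coflow_def
  proof (intro ballI conjI allI)
    fix t assume t: "t \<in> T"
    show "g2_structure ?P (\<phi> t)" using warped[OF t] unfolding warped_g2_structure_def by blast
    show "form_eq ?P (exterior_derivative (g2_star (\<phi> t) 3 (\<phi> t))) 0"
      unfolding form_eq_def \<phi>_eq[OF t] using d_star_3[OF M nk c r(1)[OF t]] by simp
    fix j q vs assume jq: "j \<in> Index ?P" "q \<in> chart_image ?P j"
    \<comment> \<open>The slope of \<open>h\<close> is chosen so that this derivative is minus the Laplacian.\<close>
    have "((\<lambda>\<tau>. (h \<tau>)\<^sup>2 * \<Phi> j q vs) has_real_derivative - (3 * \<sigma>0\<^sup>2 * h t) * \<Phi> j q vs) (at t within T)"
      unfolding h_def by (auto intro!: derivative_eq_intros simp: algebra_simps)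
    moreover have "g2_laplacian (\<phi> t) 4 (g2_star (\<phi> t) 3 (\<phi> t)) j q = (3 * \<sigma>0\<^sup>2 * h t) \<cdot>\<^sub>c \<Phi> j q"
      unfolding \<phi>_eq[OF t] \<Phi>_at r(2)[OF t] by (rule coflow_laplacian[OF M nk c r(1)[OF t] jq])
    ultimately have "((\<lambda>\<tau>. (h \<tau>)\<^sup>2 * \<Phi> j q vs) has_real_derivative
        - g2_laplacian (\<phi> t) 4 (g2_star (\<phi> t) 3 (\<phi> t)) j q vs) (at t within T)"
      by (simp add: cov_scale_apply)
    then show "((\<lambda>\<tau>. g2_star (\<phi> \<tau>) 3 (\<phi> \<tau>) j q vs) has_real_derivative
        - g2_laplacian (\<phi> t) 4 (g2_star (\<phi> t) 3 (\<phi> t)) j q vs) (at t within T)"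
      by (rule has_field_derivative_transform_within[OF _ zero_less_one t])
        (simp add: star jq cov_scale_apply)
  qed
  moreover have "form_eq ?P (g2_star (\<phi> t) 3 (\<phi> t)) ((h t)\<^sup>2 \<cdot>\<^sub>f \<Phi>)" if "t \<in> T" for t
    unfolding form_eq_def form_apply using star[OF that] by blast
  ultimately have "(\<forall>t\<in>T. warped_g2_structure M (\<lambda>p. c * h t powr (1 / 2))
       (h t \<cdot>\<^sub>f \<omega>) ((h t powr (3 / 2)) \<cdot>\<^sub>f \<psi>p) ((h t powr (3 / 2)) \<cdot>\<^sub>f \<psi>m) (\<phi> t) \<and>
       form_eq ?P (g2_star (\<phi> t) 3 (\<phi> t)) ((h t)\<^sup>2 \<cdot>\<^sub>f \<Phi>)) \<and> laplacian_coflow ?P T \<phi>"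
    using warped by blast
  then show ?thesis unfolding Let_def h_def T_def \<phi>_def \<Phi>_def .
qed

end
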